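(* Let $\delta\in\widehat K_M$ and $\alpha\in\Lambda$. Define, entrywise, $\Phi^{\delta,\lambda}_\alpha(z)=\big\langle\Pi^\lambda(z),\mathcal W^\lambda(P^\delta)\big\rangle^\lambda_\alpha$. Then $\Psi^{\delta,\lambda}_\alpha=\pi^{-n}(2|\lambda|)^n\,\Phi^{\delta,\lambda}_\alpha$. Consequently $\big(\theta^\lambda(p)\psi^\lambda_\alpha\big)(z)=\pi^{-n}(2|\lambda|)^n\big\langle\Pi^\lambda(z),\mathcal W^\lambda(p)\big\rangle^\lambda_\alpha$ whenever $p\in H_{\check\delta}$.
   Context: $\mathbb H^n=\mathbb C^n\times\mathbb R$ with product $(z,t)(z',t')=(z+z',t+t'+\mathrm{Im}(z\cdot\overline{z'}))$, $z\cdot w=\sum_jz_jw_j$; $U(n)$ acts by $k\cdot(z,t)=(k\cdot z,t)$. $K$ is a compact connected subgroup of $U(n)$ such that $(K,\mathbb H^n)$ is a Gelfand pair (the convolution algebra of $K$-invariant $L^1$ functions on $\mathbb H^n$ is commutative), and the $K$-action on $\mathbb C^n\cong\mathbb R^{2n}$ is polar: there is a real linear subspace $T$ meeting every $K$-orbit with $(\mathfrak k\cdot x,T)=0$ for all $x\in T$ ($\mathfrak k$ the Lie algebra of $K$). Fix such $T$; $M=\{k\in K:k\cdot q=q\ \forall q\in T\}$. $\lambda$ is a fixed non-zero real number. $\mathcal H^\lambda$: entire $u$ on $\mathbb C^n$ with $\|u\|^2=(2|\lambda|/\pi)^n\int|u(w)|^2e^{-2|\lambda||w|^2}dw<\infty$;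 $\mathcal P(\mathbb C^n)$: holomorphic polynomials. $(\Pi^\lambda(z)u)(w)=u(w+\bar z)e^{-2\lambda(w\cdot z+|z|^2/2)}$ if $\lambda>0$, $u(w-z)e^{2\lambda(-w\cdot\bar z+|z|^2/2)}$ if $\lambda<0$. $\mathcal P(\mathbb C^n)=\bigoplus_{\alpha\in\Lambda}V_\alpha$ is the decomposition into $K$-irreducible subspaces for the action $(k\cdot u)(w)=u(k^{-1}\cdot w)$, each $V_\alpha$ consisting of homogeneous polynomials of one degree. $\psi^\lambda_\alpha(z)=\frac1{\kappa^\lambda_\alpha}\int_K\langle\Pi^\lambda(k\cdot z)v,v\rangle dk$ for any unit $v\in V_\alpha$ (normalized Haar measure), $\kappa^\lambda_\alpha$ being the squared $L^2$ norm of $z\mapsto\int_K\langle\Pi^\lambda(k\cdot z)v,v\rangle dk$. $\langle R,R'\rangle^\lambda_\alpha=\sum_j\langle Rv_j,R'v_j\rangle$ for an orthonormal basis $\{v_j\}$ of $V_\alpha$ (linear in the first variable). $\widehat K_M$: irreducible unitary representations $\delta$ of $K$ on $V_\delta$ with a nonzero $M$-fixed vector; $d(\delta)=\dim V_\delta$, $l(\delta)=\dim V_\delta^M$; $v_1,\dots,v_{d(\delta)}$ an orthonormal basis of $V_\delta$ whose first $l(\delta)$ vectors span $V_\delta^M$; $\check\delta$ the contragredient on $V_{\check\delta}=V_\delta^*$ with dual basis $v_i^*$. $H$: $K$-harmonic polynomials (polynomials in $z,\bar z$ annihilated by all $i(\partial)$, $i$ a $K$-invariant polynomial on $\mathbb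 R^{2n}$ without constant term); $H_{\check\delta}$: its subspace of type $\check\delta$; $\eta_1,\dots,\eta_{l(\delta)}$ a basis of $\mathrm{Hom}_K(V_{\check\delta},H_{\check\delta})$; $P^\delta_{ij}=\eta_j(v_i^* )$, a $d(\delta)\times l(\delta)$ matrix of polynomials. $R^\lambda_j=\partial/\partial\bar z_j+\lambda z_j$, $\overline R^\lambda_j=\partial/\partial z_j-\lambda\bar z_j$. On $\mathcal P(\mathbb C^n)$, for $\lambda>0$, $\overline W^\lambda_j$ is multiplication by $2|\lambda|w_j$ and $W^\lambda_j=\partial/\partial w_j$; for $\lambda<0$ interchanged. $\theta^\lambda$ is the linear extension of $\theta^\lambda(\zeta^\rho\bar\zeta^\gamma)=\frac12[(\overline R^\lambda)^\gamma(-R^\lambda)^\rho+(-R^\lambda)^\rho(\overline R^\lambda)^\gamma]$, and for $K$-harmonic $p$ the Weyl correspondence $\mathcal W^\lambda(p)$ is given by the linear extension of $\zeta^\rho\bar\zeta^\gamma\mapsto\frac12[(\overline W^\lambda)^\gamma(W^\lambda)^\rho+(W^\lambda)^\rho(\overline W^\lambda)^\gamma]$; both applied entrywise to $P^\delta$. $\Psi^{\delta,\lambda}_\alpha=\theta^\lambda(P^\delta)\psi^\lambda_\alpha$.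
   Formalization: The inner product is taken linear in the second variable (not the first), and for λ>0 the V_α are K-irreducible for the action u(w) ↦ u(conj(k)^{-1}·w) instead of u(k^{-1}·w); with the conventions as printed the identity fails. *)

theory Defs
  imports
    "HOL-Analysis.Analysis"
    "HOL-Library.Poly_Mapping"
    "HOL-Library.Function_Algebras"
begin

section \<open>The Heisenberg group and Gelfand pairs\<close>

text \<open>The complex space of dimension \<open>n\<close> is \<open>complex ^ 'n\<close> with \<open>n = CARD('n)\<close>; its real inner
  product (the library's \<open>\<bullet>\<close>), its norm and \<^const>\<open>lborel\<close> are those of the real space of dimension
  \<open>2n\<close>.\<close>

definition cdot :: "complex ^ 'n \<Rightarrow> complex ^ 'n \<Rightarrow> complex" where
  "cdot z w = (\<Sum>j\<in>UNIV. z $ j * w $ j)"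

definition vcnj :: "complex ^ 'n \<Rightarrow> complex ^ 'n" where
  "vcnj z = (\<chi> j. cnj (z $ j))"

definition mcnj :: "complex ^ 'n ^ 'm \<Rightarrow> complex ^ 'n ^ 'm" where
  "mcnj A = (\<chi> i j. cnj (A $ i $ j))"

definition hmul :: "(complex ^ 'n) \<times> real \<Rightarrow> (complex ^ 'n) \<times> real \<Rightarrow> (complex ^ 'n) \<times> real" where
  "hmul x y = (fst x + fst y, snd x + snd y + Im (cdot (fst x) (vcnj (fst y))))"

definition hinv :: "(complex ^ 'n) \<times> real \<Rightarrow> (complex ^ 'n) \<times> real" where
  "hinv x = (- fst x, - snd x)"

definition unitary :: "complex ^ 'n ^ 'n \<Rightarrow> bool" where
  "unitary A \<longleftrightarrow> A ** transpose (mcnj A) = mat 1 \<and> transpose (mcnj A) ** A = mat 1"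

definition unitary_subgroup :: "(complex ^ 'n ^ 'n) set \<Rightarrow> bool" where
  "unitary_subgroup K \<longleftrightarrow> (\<forall>k\<in>K. unitary k) \<and> mat 1 \<in> K \<and>
     (\<forall>k\<in>K. \<forall>k'\<in>K. k ** k' \<in> K) \<and> (\<forall>k\<in>K. matrix_inv k \<in> K)"

definition normalized_haar :: "(complex ^ 'n ^ 'n) set \<Rightarrow> (complex ^ 'n ^ 'n) measure \<Rightarrow> bool" where
  "normalized_haar K \<mu> \<longleftrightarrow> sets \<mu> = sets (restrict_space borel K) \<and> emeasure \<mu> K = 1 \<and>
     (\<forall>k\<in>K. distr \<mu> \<mu> (\<lambda>k'. k ** k') = \<mu>)"

text \<open>Elements of \<open>L\<^sup>1\<close> are represented by integrable functions; identities between them hold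
  almost everywhere. Lebesgue measure is a Haar measure of the Heisenberg group.\<close>

definition invariant_L1 :: "(complex ^ 'n ^ 'n) set \<Rightarrow> ((complex ^ 'n) \<times> real \<Rightarrow> complex) set" where
  "invariant_L1 K = {f. integrable lborel f \<and>
     (\<forall>k\<in>K. AE x in lborel. f (k *v fst x, snd x) = f x)}"

definition hconv :: "((complex ^ 'n) \<times> real \<Rightarrow> complex) \<Rightarrow> ((complex ^ 'n) \<times> real \<Rightarrow> complex) \<Rightarrow>
    (complex ^ 'n) \<times> real \<Rightarrow> complex" where
  "hconv f g x = (LINT y|lborel. f y * g (hmul (hinv y) x))"

definition gelfand_pair :: "(complex ^ 'n ^ 'n) set \<Rightarrow> bool" where
  "gelfand_pair K \<longleftrightarrow> (\<forall>f\<in>invariant_L1 K. \<forall>g\<in>invariant_L1 K.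
     AE x in lborel. hconv f g x = hconv g f x)"

section \<open>Polar actions\<close>

definition mexp :: "complex ^ 'n ^ 'n \<Rightarrow> complex ^ 'n ^ 'n" where
  "mexp X = suminf (\<lambda>m. (1 / fact m) *\<^sub>R ((\<lambda>Y. X ** Y) ^^ m) (mat 1))"

definition lie_algebra :: "(complex ^ 'n ^ 'n) set \<Rightarrow> (complex ^ 'n ^ 'n) set" where
  "lie_algebra K = {X. \<forall>t::real. mexp (t *\<^sub>R X) \<in> K}"

definition polar_section :: "(complex ^ 'n ^ 'n) set \<Rightarrow> (complex ^ 'n) set \<Rightarrow> bool" where
  "polar_section K T \<longleftrightarrow> subspace T \<and> (\<forall>x. \<exists>k\<in>K. k *v x \<in> T) \<and>
     (\<forall>x\<in>T. \<forall>X\<in>lie_algebra K. \<forall>y\<in>T. (X *v x) \<bullet> y = 0)"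

definition fixer :: "(complex ^ 'n ^ 'n) set \<Rightarrow> (complex ^ 'n) set \<Rightarrow> (complex ^ 'n ^ 'n) set" where
  "fixer K T = {k \<in> K. \<forall>q\<in>T. k *v q = q}"

section \<open>Polynomials and differential operators\<close>

definition fscale :: "complex \<Rightarrow> ('a \<Rightarrow> complex) \<Rightarrow> 'a \<Rightarrow> complex" where
  "fscale c u = (\<lambda>w. c * u w)"

global_interpretation cfun: vector_space "fscale :: complex \<Rightarrow> ('a \<Rightarrow> complex) \<Rightarrow> 'a \<Rightarrow> complex"
  by unfold_locales (auto simp: fscale_def fun_eq_iff algebra_simps)

text \<open>A polynomial in \<open>z\<close> and the conjugate of \<open>z\<close> is given by its coefficients: the key
  \<open>(\<rho>, \<gamma>)\<close> stands for the monomial with exponent \<open>\<rho>\<close> in \<open>z\<close> and \<open>\<gamma>\<close> in the conjugate.\<close>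

type_synonym 'n cpoly = "((nat ^ 'n) \<times> (nat ^ 'n)) \<Rightarrow>\<^sub>0 complex"

definition pscale :: "complex \<Rightarrow> ('a \<Rightarrow>\<^sub>0 complex) \<Rightarrow> 'a \<Rightarrow>\<^sub>0 complex" where
  "pscale c p = Poly_Mapping.map (\<lambda>x. c * x) p"

lemma lookup_pscale [simp]: "Poly_Mapping.lookup (pscale c p) a = c * Poly_Mapping.lookup p a"
  by (auto simp: pscale_def Poly_Mapping.map.rep_eq when_def)

global_interpretation cpol: vector_space "pscale :: complex \<Rightarrow> ('a \<Rightarrow>\<^sub>0 complex) \<Rightarrow> 'a \<Rightarrow>\<^sub>0 complex"
  by unfold_locales (auto intro!: poly_mapping_eqI simp: lookup_add algebra_simps)

definition cmonom :: "nat ^ 'n \<Rightarrow> complex ^ 'n \<Rightarrow> complex" where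
  "cmonom \<rho> z = (\<Prod>j\<in>UNIV. z $ j ^ (\<rho> $ j))"

definition ceval :: "'n::finite cpoly \<Rightarrow> complex ^ 'n \<Rightarrow> complex" where
  "ceval p z =
     (\<Sum>(\<rho>, \<gamma>)\<in>Poly_Mapping.keys p. Poly_Mapping.lookup p (\<rho>, \<gamma>) * cmonom \<rho> z * cmonom \<gamma> (vcnj z))"

definition hol_polys :: "(complex ^ 'n \<Rightarrow> complex) set" where
  "hol_polys = {u. \<exists>p :: (nat ^ 'n) \<Rightarrow>\<^sub>0 complex.
     \<forall>w. u w = (\<Sum>\<rho>\<in>Poly_Mapping.keys p. Poly_Mapping.lookup p \<rho> * cmonom \<rho> w)}"

definition homogeneous_deg :: "nat \<Rightarrow> (complex ^ 'n \<Rightarrow> complex) \<Rightarrow> bool" where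
  "homogeneous_deg m u \<longleftrightarrow> (\<forall>c w. u (c *s w) = c ^ m * u w)"

text \<open>\<open>dx j\<close>, \<open>dy j\<close>: derivatives in the real and imaginary part of \<open>z\<^sub>j\<close>; \<open>dz j\<close>, \<open>dzb j\<close>:
  derivatives in \<open>z\<^sub>j\<close> and its conjugate. On holomorphic functions \<open>dz j\<close> is the complex partial
  derivative.\<close>

definition dx :: "'n \<Rightarrow> (complex ^ 'n \<Rightarrow> complex) \<Rightarrow> complex ^ 'n \<Rightarrow> complex" where
  "dx j f = (\<lambda>z. vector_derivative (\<lambda>t::real. f (z + t *\<^sub>R axis j 1)) (at 0))"

definition dy :: "'n \<Rightarrow> (complex ^ 'n \<Rightarrow> complex) \<Rightarrow> complex ^ 'n \<Rightarrow> complex" where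
  "dy j f = (\<lambda>z. vector_derivative (\<lambda>t::real. f (z + t *\<^sub>R axis j \<i>)) (at 0))"

definition dz :: "'n \<Rightarrow> (complex ^ 'n \<Rightarrow> complex) \<Rightarrow> complex ^ 'n \<Rightarrow> complex" where
  "dz j f = (\<lambda>z. (dx j f z - \<i> * dy j f z) / 2)"

definition dzb :: "'n \<Rightarrow> (complex ^ 'n \<Rightarrow> complex) \<Rightarrow> complex ^ 'n \<Rightarrow> complex" where
  "dzb j f = (\<lambda>z. (dx j f z + \<i> * dy j f z) / 2)"

text \<open>\<open>opow A \<rho>\<close> is the product over \<open>j\<close> of the powers \<open>A j ^^ (\<rho> $ j)\<close>. It is used only where
  the operators \<open>A j\<close> commute with each other (on smooth functions), so that the order of the
  factors is immaterial.\<close>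

definition index_list :: "'n::finite list" where
  "index_list = (SOME js. set js = UNIV \<and> distinct js)"

definition opow :: "('n::finite \<Rightarrow> 'f \<Rightarrow> 'f) \<Rightarrow> nat ^ 'n \<Rightarrow> 'f \<Rightarrow> 'f" where
  "opow A \<rho> = foldr (\<lambda>j g. (A j ^^ (\<rho> $ j)) \<circ> g) index_list id"

text \<open>The operator \<open>i(\<partial>)\<close>: substituting the real partial derivatives for the real coordinates
  turns \<open>z\<^sub>j\<close> into \<open>dx j + \<i> dy j\<close> and its conjugate into \<open>dx j - \<i> dy j\<close>.\<close>

definition const_coeff_op :: "'n::finite cpoly \<Rightarrow> (complex ^ 'n \<Rightarrow> complex) \<Rightarrow> complex ^ 'n \<Rightarrow> complex" where
  "const_coeff_op i f = (\<lambda>z. \<Sum>(\<rho>, \<gamma>)\<in>Poly_Mapping.keys i. Poly_Mapping.lookup i (\<rho>, \<gamma>) *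
     opow (\<lambda>j g w. dx j g w + \<i> * dy j g w) \<rho> (opow (\<lambda>j g w. dx j g w - \<i> * dy j g w) \<gamma> f) z)"

definition K_harmonic :: "(complex ^ 'n ^ 'n) set \<Rightarrow> 'n::finite cpoly set" where
  "K_harmonic K = {p. \<forall>i :: 'n cpoly.
     (\<forall>k\<in>K. \<forall>z. ceval i (k *v z) = ceval i z) \<longrightarrow> Poly_Mapping.lookup i (0, 0) = 0 \<longrightarrow>
     (\<forall>z. const_coeff_op i (ceval p) z = 0)}"

section \<open>The Fock space and its decomposition under K\<close>

text \<open>The inner product of the Fock space, linear in the second and conjugate linear in the first
  variable. This is the convention under which the pairing of \<open>\<Pi>(z)\<close> with \<open>W(p)\<close>, in this order,
  is complex linear in \<open>p\<close>, as \<open>\<theta>(p)\<psi>\<close> is.\<close>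

definition fock_inner :: "real \<Rightarrow> (complex ^ 'n \<Rightarrow> complex) \<Rightarrow> (complex ^ 'n \<Rightarrow> complex) \<Rightarrow> complex" where
  "fock_inner lam u v = of_real ((2 * \<bar>lam\<bar> / pi) ^ CARD('n)) *
     (LINT w|lborel. cnj (u w) * v w * of_real (exp (- 2 * \<bar>lam\<bar> * (norm w)\<^sup>2)))"

definition fock_rep :: "real \<Rightarrow> complex ^ 'n \<Rightarrow> (complex ^ 'n \<Rightarrow> complex) \<Rightarrow> complex ^ 'n \<Rightarrow> complex" where
  "fock_rep lam z u = (\<lambda>w.
     if lam > 0 then u (w + vcnj z) * exp (- 2 * of_real lam * (cdot w z + of_real ((norm z)\<^sup>2 / 2)))
     else u (w - z) * exp (2 * of_real lam * (- cdot w (vcnj z) + of_real ((norm z)\<^sup>2 / 2))))"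

text \<open>The action of \<open>K\<close> on the Fock space for which \<open>\<Pi>(k z) = k \<Pi>(z) k\<^sup>-\<^sup>1\<close>. For negative
  \<open>lam\<close> it is \<open>(k u)(w) = u(k\<^sup>-\<^sup>1 w)\<close>. For positive \<open>lam\<close>, where \<open>\<Pi>(z)\<close> translates by the
  conjugate of \<open>z\<close>, the element \<open>k\<close> has to act through its entrywise conjugate; the invariant
  subspaces are the same as those of the former action if \<open>K\<close> is closed under entrywise
  conjugation.\<close>

definition fock_act :: "real \<Rightarrow> complex ^ 'n ^ 'n \<Rightarrow> (complex ^ 'n \<Rightarrow> complex) \<Rightarrow> complex ^ 'n \<Rightarrow> complex" where
  "fock_act lam k u = (\<lambda>w. u ((if lam > 0 then mcnj (matrix_inv k) else matrix_inv k) *v w))"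

definition fock_invariant :: "real \<Rightarrow> (complex ^ 'n ^ 'n) set \<Rightarrow> (complex ^ 'n \<Rightarrow> complex) set \<Rightarrow> bool" where
  "fock_invariant lam K V \<longleftrightarrow> cfun.subspace V \<and> (\<forall>k\<in>K. \<forall>u\<in>V. fock_act lam k u \<in> V)"

definition fock_irreducible :: "real \<Rightarrow> (complex ^ 'n ^ 'n) set \<Rightarrow> (complex ^ 'n \<Rightarrow> complex) set \<Rightarrow> bool" where
  "fock_irreducible lam K V \<longleftrightarrow> fock_invariant lam K V \<and> V \<noteq> {0} \<and>
     (\<forall>U. U \<subseteq> V \<and> fock_invariant lam K U \<longrightarrow> U = {0} \<or> U = V)"

definition polys_decomposition ::
  "real \<Rightarrow> (complex ^ 'n ^ 'n) set \<Rightarrow> 'a set \<Rightarrow> ('a \<Rightarrow> (complex ^ 'n \<Rightarrow> complex) set) \<Rightarrow> bool" where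
  "polys_decomposition lam K \<Lambda> V \<longleftrightarrow>
     (\<forall>\<alpha>\<in>\<Lambda>. fock_irreducible lam K (V \<alpha>) \<and> (\<exists>m. \<forall>u\<in>V \<alpha>. homogeneous_deg m u)) \<and>
     cfun.span (\<Union>\<alpha>\<in>\<Lambda>. V \<alpha>) = hol_polys \<and>
     (\<forall>F u. finite F \<and> F \<subseteq> \<Lambda> \<and> (\<forall>\<alpha>\<in>F. u \<alpha> \<in> V \<alpha>) \<and> (\<Sum>\<alpha>\<in>F. u \<alpha>) = 0 \<longrightarrow> (\<forall>\<alpha>\<in>F. u \<alpha> = 0))"

definition fock_onb :: "real \<Rightarrow> (complex ^ 'n \<Rightarrow> complex) set \<Rightarrow> (complex ^ 'n \<Rightarrow> complex) set \<Rightarrow> bool" where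
  "fock_onb lam V B \<longleftrightarrow> finite B \<and> cfun.span B = V \<and>
     (\<forall>b\<in>B. \<forall>b'\<in>B. fock_inner lam b b' = (if b = b' then 1 else 0))"

definition op_pairing :: "real \<Rightarrow> (complex ^ 'n \<Rightarrow> complex) set \<Rightarrow>
    ((complex ^ 'n \<Rightarrow> complex) \<Rightarrow> complex ^ 'n \<Rightarrow> complex) \<Rightarrow>
    ((complex ^ 'n \<Rightarrow> complex) \<Rightarrow> complex ^ 'n \<Rightarrow> complex) \<Rightarrow> complex" where
  "op_pairing lam B R R' = (\<Sum>b\<in>B. fock_inner lam (R b) (R' b))"

definition averaged_coeff ::
  "real \<Rightarrow> (complex ^ 'n ^ 'n) measure \<Rightarrow> (complex ^ 'n \<Rightarrow> complex) \<Rightarrow> complex ^ 'n \<Rightarrow> complex" where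
  "averaged_coeff lam \<mu> v z = (LINT k|\<mu>. fock_inner lam (fock_rep lam (k *v z) v) v)"

definition kappa :: "real \<Rightarrow> (complex ^ 'n ^ 'n) measure \<Rightarrow> (complex ^ 'n \<Rightarrow> complex) \<Rightarrow> real" where
  "kappa lam \<mu> v = (LINT z|lborel. (norm (averaged_coeff lam \<mu> v z))\<^sup>2)"

definition psi ::
  "real \<Rightarrow> (complex ^ 'n ^ 'n) measure \<Rightarrow> (complex ^ 'n \<Rightarrow> complex) \<Rightarrow> complex ^ 'n \<Rightarrow> complex" where
  "psi lam \<mu> v z = averaged_coeff lam \<mu> v z / of_real (kappa lam \<mu> v)"

section \<open>The maps \<open>\<theta>\<close> and the Weyl correspondence\<close>

definition R_op :: "real \<Rightarrow> 'n \<Rightarrow> (complex ^ 'n \<Rightarrow> complex) \<Rightarrow> complex ^ 'n \<Rightarrow> complex" where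
  "R_op lam j f = (\<lambda>z. dzb j f z + of_real lam * z $ j * f z)"

definition Rbar_op :: "real \<Rightarrow> 'n \<Rightarrow> (complex ^ 'n \<Rightarrow> complex) \<Rightarrow> complex ^ 'n \<Rightarrow> complex" where
  "Rbar_op lam j f = (\<lambda>z. dz j f z - of_real lam * cnj (z $ j) * f z)"

definition W_op :: "real \<Rightarrow> 'n \<Rightarrow> (complex ^ 'n \<Rightarrow> complex) \<Rightarrow> complex ^ 'n \<Rightarrow> complex" where
  "W_op lam j u = (if lam > 0 then dz j u else (\<lambda>w. 2 * of_real \<bar>lam\<bar> * w $ j * u w))"

definition Wbar_op :: "real \<Rightarrow> 'n \<Rightarrow> (complex ^ 'n \<Rightarrow> complex) \<Rightarrow> complex ^ 'n \<Rightarrow> complex" where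
  "Wbar_op lam j u = (if lam > 0 then (\<lambda>w. 2 * of_real \<bar>lam\<bar> * w $ j * u w) else dz j u)"

definition theta :: "real \<Rightarrow> 'n::finite cpoly \<Rightarrow> (complex ^ 'n \<Rightarrow> complex) \<Rightarrow> complex ^ 'n \<Rightarrow> complex" where
  "theta lam p f = (\<lambda>z. \<Sum>(\<rho>, \<gamma>)\<in>Poly_Mapping.keys p. Poly_Mapping.lookup p (\<rho>, \<gamma>) * (1 / 2) *
     (opow (Rbar_op lam) \<gamma> (opow (\<lambda>j g. - R_op lam j g) \<rho> f) z +
      opow (\<lambda>j g. - R_op lam j g) \<rho> (opow (Rbar_op lam) \<gamma> f) z))"

definition weyl :: "real \<Rightarrow> 'n::finite cpoly \<Rightarrow> (complex ^ 'n \<Rightarrow> complex) \<Rightarrow> complex ^ 'n \<Rightarrow> complex" where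
  "weyl lam p u = (\<lambda>w. \<Sum>(\<rho>, \<gamma>)\<in>Poly_Mapping.keys p. Poly_Mapping.lookup p (\<rho>, \<gamma>) * (1 / 2) *
     (opow (Wbar_op lam) \<gamma> (opow (W_op lam) \<rho> u) w +
      opow (W_op lam) \<rho> (opow (Wbar_op lam) \<gamma> u) w))"

section \<open>Representations of K and the matrix P\<close>

text \<open>A finite-dimensional unitary representation is given on \<open>complex ^ 'd\<close> with its standard
  Hermitian inner product, so its dimension is \<open>CARD('d)\<close>.\<close>

definition herm :: "complex ^ 'd \<Rightarrow> complex ^ 'd \<Rightarrow> complex" where
  "herm x y = cdot x (vcnj y)"

definition irred_unitary_rep ::
  "(complex ^ 'n ^ 'n) set \<Rightarrow> (complex ^ 'n ^ 'n \<Rightarrow> complex ^ 'd ^ 'd) \<Rightarrow> bool" where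
  "irred_unitary_rep K \<delta> \<longleftrightarrow> continuous_on K \<delta> \<and> (\<forall>k\<in>K. unitary (\<delta> k)) \<and>
     (\<forall>k\<in>K. \<forall>k'\<in>K. \<delta> (k ** k') = \<delta> k ** \<delta> k') \<and>
     (\<forall>U. vec.subspace U \<and> (\<forall>k\<in>K. \<forall>x\<in>U. \<delta> k *v x \<in> U) \<longrightarrow> U = {0} \<or> U = UNIV)"

definition fixed_space ::
  "(complex ^ 'n ^ 'n) set \<Rightarrow> (complex ^ 'n ^ 'n \<Rightarrow> complex ^ 'd ^ 'd) \<Rightarrow> (complex ^ 'd) set" where
  "fixed_space M \<delta> = {x. \<forall>m\<in>M. \<delta> m *v x = x}"

definition khat :: "(complex ^ 'n ^ 'n) set \<Rightarrow> (complex ^ 'n ^ 'n) set \<Rightarrow>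
    (complex ^ 'n ^ 'n \<Rightarrow> complex ^ 'd ^ 'd) set" where
  "khat K M = {\<delta>. irred_unitary_rep K \<delta> \<and> (\<exists>x\<in>fixed_space M \<delta>. x \<noteq> 0)}"

definition adapted_onb :: "(complex ^ 'n ^ 'n) set \<Rightarrow> (complex ^ 'n ^ 'n \<Rightarrow> complex ^ 'd ^ 'd) \<Rightarrow>
    (nat \<Rightarrow> complex ^ 'd) \<Rightarrow> bool" where
  "adapted_onb M \<delta> v \<longleftrightarrow>
     (\<forall>i<CARD('d). \<forall>i'<CARD('d). herm (v i) (v i') = (if i = i' then 1 else 0)) \<and>
     vec.span (v ` {..<vec.dim (fixed_space M \<delta>)}) = fixed_space M \<delta>"

definition dual_space :: "(complex ^ 'd \<Rightarrow> complex) set" where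
  "dual_space = {f. Vector_Spaces.linear (*s) (*) f}"

definition is_dual_basis :: "(nat \<Rightarrow> complex ^ 'd) \<Rightarrow> (nat \<Rightarrow> complex ^ 'd \<Rightarrow> complex) \<Rightarrow> bool" where
  "is_dual_basis v v' \<longleftrightarrow> (\<forall>i<CARD('d). v' i \<in> dual_space \<and>
     (\<forall>i'<CARD('d). v' i (v i') = (if i = i' then 1 else 0)))"

definition contragredient :: "(complex ^ 'n ^ 'n \<Rightarrow> complex ^ 'd ^ 'd) \<Rightarrow> complex ^ 'n ^ 'n \<Rightarrow>
    (complex ^ 'd \<Rightarrow> complex) \<Rightarrow> complex ^ 'd \<Rightarrow> complex" where
  "contragredient \<delta> k f = (\<lambda>x. f (\<delta> (matrix_inv k) *v x))"

text \<open>Intertwining maps from the dual space to a space \<open>U\<close> of polynomials, on which \<open>K\<close> acts by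
  \<open>(k p)(z) = p(k\<^sup>-\<^sup>1 z)\<close>. Their values outside \<^const>\<open>dual_space\<close> are irrelevant.\<close>

definition Hom_K :: "(complex ^ 'n ^ 'n) set \<Rightarrow> (complex ^ 'n ^ 'n \<Rightarrow> complex ^ 'd ^ 'd) \<Rightarrow>
    'n::finite cpoly set \<Rightarrow> ((complex ^ 'd \<Rightarrow> complex) \<Rightarrow> 'n cpoly) set" where
  "Hom_K K \<delta> U = {\<eta>. (\<forall>f\<in>dual_space. \<eta> f \<in> U) \<and>
     (\<forall>f\<in>dual_space. \<forall>g\<in>dual_space. \<eta> (f + g) = \<eta> f + \<eta> g) \<and>
     (\<forall>c. \<forall>f\<in>dual_space. \<eta> (fscale c f) = pscale c (\<eta> f)) \<and>
     (\<forall>k\<in>K. \<forall>f\<in>dual_space. \<forall>z. ceval (\<eta> (contragredient \<delta> k f)) z = ceval (\<eta> f) (matrix_inv k *v z))}"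

text \<open>The isotypic subspace: the sum of all subspaces of the \<open>K\<close>-harmonic polynomials that are
  isomorphic to the contragredient of \<open>\<delta>\<close>.\<close>

definition H_check :: "(complex ^ 'n ^ 'n) set \<Rightarrow> (complex ^ 'n ^ 'n \<Rightarrow> complex ^ 'd ^ 'd) \<Rightarrow>
    'n::finite cpoly set" where
  "H_check K \<delta> = cpol.span (\<Union>{\<eta> ` dual_space |\<eta>. \<eta> \<in> Hom_K K \<delta> (K_harmonic K) \<and> inj_on \<eta> dual_space})"

definition Hom_basis :: "(complex ^ 'n ^ 'n) set \<Rightarrow> (complex ^ 'n ^ 'n \<Rightarrow> complex ^ 'd ^ 'd) \<Rightarrow>
    nat \<Rightarrow> (nat \<Rightarrow> (complex ^ 'd \<Rightarrow> complex) \<Rightarrow> 'n::finite cpoly) \<Rightarrow> bool" where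
  "Hom_basis K \<delta> l \<eta> \<longleftrightarrow> (\<forall>j<l. \<eta> j \<in> Hom_K K \<delta> (H_check K \<delta>)) \<and>
     (\<forall>h\<in>Hom_K K \<delta> (H_check K \<delta>). \<exists>c. \<forall>f\<in>dual_space. h f = (\<Sum>j<l. pscale (c j) (\<eta> j f))) \<and>
     (\<forall>c. (\<forall>f\<in>dual_space. (\<Sum>j<l. pscale (c j) (\<eta> j f)) = 0) \<longrightarrow> (\<forall>j<l. c j = 0))"

text \<open>\<open>P\<close> is the matrix of polynomials, \<open>v\<close> a unit vector and \<open>B\<close> an orthonormal basis of the
  subspace with index \<open>\<alpha>\<close>.\<close>

definition Pmat :: "(nat \<Rightarrow> (complex ^ 'd \<Rightarrow> complex) \<Rightarrow> 'n::finite cpoly) \<Rightarrow>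
    (nat \<Rightarrow> complex ^ 'd \<Rightarrow> complex) \<Rightarrow> nat \<Rightarrow> nat \<Rightarrow> 'n cpoly" where
  "Pmat \<eta> v' i j = \<eta> j (v' i)"

definition Psi :: "real \<Rightarrow> (complex ^ 'n ^ 'n) measure \<Rightarrow> (complex ^ 'n \<Rightarrow> complex) \<Rightarrow>
    (nat \<Rightarrow> nat \<Rightarrow> 'n::finite cpoly) \<Rightarrow> nat \<Rightarrow> nat \<Rightarrow> complex ^ 'n \<Rightarrow> complex" where
  "Psi lam \<mu> v P i j = theta lam (P i j) (psi lam \<mu> v)"

definition Phi :: "real \<Rightarrow> (complex ^ 'n \<Rightarrow> complex) set \<Rightarrow>
    (nat \<Rightarrow> nat \<Rightarrow> 'n::finite cpoly) \<Rightarrow> nat \<Rightarrow> nat \<Rightarrow> complex ^ 'n \<Rightarrow> complex" where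
  "Phi lam B P i j z = op_pairing lam B (fock_rep lam z) (weyl lam (P i j))"

end

theory Submission
  imports Defs "HOL-Probability.Distributions" "HOL-Computational_Algebra.Fundamental_Theorem_Algebra"
begin

text \<open>The operators \<open>- R\<^sub>j\<close> and \<open>R\<^sub>j\<close>-bar carry a matrix coefficient of \<open>\<Pi>(z)\<close> at \<open>(u, v)\<close> to the
  ones at \<open>(u, W\<^sub>j v)\<close> and \<open>(u, W\<^sub>j\<close>-bar\<open> v)\<close>: differentiate under the integral sign and integrate
  by parts. Hence \<open>\<theta>(p)\<close> carries the trace of \<open>\<Pi>(z)\<close> on \<open>V\<^sub>\<alpha>\<close> to its pairing with \<open>W(p)\<close>, and it
  remains to identify \<open>\<psi>\<^sub>\<alpha>\<close> with \<open>(2 |\<lambda>| / \<pi>)\<^sup>n\<close> times that trace. By Schur's lemma the averaged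
  coefficient is the trace divided by \<open>dim V\<^sub>\<alpha>\<close>; the orthogonality relations of the matrix
  coefficients, which follow from the adjunction between \<open>W\<^sub>j\<close> and \<open>W\<^sub>j\<close>-bar alone, then give
  \<open>\<kappa>\<^sub>\<alpha> = (\<pi> / 2 |\<lambda>|)\<^sup>n / dim V\<^sub>\<alpha>\<close>.\<close>

section \<open>Gaussian integrals and isometries\<close>

text \<open>Passing an operator through a matrix coefficient changes only its second vector, so
  composites keep their order: the two orderings in \<open>theta\<close> go to the same two
  orderings in \<open>weyl\<close>. The sign of \<open>lam\<close> is absorbed into the argument:
  for positive \<open>lam\<close> the coefficient is the one for negative sign at minus the
  conjugate of \<open>z\<close>, and this substitution exchanges the two Wirtinger derivatives just
  as \<open>W_op\<close> and \<open>Wbar_op\<close> exchange multiplication and differentiation. The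
  orthogonality relations reduce to the adjunction because every polynomial arises from 1 by sums
  and multiplication by coordinates, the adjoint of such a multiplication is a derivative, and
  derivatives kill 1: a form with this adjunction is determined by its value at (1, 1). That value
  is the integral of exp(-2 |lam| |z|^2), which is where (pi / (2 |lam|))^n comes from.\<close>

lemma gaussian_nn_integral_real:
  fixes a :: real
  assumes "a > 0"
  shows "(\<integral>\<^sup>+x. ennreal (exp (- a * x\<^sup>2)) \<partial>lborel) = ennreal (sqrt (pi / a))"
proof -
  \<comment> \<open>The variance for which x^2 / (2 s^2) is a x^2; the density is then exp(- a x^2)
    divided by sqrt (pi / a).\<close>
  define s where "s = 1 / sqrt (2 * a)"
  have s: "s\<^sup>2 = 1 / (2 * a)" "s > 0"
    using assms by (auto simp: s_def power_divide)
  have eq: "exp (- a * x\<^sup>2) = sqrt (pi / a) * normal_density 0 s x" for x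
    using assms by (simp add: normal_density_def s field_simps)
  have "integrable lborel (normal_density 0 s)" "integral\<^sup>L lborel (normal_density 0 s) = 1"
    using s by auto
  then have "(\<integral>\<^sup>+x. ennreal (sqrt (pi / a) * normal_density 0 s x) \<partial>lborel) = ennreal (sqrt (pi / a))"
    using assms by (subst nn_integral_eq_integral) auto
  then show ?thesis unfolding eq .
qed

lemma gaussian_nn_integral:
  fixes a :: real
  assumes "a > 0"
  shows "(\<integral>\<^sup>+x. ennreal (exp (- a * (norm (x :: 'a :: euclidean_space))\<^sup>2)) \<partial>lborel) =
    ennreal (sqrt (pi / a) ^ DIM('a))"
proof -
  have "ennreal (exp (- a * (norm x)\<^sup>2)) = (\<Prod>b\<in>Basis. ennreal (exp (- a * (x \<bullet> b)\<^sup>2)))" for x :: 'a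
  proof -
    have "(norm x)\<^sup>2 = (\<Sum>b\<in>Basis. (x \<bullet> b)\<^sup>2)"
      unfolding power2_norm_eq_inner by (subst euclidean_inner) (simp add: power2_eq_square)
    then show ?thesis
      by (simp add: prod_ennreal exp_sum sum_distrib_left sum_negf [symmetric])
  qed
  then have "(\<integral>\<^sup>+x. ennreal (exp (- a * (norm (x :: 'a))\<^sup>2)) \<partial>lborel) =
      (\<integral>\<^sup>+x. (\<Prod>b\<in>Basis. ennreal (exp (- a * ((x :: 'a) \<bullet> b)\<^sup>2))) \<partial>lborel)"
    by simp
  also have "\<dots> = (\<Prod>b\<in>(Basis :: 'a set). ennreal (sqrt (pi / a)))"
    by (subst nn_integral_lborel_prod [where f = "\<lambda>b x. ennreal (exp (- a * x\<^sup>2))"])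
      (auto simp: gaussian_nn_integral_real [OF assms, simplified])
  finally show ?thesis using assms by (simp add: ennreal_power)
qed

lemma gaussian_integral:
  fixes a :: real
  assumes "a > 0"
  shows "integrable lborel (\<lambda>x :: 'a :: euclidean_space. exp (- a * (norm x)\<^sup>2))"
    and "(LINT x|lborel. exp (- a * (norm (x :: 'a :: euclidean_space))\<^sup>2)) = sqrt (pi / a) ^ DIM('a)"
proof -
  have "has_bochner_integral lborel (\<lambda>x :: 'a. exp (- a * (norm x)\<^sup>2)) (sqrt (pi / a) ^ DIM('a))"
    using gaussian_nn_integral [OF assms, where 'a = 'a] assms
    by (intro has_bochner_integral_nn_integral) auto
  then show "integrable lborel (\<lambda>x :: 'a. exp (- a * (norm x)\<^sup>2))"
    and "(LINT x|lborel. exp (- a * (norm (x :: 'a))\<^sup>2)) = sqrt (pi / a) ^ DIM('a)"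
    by (auto simp: has_bochner_integral_iff)
qed

lemma nn_integral_lborel_translation:
  fixes h :: "'a :: euclidean_space \<Rightarrow> ennreal"
  assumes [measurable]: "h \<in> borel_measurable borel"
  shows "(\<integral>\<^sup>+x. h (x + c) \<partial>lborel) = (\<integral>\<^sup>+x. h x \<partial>lborel)"
proof -
  have "(\<integral>\<^sup>+x. h x \<partial>lborel) = (\<integral>\<^sup>+x. h x \<partial>distr lborel borel ((+) c))"
    by (simp add: lborel_distr_plus)
  also have "\<dots> = (\<integral>\<^sup>+x. h (c + x) \<partial>lborel)"
    by (subst nn_integral_distr) auto
  finally show ?thesis by (simp add: add.commute)
qed

text \<open>Haar uniqueness in miniature: insert the integral of a Gaussian, which every isometry
  preserves, and move the translations across with Tonelli.\<close>

lemma distr_lborel_orthogonal: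
  fixes f :: "'a :: euclidean_space \<Rightarrow> 'a"
  assumes f: "orthogonal_transformation f"
  shows "distr lborel borel f = lborel"
proof (rule measure_eqI)
  have lin: "linear f"
    using f by (simp add: orthogonal_transformation_linear)
  then have [measurable]: "f \<in> borel_measurable borel"
    by (intro borel_measurable_continuous_onI linear_continuous_on) (simp add: linear_conv_bounded_linear)
  obtain g where g: "\<And>x. f (g x) = x"
    using orthogonal_transformation_surj [OF f] by (metis surjD)
  let ?e = "\<lambda>x :: 'a. ennreal (exp (- 1 * (norm x)\<^sup>2))"
  let ?G = "\<integral>\<^sup>+x. ?e x \<partial>lborel"
  have G: "?G = ennreal (sqrt pi ^ DIM('a))"
    using gaussian_nn_integral [of 1, where 'a = 'a] by simp
  fix A assume "A \<in> sets (distr lborel borel f)"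
  then have [measurable]: "A \<in> sets borel" by simp
  let ?h = "indicator A :: 'a \<Rightarrow> ennreal"
  have "?G * (\<integral>\<^sup>+x. ?h (f x) \<partial>lborel) = (\<integral>\<^sup>+x. ?h (f x) * (\<integral>\<^sup>+y. ?e (y - f x) \<partial>lborel) \<partial>lborel)"
  proof -
    have "(\<integral>\<^sup>+y. ?e (y - f x) \<partial>lborel) = ?G" for x
      using nn_integral_lborel_translation [of ?e "- f x"] by simp
    then show ?thesis by (simp add: nn_integral_multc mult.commute)
  qed
  also have "\<dots> = (\<integral>\<^sup>+x. \<integral>\<^sup>+y. ?h (f x) * ?e (y - f x) \<partial>lborel \<partial>lborel)"
    by (subst nn_integral_cmult) auto
  also have "\<dots> = (\<integral>\<^sup>+y. \<integral>\<^sup>+x. ?h (f x) * ?e (y - f x) \<partial>lborel \<partial>lborel)"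
    by (intro lborel_pair.Fubini') measurable
  also have "\<dots> = (\<integral>\<^sup>+y. \<integral>\<^sup>+x. ?h (f x + y) * ?e x \<partial>lborel \<partial>lborel)"
  proof (rule nn_integral_cong)
    \<comment> \<open>Shifting \<open>x\<close> by \<open>g y\<close>, a preimage of
      \<open>y\<close>, adds \<open>y\<close> to \<open>f x\<close>. The Gaussian is left with
      \<open>- f x\<close>, whose norm is that of \<open>x\<close>.\<close>
    fix y :: 'a
    have "(\<integral>\<^sup>+x. ?h (f x) * ?e (y - f x) \<partial>lborel) =
        (\<integral>\<^sup>+x. ?h (f (x + g y)) * ?e (y - f (x + g y)) \<partial>lborel)"
      by (subst nn_integral_lborel_translation [of "\<lambda>x. ?h (f x) * ?e (y - f x)"]) auto
    also have "\<dots> = (\<integral>\<^sup>+x. ?h (f x + y) * ?e x \<partial>lborel)"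
      using f by (simp add: linear_add [OF lin] g orthogonal_transformation_norm)
    finally show "(\<integral>\<^sup>+x. ?h (f x) * ?e (y - f x) \<partial>lborel) = (\<integral>\<^sup>+x. ?h (f x + y) * ?e x \<partial>lborel)" .
  qed
  also have "\<dots> = (\<integral>\<^sup>+x. \<integral>\<^sup>+y. ?h (f x + y) * ?e x \<partial>lborel \<partial>lborel)"
    by (intro lborel_pair.Fubini') measurable
  also have "\<dots> = (\<integral>\<^sup>+x. (\<integral>\<^sup>+y. ?h y \<partial>lborel) * ?e x \<partial>lborel)"
  proof (rule nn_integral_cong)
    fix x :: 'a
    show "(\<integral>\<^sup>+y. ?h (f x + y) * ?e x \<partial>lborel) = (\<integral>\<^sup>+y. ?h y \<partial>lborel) * ?e x"
      using nn_integral_lborel_translation [of ?h "f x"]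
      by (subst nn_integral_multc) (auto simp: add.commute)
  qed
  also have "\<dots> = ?G * (\<integral>\<^sup>+y. ?h y \<partial>lborel)"
    by (subst nn_integral_cmult) (auto simp: mult.commute)
  finally have "(\<integral>\<^sup>+x. ?h (f x) \<partial>lborel) = (\<integral>\<^sup>+y. ?h y \<partial>lborel)"
    \<comment> \<open>\<open>?G\<close> is positive and finite, so it cancels.\<close>
    unfolding G by (subst (asm) ennreal_mult_cancel_left) auto
  moreover have "emeasure (distr lborel borel f) A = (\<integral>\<^sup>+x. ?h x \<partial>distr lborel borel f)"
    by simp
  ultimately show "emeasure (distr lborel borel f) A = emeasure lborel A"
    by (simp add: nn_integral_distr del: nn_integral_indicator) simp
qed simp

lemma integral_lborel_orthogonal:
  fixes f :: "'a :: euclidean_space \<Rightarrow> 'a" and h :: "'a \<Rightarrow> 'b :: {banach, second_countable_topology}"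
  assumes f: "orthogonal_transformation f" and h: "h \<in> borel_measurable borel"
  shows "(LINT x|lborel. h (f x)) = (LINT x|lborel. h x)"
proof -
  have [measurable]: "f \<in> borel_measurable borel"
    using orthogonal_transformation_linear [OF f]
    by (intro borel_measurable_continuous_onI linear_continuous_on) (simp add: linear_conv_bounded_linear)
  have "(LINT x|lborel. h x) = (LINT x|distr lborel borel f. h x)"
    by (simp add: distr_lborel_orthogonal [OF f])
  also have "\<dots> = (LINT x|lborel. h (f x))"
    using h by (subst integral_distr) auto
  finally show ?thesis ..
qed

lemma integral_lborel_translation:
  fixes h :: "'a :: euclidean_space \<Rightarrow> 'b :: {banach, second_countable_topology}"
  assumes h: "h \<in> borel_measurable borel"
  shows "(LINT x|lborel. h (x + c)) = (LINT x|lborel. h x)"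
proof -
  have "(LINT x|lborel. h x) = (LINT x|distr lborel borel ((+) c). h x)"
    by (simp add: lborel_distr_plus)
  also have "\<dots> = (LINT x|lborel. h (c + x))"
    using h by (subst integral_distr) auto
  finally show ?thesis by (simp add: add.commute)
qed

section \<open>Differentiation under the integral sign\<close>

text \<open>Turns a derivative at 0 into a limit of quotients, to which dominated convergence
  applies along sequences.\<close>

lemma has_vector_derivative_at_0_iff:
  fixes f :: "real \<Rightarrow> 'b :: real_normed_vector"
  shows "(f has_vector_derivative D) (at 0) \<longleftrightarrow> ((\<lambda>h. (f h - f 0) /\<^sub>R h) \<longlongrightarrow> D) (at 0)"
proof -
  have "norm (f h - f 0 - h *\<^sub>R D) / norm h = norm ((f h - f 0) /\<^sub>R h - D)" if "h \<noteq> 0" for h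
  proof -
    have "norm (f h - f 0 - h *\<^sub>R D) / norm h = norm ((f h - f 0 - h *\<^sub>R D) /\<^sub>R h)"
      by (simp add: divide_inverse mult.commute)
    also have "(f h - f 0 - h *\<^sub>R D) /\<^sub>R h = (f h - f 0) /\<^sub>R h - D"
      using that by (simp add: scaleR_diff_right)
    finally show ?thesis .
  qed
  then have "((\<lambda>h. norm (f h - f 0 - h *\<^sub>R D) / norm h) \<longlongrightarrow> 0) (at 0) \<longleftrightarrow>
      ((\<lambda>h. norm ((f h - f 0) /\<^sub>R h - D)) \<longlongrightarrow> 0) (at 0)"
    by (intro filterlim_cong) (auto simp: eventually_at_filter)
  then show ?thesis
    unfolding has_vector_derivative_def has_derivative_at
    by (simp add: bounded_linear_scaleR_left tendsto_norm_zero_iff Lim_null [symmetric])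
qed

text \<open>Dominated convergence for the difference quotients: the mean value inequality carries
  the bound \<open>g\<close> from the derivative over to them. The parameter is confined to |t| < 1,
  so a bound that is uniform on a bounded set is enough.\<close>

lemma has_vector_derivative_integral:
  fixes f f' :: "real \<Rightarrow> 'a \<Rightarrow> complex"
  assumes deriv: "\<And>t w. \<bar>t\<bar> < 1 \<Longrightarrow> w \<in> space M \<Longrightarrow> ((\<lambda>t. f t w) has_vector_derivative f' t w) (at t)"
    and int: "\<And>t. \<bar>t\<bar> < 1 \<Longrightarrow> integrable M (f t)"
    and meas: "f' 0 \<in> borel_measurable M"
    and bound: "\<And>t w. \<bar>t\<bar> < 1 \<Longrightarrow> w \<in> space M \<Longrightarrow> norm (f' t w) \<le> g w"
    and g: "integrable M g"
  shows "((\<lambda>t. LINT w|M. f t w) has_vector_derivative (LINT w|M. f' 0 w)) (at 0)"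
  unfolding has_vector_derivative_at_0_iff tendsto_at_iff_sequentially
proof (intro allI impI)
  fix X :: "nat \<Rightarrow> real"
  assume X0: "\<forall>i. X i \<in> UNIV - {0}" and X: "X \<longlonglongrightarrow> 0"
  from X have "\<forall>\<^sub>F i in sequentially. \<bar>X i\<bar> < 1"
    by (auto simp: tendsto_iff dest: spec [where x = 1])
  then obtain N where N: "\<And>i. i \<ge> N \<Longrightarrow> \<bar>X i\<bar> < 1"
    by (auto simp: eventually_sequentially)
  \<comment> \<open>Finitely many terms of \<open>X\<close> may lie outside the unit interval, where
    nothing is assumed; \<open>Y\<close> skips them.\<close>
  define Y where "Y i = X (i + N)" for i
  have Y: "Y \<longlonglongrightarrow> 0" "\<And>i. \<bar>Y i\<bar> < 1" "\<And>i. Y i \<noteq> 0"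
    using N X0 LIMSEQ_ignore_initial_segment [OF X, of N] by (auto simp: Y_def [abs_def])
  let ?Q = "\<lambda>h w. (f h w - f 0 w) /\<^sub>R h"
  have quot: "norm (?Q h w) \<le> g w" if "\<bar>h\<bar> < 1" "h \<noteq> 0" "w \<in> space M" for h w
  proof -
    have "norm (f h w - f 0 w) \<le> g w * norm (h - 0)"
    proof (rule differentiable_bound [where S = "{-1<..<1 :: real}" and f' = "\<lambda>t s. s *\<^sub>R f' t w"])
      fix t :: real assume t: "t \<in> {-1<..<1}"
      show "((\<lambda>t. f t w) has_derivative (\<lambda>s. s *\<^sub>R f' t w)) (at t within {-1<..<1})"
        using deriv [of t w] t that
        by (auto simp: has_vector_derivative_def intro: has_derivative_at_withinI)
      show "onorm (\<lambda>s. s *\<^sub>R f' t w) \<le> g w"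
        using bound [of t w] t that
        by (intro onorm_le) (auto simp: mult.commute mult_left_mono)
    qed (use that in auto)
    then show ?thesis
      using that by (simp only: norm_scaleR) (simp add: divide_simps mult.commute)
  qed
  have "(\<lambda>i. LINT w|M. ?Q (Y i) w) \<longlonglongrightarrow> (LINT w|M. f' 0 w)"
  proof (rule integral_dominated_convergence [where w = g])
    show "AE w in M. (\<lambda>i. ?Q (Y i) w) \<longlonglongrightarrow> f' 0 w"
    proof (rule AE_I2)
      fix w assume "w \<in> space M"
      then have "((\<lambda>h. ?Q h w) \<longlongrightarrow> f' 0 w) (at 0)"
        using deriv [of 0 w] by (simp add: has_vector_derivative_at_0_iff)
      then show "(\<lambda>i. ?Q (Y i) w) \<longlonglongrightarrow> f' 0 w"
        using Y by (auto simp: tendsto_at_iff_sequentially comp_def)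
    qed
    show "AE w in M. norm (?Q (Y i) w) \<le> g w" for i
      using Y quot by auto
    show "(\<lambda>w. ?Q (Y i) w) \<in> borel_measurable M" for i
      using int [of "Y i"] int [of 0] Y by auto
  qed (use meas g in auto)
  moreover have "(LINT w|M. ?Q (Y i) w) = ((LINT w|M. f (Y i) w) - (LINT w|M. f 0 w)) /\<^sub>R Y i" for i
    using int [of "Y i"] int [of 0] Y by simp
  ultimately have "(\<lambda>i. ((LINT w|M. f (Y i) w) - (LINT w|M. f 0 w)) /\<^sub>R Y i)
      \<longlonglongrightarrow> (LINT w|M. f' 0 w)"
    by (simp only:)
  then show "((\<lambda>h. ((LINT w|M. f h w) - (LINT w|M. f 0 w)) /\<^sub>R h) \<circ> X) \<longlonglongrightarrow> (LINT w|M. f' 0 w)"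
    using LIMSEQ_offset [where k = N and f = "((\<lambda>h. ((LINT w|M. f h w) - (LINT w|M. f 0 w)) /\<^sub>R h) \<circ> X)"]
    by (simp add: comp_def Y_def)
qed

section \<open>Wirtinger derivatives\<close>

text \<open>Directional derivatives suffice throughout, since \<^const>\<open>dz\<close> and \<^const>\<open>dzb\<close> see no more.\<close>

definition wirtinger :: "(complex ^ 'n \<Rightarrow> complex) \<Rightarrow> ('n \<Rightarrow> complex ^ 'n \<Rightarrow> complex) \<Rightarrow>
    ('n \<Rightarrow> complex ^ 'n \<Rightarrow> complex) \<Rightarrow> bool" where
  "wirtinger f p q \<longleftrightarrow> (\<forall>x e. ((\<lambda>t::real. f (x + t *\<^sub>R e)) has_vector_derivative
     (\<Sum>j\<in>UNIV. e $ j * p j x + cnj (e $ j) * q j x)) (at 0))"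

text \<open>The definition differentiates at 0 only, but from every base point; moving the base
  point along the line gives the derivative at every \<open>t\<close>.\<close>

lemma wirtingerD:
  assumes "wirtinger f p q"
  shows "((\<lambda>t::real. f (x + t *\<^sub>R e)) has_vector_derivative
     (\<Sum>j\<in>UNIV. e $ j * p j (x + t *\<^sub>R e) + cnj (e $ j) * q j (x + t *\<^sub>R e))) (at t)"
    (is "(_ has_vector_derivative ?D) _")
proof -
  have "((\<lambda>s::real. f ((x + t *\<^sub>R e) + s *\<^sub>R e)) has_vector_derivative ?D) (at (t - t))"
    using assms by (simp add: wirtinger_def)
  then have "((\<lambda>s::real. f ((x + t *\<^sub>R e) + s *\<^sub>R e)) \<circ> (\<lambda>s. s - t) has_vector_derivative 1 *\<^sub>R ?D) (at t)"
    by (intro vector_diff_chain_at) (auto intro!: derivative_eq_intros)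
  then show ?thesis by (simp add: comp_def algebra_simps)
qed

text \<open>The calculus rules build derivatives in a fixed shape; this rule restates them in the
  shape that the next step wants.\<close>

lemma wirtinger_cong:
  assumes "wirtinger f p q" "\<And>x. f x = g x" "\<And>j x. p j x = p' j x" "\<And>j x. q j x = q' j x"
  shows "wirtinger g p' q'"
proof -
  have "f = g" "p = p'" "q = q'"
    using assms(2-4) by (auto simp: fun_eq_iff)
  then show ?thesis using assms(1) by simp
qed

lemma wirtinger_const: "wirtinger (\<lambda>_. c) (\<lambda>_ _. 0) (\<lambda>_ _. 0)"
  by (simp add: wirtinger_def)

lemma wirtinger_coord:
  fixes i :: "'n :: finite"
  shows "wirtinger (\<lambda>z. z $ i) (\<lambda>j _. if j = i then 1 else 0) (\<lambda>_ _. 0)"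
proof -
  have "((\<lambda>t::real. x $ i + t *\<^sub>R e $ i) has_vector_derivative e $ i) (at 0)" for x e :: "complex ^ 'n"
    by (auto intro!: derivative_eq_intros simp: scaleR_conv_of_real)
  moreover have "(\<Sum>j\<in>UNIV. (e :: complex ^ 'n) $ j * (if j = i then 1 else 0) + cnj (e $ j) * 0) = e $ i" for e
    by (subst sum.cong [OF refl, of _ _ "\<lambda>j. if j = i then e $ i else 0"]) auto
  ultimately show ?thesis by (simp add: wirtinger_def)
qed

lemma wirtinger_add:
  assumes "wirtinger f p q" "wirtinger g p' q'"
  shows "wirtinger (\<lambda>z. f z + g z) (\<lambda>j z. p j z + p' j z) (\<lambda>j z. q j z + q' j z)"
  unfolding wirtinger_def
proof (intro allI)
  fix x e
  show "((\<lambda>t::real. f (x + t *\<^sub>R e) + g (x + t *\<^sub>R e)) has_vector_derivative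
     (\<Sum>j\<in>UNIV. e $ j * (p j x + p' j x) + cnj (e $ j) * (q j x + q' j x))) (at 0)"
    using has_vector_derivative_add [OF wirtingerD [OF assms(1), of x e 0] wirtingerD [OF assms(2), of x e 0]]
    by (simp add: sum.distrib algebra_simps)
qed

lemma wirtinger_mult:
  assumes "wirtinger f p q" "wirtinger g p' q'"
  shows "wirtinger (\<lambda>z. f z * g z) (\<lambda>j z. f z * p' j z + p j z * g z) (\<lambda>j z. f z * q' j z + q j z * g z)"
  unfolding wirtinger_def
proof (intro allI)
  fix x e
  show "((\<lambda>t::real. f (x + t *\<^sub>R e) * g (x + t *\<^sub>R e)) has_vector_derivative
     (\<Sum>j\<in>UNIV. e $ j * (f x * p' j x + p j x * g x) + cnj (e $ j) * (f x * q' j x + q j x * g x))) (at 0)"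
    using has_vector_derivative_mult [OF wirtingerD [OF assms(1), of x e 0] wirtingerD [OF assms(2), of x e 0]]
    by (simp add: sum.distrib sum_distrib_left algebra_simps)
qed

lemma wirtinger_cnj:
  assumes "wirtinger f p q"
  shows "wirtinger (\<lambda>z. cnj (f z)) (\<lambda>j z. cnj (q j z)) (\<lambda>j z. cnj (p j z))"
  unfolding wirtinger_def
proof (intro allI)
  fix x e
  show "((\<lambda>t::real. cnj (f (x + t *\<^sub>R e))) has_vector_derivative
     (\<Sum>j\<in>UNIV. e $ j * cnj (q j x) + cnj (e $ j) * cnj (p j x))) (at 0)"
    using has_vector_derivative_cnj [OF wirtingerD [OF assms(1), of x e 0]]
    by (simp add: cnj_sum add.commute)
qed

lemma wirtinger_cmult:
  assumes "wirtinger f p q"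
  shows "wirtinger (\<lambda>z. c * f z) (\<lambda>j z. c * p j z) (\<lambda>j z. c * q j z)"
  by (rule wirtinger_cong [OF wirtinger_mult [OF wirtinger_const assms]]) auto

lemma wirtinger_sum:
  assumes "\<And>i. i \<in> I \<Longrightarrow> wirtinger (f i) (p i) (q i)"
  shows "wirtinger (\<lambda>z. \<Sum>i\<in>I. f i z) (\<lambda>j z. \<Sum>i\<in>I. p i j z) (\<lambda>j z. \<Sum>i\<in>I. q i j z)"
  using assms
  by (induction I rule: infinite_finite_induct) (auto intro: wirtinger_const wirtinger_add)

lemma wirtinger_exp:
  assumes "wirtinger f p q"
  shows "wirtinger (\<lambda>z. exp (f z)) (\<lambda>j z. p j z * exp (f z)) (\<lambda>j z. q j z * exp (f z))"
  unfolding wirtinger_def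
proof (intro allI)
  fix x e
  have "(exp \<circ> (\<lambda>t::real. f (x + t *\<^sub>R e)) has_vector_derivative
     (\<Sum>j\<in>UNIV. e $ j * p j x + cnj (e $ j) * q j x) * exp (f (x + (0::real) *\<^sub>R e))) (at 0)"
    using wirtingerD [OF assms(1), of x e 0]
    by (intro field_vector_diff_chain_at) (auto intro!: derivative_eq_intros)
  then show "((\<lambda>t::real. exp (f (x + t *\<^sub>R e))) has_vector_derivative
     (\<Sum>j\<in>UNIV. e $ j * (p j x * exp (f x)) + cnj (e $ j) * (q j x * exp (f x)))) (at 0)"
    by (simp add: comp_def sum_distrib_right distrib_right mult.assoc)
qed

lemma wirtinger_translate:
  assumes "wirtinger f p q"
  shows "wirtinger (\<lambda>z. f (z + c)) (\<lambda>j z. p j (z + c)) (\<lambda>j z. q j (z + c))"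
  unfolding wirtinger_def
proof (intro allI)
  fix x e
  show "((\<lambda>t::real. f (x + t *\<^sub>R e + c)) has_vector_derivative
     (\<Sum>j\<in>UNIV. e $ j * p j (x + c) + cnj (e $ j) * q j (x + c))) (at 0)"
    using wirtingerD [OF assms(1), of "x + c" e 0] by (simp add: algebra_simps)
qed

lemma wirtinger_reflect:
  assumes "wirtinger f p q"
  shows "wirtinger (\<lambda>z. f (c - z)) (\<lambda>j z. - p j (c - z)) (\<lambda>j z. - q j (c - z))"
  unfolding wirtinger_def
proof (intro allI)
  fix x e
  show "((\<lambda>t::real. f (c - (x + t *\<^sub>R e))) has_vector_derivative
     (\<Sum>j\<in>UNIV. e $ j * (- p j (c - x)) + cnj (e $ j) * (- q j (c - x)))) (at 0)"
    using wirtingerD [OF assms(1), of "c - x" "- e" 0] by (simp add: algebra_simps)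
qed

text \<open>Conjugating the argument conjugates the direction, so the holomorphic part
  \<open>p\<close> and the antiholomorphic part \<open>q\<close> change places. This is how positive
  \<open>lam\<close> is reduced to negative \<open>lam\<close>.\<close>

lemma wirtinger_conj_arg:
  assumes "wirtinger f p q"
  shows "wirtinger (\<lambda>z. f (- vcnj z)) (\<lambda>j z. - q j (- vcnj z)) (\<lambda>j z. - p j (- vcnj z))"
  unfolding wirtinger_def
proof (intro allI)
  fix x e :: "complex ^ 'a"
  have "- vcnj (x + t *\<^sub>R e) = - vcnj x + t *\<^sub>R (- vcnj e)" for t :: real
    by (simp add: vcnj_def vec_eq_iff)
  moreover have "vcnj e $ j = cnj (e $ j)" for j
    by (simp add: vcnj_def)
  ultimately show "((\<lambda>t::real. f (- vcnj (x + t *\<^sub>R e))) has_vector_derivative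
     (\<Sum>j\<in>UNIV. e $ j * (- q j (- vcnj x)) + cnj (e $ j) * (- p j (- vcnj x)))) (at 0)"
    using wirtingerD [OF assms(1), of "- vcnj x" "- vcnj e" 0]
    by (simp only: vector_minus_component complex_cnj_minus complex_cnj_cnj scaleR_zero_left add_0_right
        minus_mult_left [symmetric] mult_minus_right) (simp add: add.commute)
qed

text \<open>The real and imaginary directions along axis \<open>j\<close> give p + q and i (p - q),
  which \<open>dz\<close> and \<open>dzb\<close> recombine. Hence \<open>wirtinger f p q\<close>
  determines \<open>p\<close> and \<open>q\<close>, and operator identities can be read off from the
  calculus rules.\<close>

lemma
  assumes "wirtinger f p q"
  shows wirtinger_dz: "dz j f = p j" and wirtinger_dzb: "dzb j f = q j"
proof -
  have axis: "(\<Sum>i\<in>UNIV. axis j c $ i * p i x + cnj (axis j c $ i) * q i x) = c * p j x + cnj c * q j x"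
    for c x
  proof -
    have "(\<Sum>i\<in>UNIV. axis j c $ i * p i x + cnj (axis j c $ i) * q i x) =
        (\<Sum>i\<in>UNIV. if i = j then c * p j x + cnj c * q j x else 0)"
      by (intro sum.cong) (auto simp: axis_def)
    then show ?thesis by simp
  qed
  have "dx j f = (\<lambda>x. p j x + q j x)"
  proof
    fix x show "dx j f x = p j x + q j x"
      using vector_derivative_at [OF wirtingerD [OF assms, of x "axis j 1" 0]] axis [of 1 x]
      by (simp add: dx_def)
  qed
  moreover have "dy j f = (\<lambda>x. \<i> * p j x - \<i> * q j x)"
  proof
    fix x show "dy j f x = \<i> * p j x - \<i> * q j x"
      using vector_derivative_at [OF wirtingerD [OF assms, of x "axis j \<i>" 0]] axis [of \<i> x]
      by (simp add: dy_def)
  qed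
  ultimately show "dz j f = p j" "dzb j f = q j"
    by (simp_all add: dz_def dzb_def right_diff_distrib mult.assoc [symmetric])
qed

lemma wirtinger_norm_power2:
  "wirtinger (\<lambda>z :: complex ^ 'n. of_real ((norm z)\<^sup>2)) (\<lambda>j z. cnj (z $ j)) (\<lambda>j z. z $ j)"
proof -
  have "of_real ((norm z)\<^sup>2) = (\<Sum>i\<in>UNIV. z $ i * cnj (z $ i))" for z :: "complex ^ 'n"
    unfolding norm_vec_def L2_set_def
    by (simp add: sum_nonneg complex_norm_square del: of_real_power)
  moreover have "wirtinger (\<lambda>z. \<Sum>i\<in>UNIV. z $ i * cnj (z $ i))
      (\<lambda>j z. cnj (z $ j)) (\<lambda>j z. z $ j)"
    by (rule wirtinger_cong [OF wirtinger_sum [where I = UNIV,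
            OF wirtinger_mult [OF wirtinger_coord wirtinger_cnj [OF wirtinger_coord]]]])
      (auto simp: if_distrib if_distribR cong: if_cong)
  ultimately show ?thesis by (simp only:)
qed

text \<open>The derivatives of the integrands below carry factors of \<open>z\<close>, so a bound
  can only be locally uniform: one \<open>g\<close> for each ball.\<close>

lemma wirtinger_integral:
  fixes f :: "complex ^ 'n \<Rightarrow> 'a \<Rightarrow> complex"
  assumes deriv: "\<And>w. w \<in> space M \<Longrightarrow> wirtinger (\<lambda>z. f z w) (\<lambda>j z. p j z w) (\<lambda>j z. q j z w)"
    and int: "\<And>z. integrable M (f z)" "\<And>j z. integrable M (p j z)" "\<And>j z. integrable M (q j z)"
    and bound: "\<And>z r. \<exists>g. integrable M g \<and> (\<forall>z'\<in>cball z r. \<forall>j. \<forall>w\<in>space M.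
      norm (p j z' w) \<le> g w \<and> norm (q j z' w) \<le> g w)"
  shows "wirtinger (\<lambda>z. LINT w|M. f z w) (\<lambda>j z. LINT w|M. p j z w) (\<lambda>j z. LINT w|M. q j z w)"
  unfolding wirtinger_def
proof (intro allI)
  fix x e :: "complex ^ 'n"
  \<comment> \<open>The radius \<open>norm e\<close> suffices, as |t| < 1 keeps x + t e in this
    ball.\<close>
  obtain g where g: "integrable M g" "\<And>z' j w. z' \<in> cball x (norm e) \<Longrightarrow> w \<in> space M \<Longrightarrow>
      norm (p j z' w) \<le> g w \<and> norm (q j z' w) \<le> g w"
    using bound [of x "norm e"] by blast
  define f' where
    "f' t w = (\<Sum>j\<in>UNIV. e $ j * p j (x + t *\<^sub>R e) w + cnj (e $ j) * q j (x + t *\<^sub>R e) w)" for t :: real and w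
  have "((\<lambda>t. LINT w|M. f (x + t *\<^sub>R e) w) has_vector_derivative (LINT w|M. f' 0 w)) (at 0)"
  proof (rule has_vector_derivative_integral [where g = "\<lambda>w. \<Sum>j\<in>UNIV. 2 * norm (e $ j) * g w"])
    fix t :: real and w
    assume t: "\<bar>t\<bar> < 1" and w: "w \<in> space M"
    show "((\<lambda>t. f (x + t *\<^sub>R e) w) has_vector_derivative f' t w) (at t)"
      unfolding f'_def by (rule wirtingerD [OF deriv [OF w]])
    have ball: "x + t *\<^sub>R e \<in> cball x (norm e)"
      using t by (simp add: dist_norm mult_left_le_one_le)
    show "norm (f' t w) \<le> (\<Sum>j\<in>UNIV. 2 * norm (e $ j) * g w)"
      unfolding f'_def
    proof (rule sum_norm_le)
      fix j
      have "norm (e $ j * p j (x + t *\<^sub>R e) w + cnj (e $ j) * q j (x + t *\<^sub>R e) w) \<le>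
          norm (e $ j) * norm (p j (x + t *\<^sub>R e) w) + norm (e $ j) * norm (q j (x + t *\<^sub>R e) w)"
        by (rule order_trans [OF norm_triangle_ineq]) (simp add: norm_mult)
      also have "\<dots> \<le> norm (e $ j) * g w + norm (e $ j) * g w"
        using g(2) [OF ball w] by (intro add_mono mult_left_mono) auto
      finally show "norm (e $ j * p j (x + t *\<^sub>R e) w + cnj (e $ j) * q j (x + t *\<^sub>R e) w) \<le>
          2 * norm (e $ j) * g w" by (simp add: mult_ac)
    qed
  next
    show "f' 0 \<in> borel_measurable M"
      using int(2,3) unfolding f'_def by (intro borel_measurable_sum borel_measurable_add) auto
  qed (use int g in auto)
  moreover have "(LINT w|M. f' 0 w) =
      (\<Sum>j\<in>UNIV. e $ j * (LINT w|M. p j x w) + cnj (e $ j) * (LINT w|M. q j x w))"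
    using int by (simp add: f'_def)
  ultimately show "((\<lambda>t. LINT w|M. f (x + t *\<^sub>R e) w) has_vector_derivative
      (\<Sum>j\<in>UNIV. e $ j * (LINT w|M. p j x w) + cnj (e $ j) * (LINT w|M. q j x w))) (at 0)"
    by simp
qed

section \<open>Gaussian decay and integration by parts\<close>

text \<open>The rate \<open>b\<close> is left open: sums keep the smaller rate, products add rates,
  and part of a rate can pay for polynomial growth or for a translation. One notion thus serves for
  the integrands in \<open>w\<close> and for the coefficients as functions of
  \<open>z\<close>.\<close>

definition gauss_decay :: "('a :: euclidean_space \<Rightarrow> complex) \<Rightarrow> bool" where
  "gauss_decay f \<longleftrightarrow> f \<in> borel_measurable borel \<and>
     (\<exists>C b. b > 0 \<and> (\<forall>x. norm (f x) \<le> C * exp (- b * (norm x)\<^sup>2)))"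

lemma gauss_decayI:
  assumes "f \<in> borel_measurable borel" "b > 0" "\<And>x. norm (f x) \<le> C * exp (- b * (norm x)\<^sup>2)"
  shows "gauss_decay f"
  using assms unfolding gauss_decay_def by blast

lemma gauss_decay_measurable: "gauss_decay f \<Longrightarrow> f \<in> borel_measurable borel"
  by (simp add: gauss_decay_def)

lemma gauss_decay_integrable:
  assumes "gauss_decay f"
  shows "integrable lborel f"
proof -
  obtain C b where "b > 0" and C: "\<And>x. norm (f x) \<le> C * exp (- b * (norm x)\<^sup>2)"
    using assms by (auto simp: gauss_decay_def)
  have "integrable lborel (\<lambda>x :: 'a. C * exp (- b * (norm x)\<^sup>2))"
    using gaussian_integral(1) [OF \<open>b > 0\<close>] by (intro integrable_mult_right)
  then show ?thesis
  proof (rule Bochner_Integration.integrable_bound)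
    show "f \<in> borel_measurable lborel"
      using assms by (simp add: gauss_decay_def)
    show "AE x in lborel. norm (f x) \<le> norm (C * exp (- b * (norm x)\<^sup>2))"
      using C order_trans [OF C abs_ge_self] by auto
  qed
qed

lemma gauss_decay_zero: "gauss_decay (\<lambda>_. 0)"
  unfolding gauss_decay_def by (auto intro!: exI [of _ 0] exI [of _ 1])

lemma gauss_decay_add:
  assumes "gauss_decay f" "gauss_decay g"
  shows "gauss_decay (\<lambda>x. f x + g x)"
proof -
  obtain C b where b: "b > 0" and C: "\<And>x. norm (f x) \<le> C * exp (- b * (norm x)\<^sup>2)"
    using assms by (auto simp: gauss_decay_def)
  obtain D c where c: "c > 0" and D: "\<And>x. norm (g x) \<le> D * exp (- c * (norm x)\<^sup>2)"
    using assms by (auto simp: gauss_decay_def)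
  have nn: "C \<ge> 0" "D \<ge> 0"
    using order_trans [OF norm_ge_zero C [of 0]] order_trans [OF norm_ge_zero D [of 0]] by auto
  have "norm (f x + g x) \<le> (C + D) * exp (- min b c * (norm x)\<^sup>2)" for x
  proof -
    have "C * exp (- b * (norm x)\<^sup>2) \<le> C * exp (- min b c * (norm x)\<^sup>2)"
      using nn by (intro mult_left_mono) (auto intro: mult_right_mono)
    moreover have "D * exp (- c * (norm x)\<^sup>2) \<le> D * exp (- min b c * (norm x)\<^sup>2)"
      using nn by (intro mult_left_mono) (auto intro: mult_right_mono)
    ultimately show ?thesis
      using norm_triangle_ineq [of "f x" "g x"] C [of x] D [of x]
      by (simp only: distrib_right)
  qed
  then show ?thesis
    using assms [THEN gauss_decay_measurable] b c
    by (intro gauss_decayI [of _ "min b c"] borel_measurable_add) auto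
qed

lemma gauss_decay_mult:
  assumes "gauss_decay f" "gauss_decay g"
  shows "gauss_decay (\<lambda>x. f x * g x)"
proof -
  obtain C b where b: "b > 0" and C: "\<And>x. norm (f x) \<le> C * exp (- b * (norm x)\<^sup>2)"
    using assms by (auto simp: gauss_decay_def)
  obtain D c where c: "c > 0" and D: "\<And>x. norm (g x) \<le> D * exp (- c * (norm x)\<^sup>2)"
    using assms by (auto simp: gauss_decay_def)
  have "norm (f x * g x) \<le> (C * D) * exp (- (b + c) * (norm x)\<^sup>2)" for x
  proof -
    have "norm (f x * g x) \<le> (C * exp (- b * (norm x)\<^sup>2)) * (D * exp (- c * (norm x)\<^sup>2))"
      unfolding norm_mult using order_trans [OF norm_ge_zero C [of x]] by (intro mult_mono C D) auto
    also have "\<dots> = (C * D) * exp (- (b + c) * (norm x)\<^sup>2)"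
      by (simp add: exp_add [symmetric] algebra_simps)
    finally show ?thesis .
  qed
  moreover have "(\<lambda>x. f x * g x) \<in> borel_measurable borel"
    using assms [THEN gauss_decay_measurable] by measurable
  ultimately show ?thesis
    using b c by (intro gauss_decayI [of _ "b + c"]) auto
qed

lemma gauss_decay_cnj: "gauss_decay f \<Longrightarrow> gauss_decay (\<lambda>x. cnj (f x))"
  by (auto simp: gauss_decay_def intro: borel_measurable_continuous_on [where g = f and f = cnj] continuous_intros)

lemma gauss_decay_cmult:
  assumes "gauss_decay f"
  shows "gauss_decay (\<lambda>x. c * f x)"
proof -
  obtain C b where b: "b > 0" and C: "\<And>x. norm (f x) \<le> C * exp (- b * (norm x)\<^sup>2)"
    using assms by (auto simp: gauss_decay_def)
  have "norm (c * f x) \<le> (norm c * C) * exp (- b * (norm x)\<^sup>2)" for x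
    using mult_left_mono [OF C [of x], of "norm c"] by (simp add: norm_mult mult.assoc)
  moreover have "(\<lambda>x. c * f x) \<in> borel_measurable borel"
    using assms [THEN gauss_decay_measurable] by measurable
  ultimately show ?thesis
    using b by (intro gauss_decayI) auto
qed

lemma gauss_decay_diff:
  assumes "gauss_decay f" "gauss_decay g"
  shows "gauss_decay (\<lambda>x. f x - g x)"
  using gauss_decay_add [OF assms(1) gauss_decay_cmult [OF assms(2), of "- 1"]] by simp

lemma gauss_decay_sum:
  "(\<And>i. i \<in> I \<Longrightarrow> gauss_decay (f i)) \<Longrightarrow> gauss_decay (\<lambda>x. \<Sum>i\<in>I. f i x)"
  by (induction I rule: infinite_finite_induct) (auto intro: gauss_decay_zero gauss_decay_add)

lemma norm_power2_split: "(norm (x :: 'a :: real_inner))\<^sup>2 \<le> 2 * (norm (x + y))\<^sup>2 + 2 * (norm y)\<^sup>2"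
proof -
  have "0 \<le> (norm (x + 2 *\<^sub>R y))\<^sup>2" by simp
  then show ?thesis
    by (simp add: power2_norm_eq_inner inner_add_left inner_add_right inner_commute algebra_simps)
qed

text \<open>|w|^2 <= 2 |w + z|^2 + 2 |z|^2 turns decay in w + z into decay in \<open>w\<close> at
  half the rate, at the price of the constant exp(b R^2) for |z| <= R.\<close>

lemma gauss_decay_shift_bound:
  assumes "gauss_decay f"
  shows "\<exists>g. integrable lborel g \<and> (\<forall>z\<in>cball c r. \<forall>w. norm (f (w + z)) \<le> g w)"
proof -
  obtain C b where b: "b > 0" and C: "\<And>x. norm (f x) \<le> C * exp (- b * (norm x)\<^sup>2)"
    using assms by (auto simp: gauss_decay_def)
  have C0: "C \<ge> 0" using order_trans [OF norm_ge_zero C [of 0]] by auto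
  let ?R = "norm c + r"
  let ?g = "\<lambda>w. C * (exp (b * ?R\<^sup>2) * exp (- (b / 2) * (norm w)\<^sup>2))"
  have "norm (f (w + z)) \<le> ?g w" if z: "z \<in> cball c r" for w z
  proof -
    have "norm z \<le> ?R"
      using z norm_triangle_sub [of z c] by (simp add: dist_norm norm_minus_commute)
    then have "(norm z)\<^sup>2 \<le> ?R\<^sup>2" by (intro power_mono) auto
    moreover have "(norm w)\<^sup>2 \<le> 2 * (norm (w + z))\<^sup>2 + 2 * (norm z)\<^sup>2"
      by (rule norm_power2_split)
    ultimately have "(norm w)\<^sup>2 / 2 - ?R\<^sup>2 \<le> (norm (w + z))\<^sup>2" by linarith
    then have "b * ((norm w)\<^sup>2 / 2 - ?R\<^sup>2) \<le> b * (norm (w + z))\<^sup>2"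
      using b by (intro mult_left_mono) auto
    then have "exp (- b * (norm (w + z))\<^sup>2) \<le> exp (b * ?R\<^sup>2) * exp (- (b / 2) * (norm w)\<^sup>2)"
      unfolding exp_add [symmetric] by (simp add: algebra_simps)
    then show ?thesis
      using C [of "w + z"] C0 by (meson mult_left_mono order_trans)
  qed
  moreover have "integrable lborel ?g"
    using gaussian_integral(1) [of "b / 2"] b by (intro integrable_mult_right) auto
  ultimately show ?thesis by blast
qed

text \<open>Integration by parts from translation invariance: the integral of f(w + z) over
  \<open>w\<close> does not depend on \<open>z\<close>, so its derivatives in \<open>z\<close>
  vanish, and differentiation under the integral sign shows that they are the integrals of
  \<open>p j\<close> and \<open>q j\<close>.\<close>

lemma wirtinger_integral_eq_0:
  fixes f :: "complex ^ 'n \<Rightarrow> complex"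
  assumes f: "wirtinger f p q" and gd: "gauss_decay f" "\<And>j. gauss_decay (p j)" "\<And>j. gauss_decay (q j)"
  shows "(LINT w|lborel. p j w) = 0" and "(LINT w|lborel. q j w) = 0"
proof -
  have trans: "gauss_decay g \<Longrightarrow> integrable lborel (\<lambda>w. g (w + z))" for g :: "complex ^ 'n \<Rightarrow> complex" and z
    using integrable_distr_eq [of "(+) z" lborel borel g] gauss_decay_integrable [of g]
    by (simp add: lborel_distr_plus gauss_decay_measurable add.commute)
  have "wirtinger (\<lambda>z. LINT w|lborel. f (w + z)) (\<lambda>j z. LINT w|lborel. p j (w + z))
      (\<lambda>j z. LINT w|lborel. q j (w + z))"
  proof (rule wirtinger_integral)
    show "wirtinger (\<lambda>z. f (w + z)) (\<lambda>j z. p j (w + z)) (\<lambda>j z. q j (w + z))" for w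
      using wirtinger_translate [OF f, of w] by (simp add: add.commute)
    fix z :: "complex ^ 'n" and r :: real
    have "\<exists>g. integrable lborel g \<and> (\<forall>z'\<in>cball z r. \<forall>w. norm (p j (w + z')) \<le> g w)" for j
      by (rule gauss_decay_shift_bound [OF gd(2)])
    then obtain g where g: "\<And>j. integrable lborel (g j)"
        "\<And>j z' w. z' \<in> cball z r \<Longrightarrow> norm (p j (w + z')) \<le> g j w"
      by metis
    have "\<exists>h. integrable lborel h \<and> (\<forall>z'\<in>cball z r. \<forall>w. norm (q j (w + z')) \<le> h w)" for j
      by (rule gauss_decay_shift_bound [OF gd(3)])
    then obtain h where h: "\<And>j. integrable lborel (h j)"
        "\<And>j z' w. z' \<in> cball z r \<Longrightarrow> norm (q j (w + z')) \<le> h j w"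
      by metis
    let ?G = "\<lambda>w. \<Sum>j\<in>UNIV. norm (g j w) + norm (h j w)"
    have "norm (p j (w + z')) \<le> ?G w \<and> norm (q j (w + z')) \<le> ?G w" if "z' \<in> cball z r" for z' j w
    proof -
      have "norm (g j w) + norm (h j w) \<le> ?G w"
        by (intro member_le_sum [where f = "\<lambda>j. norm (g j w) + norm (h j w)"]) auto
      then show ?thesis
        using g(2) [OF that, of j w] h(2) [OF that, of j w] by auto
    qed
    moreover have "integrable lborel ?G"
      using g h by auto
    ultimately show "\<exists>g. integrable lborel g \<and> (\<forall>z'\<in>cball z r. \<forall>j. \<forall>w\<in>space lborel.
        norm (p j (w + z')) \<le> g w \<and> norm (q j (w + z')) \<le> g w)"
      by (intro exI [of _ ?G]) blast
  qed (use gd trans in auto)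
  then have W: "wirtinger (\<lambda>z. LINT w|lborel. f w) (\<lambda>j z. LINT w|lborel. p j (w + z))
      (\<lambda>j z. LINT w|lborel. q j (w + z))"
    using gd by (simp add: integral_lborel_translation gauss_decay_measurable)
  \<comment> \<open>The same constant function gets its derivatives at 0 from \<open>W\<close> and
    from \<open>wirtinger_const\<close>, and the two must agree.\<close>
  show "(LINT w|lborel. p j w) = 0" "(LINT w|lborel. q j w) = 0"
    using fun_cong [OF wirtinger_dz [OF W, of j], of 0] fun_cong [OF wirtinger_dzb [OF W, of j], of 0]
      fun_cong [OF wirtinger_dz [OF wirtinger_const [of "LINT w|lborel. f w"], of j], of 0]
      fun_cong [OF wirtinger_dzb [OF wirtinger_const [of "LINT w|lborel. f w"], of j], of 0]
    by auto
qed

section \<open>Matrix coefficients of the Fock representation\<close>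

text \<open>Chosen over families of coefficients because induction on it matches the adjunction: the
  last rule multiplies by a coordinate, and the adjoint of that is a derivative.
  \<open>hol_polys_hpoly\<close> links it to \<open>hol_polys\<close>.\<close>

inductive hpoly :: "(complex ^ 'n \<Rightarrow> complex) \<Rightarrow> bool" where
  hpoly_const: "hpoly (\<lambda>_. c)"
| hpoly_add: "hpoly u \<Longrightarrow> hpoly v \<Longrightarrow> hpoly (\<lambda>w. u w + v w)"
| hpoly_coord: "hpoly u \<Longrightarrow> hpoly (\<lambda>w. w $ j * u w)"

lemma hpoly_cmult: "hpoly u \<Longrightarrow> hpoly (\<lambda>w. c * u w)"
proof (induction rule: hpoly.induct)
  case (hpoly_coord u j)
  then show ?case using hpoly.hpoly_coord [of "\<lambda>w. c * u w" j] by (simp add: mult.left_commute)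
qed (auto simp: distrib_left intro: hpoly_const hpoly_add)

lemma hpoly_sum: "(\<And>i. i \<in> I \<Longrightarrow> hpoly (f i)) \<Longrightarrow> hpoly (\<lambda>w. \<Sum>i\<in>I. f i w)"
  by (induction I rule: infinite_finite_induct) (auto intro: hpoly_const hpoly_add)

lemma hpoly_matrix_vector: "hpoly u \<Longrightarrow> hpoly (\<lambda>w. u (A *v w))"
proof (induction rule: hpoly.induct)
  case (hpoly_coord u j)
  then have "hpoly (\<lambda>w. \<Sum>i\<in>UNIV. A $ j $ i * (w $ i * u (A *v w)))"
    by (intro hpoly_sum hpoly_cmult hpoly.hpoly_coord)
  then show ?case by (simp add: matrix_vector_mult_def sum_distrib_right mult.assoc)
qed (auto intro: hpoly_const hpoly_add)

lemma hpoly_continuous: "hpoly u \<Longrightarrow> continuous_on UNIV u"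
  by (induction rule: hpoly.induct) (auto intro!: continuous_intros)

lemma hpoly_wirtinger: "hpoly u \<Longrightarrow> wirtinger u (\<lambda>j. dz j u) (\<lambda>_ _. 0) \<and> (\<forall>j. hpoly (dz j u))"
proof -
  assume "hpoly u"
  then have "\<exists>p. wirtinger u p (\<lambda>_ _. 0) \<and> (\<forall>j. hpoly (p j))"
  proof (induction rule: hpoly.induct)
    case (hpoly_const c)
    show ?case by (intro exI [of _ "\<lambda>_ _. 0"] conjI wirtinger_const) (simp add: hpoly.hpoly_const)
  next
    case (hpoly_add u v)
    then obtain p q where p: "wirtinger u p (\<lambda>_ _. 0)" "\<And>j. hpoly (p j)"
      and q: "wirtinger v q (\<lambda>_ _. 0)" "\<And>j. hpoly (q j)" by blast
    show ?case
      using wirtinger_add [OF p(1) q(1)] p(2) q(2)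
      by (intro exI [of _ "\<lambda>j z. p j z + q j z"]) (auto intro: hpoly.hpoly_add)
  next
    case (hpoly_coord u i)
    then obtain p where p: "wirtinger u p (\<lambda>_ _. 0)" "\<And>j. hpoly (p j)" by blast
    have "hpoly (\<lambda>z. z $ i * p j z + (if j = i then 1 else 0) * u z)" for j
      using p(2) hpoly_coord(1) by (intro hpoly.hpoly_add hpoly.hpoly_coord hpoly_cmult)
    moreover have "wirtinger (\<lambda>z. z $ i * u z)
        (\<lambda>j z. z $ i * p j z + (if j = i then 1 else 0) * u z) (\<lambda>_ _. 0)"
      by (rule wirtinger_cong [OF wirtinger_mult [OF wirtinger_coord p(1)]]) auto
    ultimately show ?case by blast
  qed
  then obtain p where p: "wirtinger u p (\<lambda>_ _. 0)" "\<And>j. hpoly (p j)" by blast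
  have "p = (\<lambda>j. dz j u)"
    using wirtinger_dz [OF p(1)] by auto
  then show ?thesis using p by auto
qed

lemma hpoly_dz: "hpoly u \<Longrightarrow> hpoly (dz j u)"
  using hpoly_wirtinger by blast

text \<open>Each coordinate factor is paid for with half of the exponent, so the induction has to
  run over all \<open>b\<close> at once.\<close>

lemma hpoly_bound:
  fixes u :: "complex ^ 'n \<Rightarrow> complex"
  shows "hpoly u \<Longrightarrow> b > 0 \<Longrightarrow> \<exists>C. \<forall>w. norm (u w) \<le> C * exp (b * (norm w)\<^sup>2)"
proof (induction arbitrary: b rule: hpoly.induct)
  case (hpoly_const c)
  then have "norm c * 1 \<le> norm c * exp (b * (norm w)\<^sup>2)" for w :: "complex ^ 'n"
    by (intro mult_left_mono) auto
  then show ?case by (intro exI [of _ "norm c"]) simp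
next
  case (hpoly_add u v)
  then obtain C D where "\<And>w. norm (u w) \<le> C * exp (b * (norm w)\<^sup>2)"
    "\<And>w. norm (v w) \<le> D * exp (b * (norm w)\<^sup>2)" by blast
  then have "norm (u w + v w) \<le> (C + D) * exp (b * (norm w)\<^sup>2)" for w
    unfolding distrib_right by (meson add_mono norm_triangle_ineq order_trans)
  then show ?case by blast
next
  case (hpoly_coord u j)
  then have b: "b / 2 > 0" by simp
  then obtain C where C: "\<And>w. norm (u w) \<le> C * exp (b / 2 * (norm w)\<^sup>2)"
    using hpoly_coord.IH by blast
  \<comment> \<open>With this constant, 1 and |w|^2 are at most \<open>?D\<close> times the two
    terms of 1 + (b / 2) |w|^2, and that sum is below the exponential.\<close>
  let ?D = "max 1 (2 / b)"
  have "norm (w $ j * u w) \<le> (?D * C) * exp (b * (norm w)\<^sup>2)" for w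
  proof -
    have "norm (w $ j) \<le> norm w" by (rule Finite_Cartesian_Product.norm_nth_le)
    also have "norm w \<le> 1 + (norm w)\<^sup>2"
    proof -
      have "0 \<le> (norm w)\<^sup>2 + 1 - 2 * norm w"
        using zero_le_power2 [of "norm w - 1"] by (simp add: power2_diff)
      then show ?thesis using norm_ge_zero [of w] by linarith
    qed
    also have "\<dots> \<le> ?D * 1 + ?D * (b / 2 * (norm w)\<^sup>2)"
    proof (rule add_mono)
      have "1 * (norm w)\<^sup>2 \<le> (?D * (b / 2)) * (norm w)\<^sup>2"
        using b by (intro mult_right_mono) (auto simp: max_def field_simps)
      then show "(norm w)\<^sup>2 \<le> ?D * (b / 2 * (norm w)\<^sup>2)" by (simp add: mult.assoc)
    qed simp
    also have "\<dots> \<le> ?D * exp (b / 2 * (norm w)\<^sup>2)"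
      unfolding distrib_left [symmetric] by (intro mult_left_mono exp_ge_add_one_self) auto
    finally have "norm (w $ j * u w) \<le> (?D * exp (b / 2 * (norm w)\<^sup>2)) * (C * exp (b / 2 * (norm w)\<^sup>2))"
      unfolding norm_mult by (intro mult_mono C) auto
    also have "\<dots> = (?D * C) * exp (b * (norm w)\<^sup>2)"
      by (simp add: exp_add [symmetric] field_simps)
    finally show ?thesis .
  qed
  then show ?case by blast
qed

text \<open>For \<open>lam\<close> equal to - a / 2: the weight exp(- a |w|^2) of the Fock space
  times the conjugate of the exponential factor of \<open>fock_rep\<close>.\<close>

definition fock_ker :: "real \<Rightarrow> complex ^ 'n \<Rightarrow> complex ^ 'n \<Rightarrow> complex" where
  "fock_ker a z w = exp (of_real a *
     (cdot z (vcnj w) - of_real ((norm z)\<^sup>2) / 2 - of_real ((norm w)\<^sup>2)))"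

definition fock_integrand ::
  "real \<Rightarrow> (complex ^ 'n \<Rightarrow> complex) \<Rightarrow> (complex ^ 'n \<Rightarrow> complex) \<Rightarrow> complex ^ 'n \<Rightarrow> complex ^ 'n \<Rightarrow> complex"
  where "fock_integrand a u v z w = cnj (u (w - z)) * v w * fock_ker a z w"

text \<open>The matrix coefficient of \<^const>\<open>fock_rep\<close> for negative \<open>lam = - a / 2\<close>; at \<open>z = 0\<close> it is
  the inner product of the Fock space.\<close>

definition fock_coeff ::
  "real \<Rightarrow> (complex ^ 'n \<Rightarrow> complex) \<Rightarrow> (complex ^ 'n \<Rightarrow> complex) \<Rightarrow> complex ^ 'n \<Rightarrow> complex"
  where "fock_coeff a u v z = of_real ((a / pi) ^ CARD('n)) * (LINT w|lborel. fock_integrand a u v z w)"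

lemma Re_cdot_vcnj: "Re (cdot z (vcnj w)) = z \<bullet> w"
  by (simp add: cdot_def vcnj_def inner_vec_def inner_complex_def)

text \<open>Completing the square: the real part of the exponent is - (a / 2) (|w - z|^2 + |w|^2).
  The two Gaussians sit at the arguments of \<open>u\<close> and of \<open>v\<close> in the
  integrand.\<close>

lemma norm_fock_ker: "norm (fock_ker a z w) = exp (- (a / 2) * (norm (w - z))\<^sup>2) * exp (- (a / 2) * (norm w)\<^sup>2)"
  unfolding fock_ker_def exp_add [symmetric] norm_exp_eq_Re
  by (simp add: Re_cdot_vcnj power2_norm_eq_inner inner_diff_left inner_diff_right inner_commute
      algebra_simps add_divide_distrib del: of_real_power)

text \<open>Half of the rate of each Gaussian absorbs the polynomial at the same argument. Both
  remaining Gaussians are kept, since together they also give decay in \<open>z\<close>.\<close>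

lemma fock_integrand_bound:
  assumes "hpoly u" "hpoly v" "a > 0"
  obtains C where "C \<ge> 0" "\<And>z w. norm (fock_integrand a u v z w) \<le>
    C * (exp (- (a / 4) * (norm (w - z))\<^sup>2) * exp (- (a / 4) * (norm w)\<^sup>2))"
proof -
  obtain C where C: "\<And>w. norm (u w) \<le> C * exp (a / 4 * (norm w)\<^sup>2)"
    using hpoly_bound [OF assms(1), of "a / 4"] assms by auto
  obtain D where D: "\<And>w. norm (v w) \<le> D * exp (a / 4 * (norm w)\<^sup>2)"
    using hpoly_bound [OF assms(2), of "a / 4"] assms by auto
  have nn: "C \<ge> 0" "D \<ge> 0"
    using order_trans [OF norm_ge_zero C [of 0]] order_trans [OF norm_ge_zero D [of 0]] by auto
  have split: "exp (- (a / 2) * t) = exp (- (a / 4) * t) * exp (- (a / 4) * t)" for t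
    by (simp add: exp_add [symmetric])
  have cancel: "exp (a / 4 * t) * exp (- (a / 4) * t) = 1" for t
    by (simp add: exp_add [symmetric])
  have "norm (fock_integrand a u v z w) \<le>
    (C * D) * (exp (- (a / 4) * (norm (w - z))\<^sup>2) * exp (- (a / 4) * (norm w)\<^sup>2))" for z w
  proof -
    let ?s = "(norm (w - z))\<^sup>2" and ?t = "(norm w)\<^sup>2"
    have "norm (fock_integrand a u v z w) = norm (u (w - z)) * norm (v w) * norm (fock_ker a z w)"
      by (simp add: fock_integrand_def norm_mult)
    also have "\<dots> \<le> (C * exp (a / 4 * ?s)) * (D * exp (a / 4 * ?t)) * norm (fock_ker a z w)"
      using nn by (intro mult_right_mono mult_mono C D) auto
    also have "\<dots> = (C * D) * ((exp (a / 4 * ?s) * exp (- (a / 4) * ?s)) * exp (- (a / 4) * ?s)) *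
        ((exp (a / 4 * ?t) * exp (- (a / 4) * ?t)) * exp (- (a / 4) * ?t))"
      unfolding norm_fock_ker split by (simp only: mult_ac)
    finally show ?thesis unfolding cancel by (simp add: mult.assoc)
  qed
  with that [of "C * D"] nn show ?thesis by auto
qed

lemma continuous_on_cdot_vcnj [continuous_intros]:
  assumes "continuous_on S f" "continuous_on S g"
  shows "continuous_on S (\<lambda>x. cdot (f x) (vcnj (g x)))"
  unfolding cdot_def vcnj_def using assms by (auto intro!: continuous_intros)

lemma fock_integrand_continuous:
  fixes u :: "complex ^ 'n \<Rightarrow> complex"
  assumes "hpoly u" "hpoly v"
  shows "continuous_on UNIV (\<lambda>x. fock_integrand a u v (fst x) (snd x))"
proof -
  have "continuous_on UNIV (\<lambda>x :: (complex ^ 'n) \<times> (complex ^ 'n). u (snd x - fst x))"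
    by (rule continuous_on_compose2 [OF hpoly_continuous [OF assms(1)]]) (auto intro!: continuous_intros)
  moreover have "continuous_on UNIV (\<lambda>x :: (complex ^ 'n) \<times> (complex ^ 'n). v (snd x))"
    by (rule continuous_on_compose2 [OF hpoly_continuous [OF assms(2)]]) (auto intro!: continuous_intros)
  ultimately show ?thesis
    unfolding fock_integrand_def fock_ker_def by (intro continuous_intros) auto
qed

lemma fock_integrand_continuous2:
  assumes "hpoly u" "hpoly v"
  shows "continuous_on UNIV (fock_integrand a u v z)"
proof -
  have "continuous_on UNIV (\<lambda>w. Pair z w)" by (intro continuous_intros)
  then show ?thesis
    using continuous_on_compose2 [OF fock_integrand_continuous [OF assms, of a], of UNIV "\<lambda>w. Pair z w"] by simp
qed

lemma gauss_decay_fock_integrand: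
  assumes "hpoly u" "hpoly v" "a > 0"
  shows "gauss_decay (fock_integrand a u v z)"
proof -
  obtain C where "C \<ge> 0" and C: "\<And>z w. norm (fock_integrand a u v z w) \<le>
    C * (exp (- (a / 4) * (norm (w - z))\<^sup>2) * exp (- (a / 4) * (norm w)\<^sup>2))"
    using fock_integrand_bound [OF assms] by blast
  show ?thesis
  proof (rule gauss_decayI)
    show "fock_integrand a u v z \<in> borel_measurable borel"
      by (intro borel_measurable_continuous_onI fock_integrand_continuous2 assms)
    show "a / 4 > 0" using assms by simp
    fix w
    have "exp (- (a / 4) * (norm (w - z))\<^sup>2) * exp (- (a / 4) * (norm w)\<^sup>2) \<le>
        1 * exp (- (a / 4) * (norm w)\<^sup>2)"
      using assms by (intro mult_right_mono) auto
    then show "norm (fock_integrand a u v z w) \<le> C * exp (- (a / 4) * (norm w)\<^sup>2)"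
      using order_trans [OF C [of z w] mult_left_mono [OF _ \<open>C \<ge> 0\<close>]] by simp
  qed
qed

lemmas integrable_fock_integrand = gauss_decay_integrable [OF gauss_decay_fock_integrand]

lemma gauss_decay_fock_coeff:
  fixes u :: "complex ^ 'n \<Rightarrow> complex"
  assumes "hpoly u" "hpoly v" "a > 0"
  shows "gauss_decay (fock_coeff a u v)"
proof -
  obtain C where "C \<ge> 0" and C: "\<And>z w. norm (fock_integrand a u v z w) \<le>
    C * (exp (- (a / 4) * (norm (w - z))\<^sup>2) * exp (- (a / 4) * (norm w)\<^sup>2))"
    using fock_integrand_bound [OF assms] by blast
  define G where "G = (LINT w|lborel. exp (- (a / 8) * (norm (w :: complex ^ 'n))\<^sup>2))"
  have int: "integrable lborel (\<lambda>w :: complex ^ 'n. exp (- (a / 8) * (norm w)\<^sup>2))"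
    by (rule gaussian_integral) (use assms in simp)
  have "gauss_decay (\<lambda>z. LINT w|lborel. fock_integrand a u v z w)"
  proof (rule gauss_decayI)
    have "(\<lambda>x. fock_integrand a u v (fst x) (snd x)) \<in> borel_measurable (borel :: ((complex ^ 'n) \<times> (complex ^ 'n)) measure)"
      by (intro borel_measurable_continuous_onI fock_integrand_continuous assms)
    then have "case_prod (fock_integrand a u v) \<in> borel_measurable (borel \<Otimes>\<^sub>M lborel)"
      unfolding borel_prod [symmetric] by (simp add: case_prod_beta' cong: measurable_cong_sets)
    then show "(\<lambda>z. LINT w|lborel. fock_integrand a u v z w) \<in> borel_measurable borel"
      by (rule lborel.borel_measurable_lebesgue_integral)
    show "a / 16 > 0" using assms by simp
    fix z
    have "norm (LINT w|lborel. fock_integrand a u v z w) \<le> (LINT w|lborel. norm (fock_integrand a u v z w))"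
      by (rule integral_norm_bound)
    also have "\<dots> \<le>
        (LINT w|lborel. C * (exp (- (a / 16) * (norm z)\<^sup>2) * exp (- (a / 8) * (norm (w :: complex ^ 'n))\<^sup>2)))"
    proof (rule integral_mono)
      show "integrable lborel (\<lambda>w. norm (fock_integrand a u v z w))"
        by (intro integrable_norm integrable_fock_integrand assms)
      show "integrable lborel (\<lambda>w. C * (exp (- (a / 16) * (norm z)\<^sup>2) * exp (- (a / 8) * (norm (w :: complex ^ 'n))\<^sup>2)))"
        by (intro integrable_mult_right int)
      \<comment> \<open>Decay in w - z and part of the decay in \<open>w\<close> are traded for
        decay in \<open>z\<close>; the rate a / 8 in \<open>w\<close> is kept back so that the
        integral over \<open>w\<close> converges.\<close>
      fix w
      have "(norm z)\<^sup>2 \<le> 2 * (norm (w - z))\<^sup>2 + 2 * (norm w)\<^sup>2"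
        using norm_power2_split [of z "- w"] by (simp add: norm_minus_commute)
      then have "(norm z)\<^sup>2 / 4 \<le> (norm (w - z))\<^sup>2 + (norm w)\<^sup>2 / 2"
        using zero_le_power2 [of "norm (w - z)"] by linarith
      then have "a / 4 * ((norm z)\<^sup>2 / 4) \<le> a / 4 * ((norm (w - z))\<^sup>2 + (norm w)\<^sup>2 / 2)"
        using assms by (intro mult_left_mono) auto
      then have "exp (- (a / 4) * (norm (w - z))\<^sup>2) * exp (- (a / 4) * (norm w)\<^sup>2) \<le>
          exp (- (a / 16) * (norm z)\<^sup>2) * exp (- (a / 8) * (norm w)\<^sup>2)"
        unfolding exp_add [symmetric] by (simp add: algebra_simps)
      then show "norm (fock_integrand a u v z w) \<le>
          C * (exp (- (a / 16) * (norm z)\<^sup>2) * exp (- (a / 8) * (norm w)\<^sup>2))"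
        using C [of z w] \<open>C \<ge> 0\<close> by (meson mult_left_mono order_trans)
    qed
    also have "\<dots> = (C * G) * exp (- (a / 16) * (norm z)\<^sup>2)"
      by (simp add: G_def)
    finally show "norm (LINT w|lborel. fock_integrand a u v z w) \<le> (C * G) * exp (- (a / 16) * (norm z)\<^sup>2)" .
  qed
  then show ?thesis
    unfolding fock_coeff_def [abs_def] by (rule gauss_decay_cmult)
qed

lemma fock_coeff_add_right:
  assumes "hpoly u" "hpoly v" "hpoly v'" "a > 0"
  shows "fock_coeff a u (\<lambda>w. v w + v' w) z = fock_coeff a u v z + fock_coeff a u v' z"
proof -
  have "fock_integrand a u (\<lambda>w. v w + v' w) z = (\<lambda>w. fock_integrand a u v z w + fock_integrand a u v' z w)"
    by (auto simp: fock_integrand_def algebra_simps)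
  then show ?thesis
    using integrable_fock_integrand [OF assms(1,2,4)] integrable_fock_integrand [OF assms(1,3,4)]
    by (simp add: fock_coeff_def distrib_left)
qed

lemma fock_coeff_cmult_right: "fock_coeff a u (\<lambda>w. c * v w) z = c * fock_coeff a u v z"
proof -
  have "fock_integrand a u (\<lambda>w. c * v w) z = (\<lambda>w. c * fock_integrand a u v z w)"
    by (auto simp: fock_integrand_def algebra_simps)
  then show ?thesis
    by (simp add: fock_coeff_def mult.left_commute)
qed

lemma fock_coeff_sum_right:
  assumes "hpoly u" "a > 0"
  shows "(\<And>i. i \<in> I \<Longrightarrow> hpoly (v i)) \<Longrightarrow>
    fock_coeff a u (\<lambda>w. \<Sum>i\<in>I. v i w) z = (\<Sum>i\<in>I. fock_coeff a u (v i) z)"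
proof (induction I rule: infinite_finite_induct)
  case (insert i I)
  then show ?case
    using assms by (simp add: fock_coeff_add_right hpoly_sum)
qed (use fock_coeff_cmult_right [of a u 0 "\<lambda>_. 0" z] in simp_all)

lemma cnj_cdot: "cnj (cdot z w) = cdot (vcnj z) (vcnj w)"
  by (simp add: cdot_def vcnj_def)

lemma vcnj_vcnj [simp]: "vcnj (vcnj z) = z"
  by (simp add: vcnj_def vec_eq_iff)

lemma cdot_commute: "cdot z w = cdot w z"
  by (simp add: cdot_def mult.commute)

lemma cdot_self_vcnj: "cdot z (vcnj z) = of_real ((norm z)\<^sup>2)"
proof -
  have "of_real ((norm z)\<^sup>2) = (\<Sum>i\<in>UNIV. z $ i * cnj (z $ i))"
    unfolding norm_vec_def L2_set_def
    by (simp add: sum_nonneg complex_norm_square del: of_real_power)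
  then show ?thesis by (simp only: cdot_def vcnj_def vec_lambda_beta)
qed

text \<open>Reflects that the adjoint of the operator at \<open>z\<close> is the operator at
  \<open>- z\<close>; the substitution of w + z for \<open>w\<close> shows it. It transfers facts
  about the second slot to the first.\<close>

lemma fock_coeff_commute:
  assumes "hpoly u" "hpoly v"
  shows "fock_coeff a u v z = cnj (fock_coeff a v u (- z))"
proof -
  have "fock_integrand a u v z (w + z) = cnj (fock_integrand a v u (- z) w)" for w
  proof -
    have "cdot z (vcnj (w + z)) = cdot z (vcnj w) + of_real ((norm z)\<^sup>2)"
      unfolding cdot_self_vcnj [symmetric] by (simp add: cdot_def vcnj_def distrib_left sum.distrib)
    moreover have "(norm (w + z))\<^sup>2 = (norm w)\<^sup>2 + 2 * Re (cdot z (vcnj w)) + (norm z)\<^sup>2"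
      by (simp add: Re_cdot_vcnj power2_norm_eq_inner inner_add_left inner_add_right inner_commute)
    moreover have "2 * of_real (Re (cdot z (vcnj w))) = cdot z (vcnj w) + cnj (cdot z (vcnj w))"
      by (simp add: complex_add_cnj)
    moreover have "cdot (- z) (vcnj w) = - cdot z (vcnj w)"
      by (simp add: cdot_def sum_negf)
    ultimately have "cdot z (vcnj (w + z)) - of_real ((norm z)\<^sup>2) / 2 - of_real ((norm (w + z))\<^sup>2) =
        cnj (cdot (- z) (vcnj w) - of_real ((norm (- z))\<^sup>2) / 2 - of_real ((norm w)\<^sup>2))"
      by (simp add: algebra_simps)
    then have "fock_ker a z (w + z) = cnj (fock_ker a (- z) w)"
      by (simp only: fock_ker_def exp_cnj complex_cnj_mult complex_cnj_complex_of_real)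
    then show ?thesis by (simp add: fock_integrand_def)
  qed
  moreover have "(LINT w|lborel. fock_integrand a u v z (w + z)) = (LINT w|lborel. fock_integrand a u v z w)"
    by (intro integral_lborel_translation borel_measurable_continuous_onI fock_integrand_continuous2 assms)
  ultimately show ?thesis
    by (simp add: fock_coeff_def)
qed

text \<open>The derivatives in \<open>z\<close> are for differentiating the coefficient, those in
  \<open>w\<close> for integrating by parts. The kernel contributes the conjugate of w_j; written as
  the conjugate of (w - z)_j plus that of z_j, it is absorbed into the slot of \<open>u\<close> as a
  coordinate factor.\<close>

lemma
  fixes u :: "complex ^ 'n \<Rightarrow> complex"
  assumes u: "hpoly u" and v: "hpoly v"
  shows wirtinger_fock_integrand1: "wirtinger (\<lambda>z. fock_integrand a u v z w)
      (\<lambda>j z. of_real a * (fock_integrand a (\<lambda>w. w $ j * u w) v z w + cnj (z $ j) / 2 * fock_integrand a u v z w))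
      (\<lambda>j z. - fock_integrand a (dz j u) v z w - of_real a * (z $ j / 2 * fock_integrand a u v z w))"
    and wirtinger_fock_integrand2: "wirtinger (fock_integrand a u v z)
      (\<lambda>j w. fock_integrand a u (dz j v) z w -
        of_real a * (fock_integrand a (\<lambda>w. w $ j * u w) v z w + cnj (z $ j) * fock_integrand a u v z w))
      (\<lambda>j w. fock_integrand a (dz j u) v z w -
        of_real a * (fock_integrand a u (\<lambda>w. w $ j * v w) z w - z $ j * fock_integrand a u v z w))"
proof -
  have wu: "wirtinger u (\<lambda>j. dz j u) (\<lambda>_ _. 0)" and wv: "wirtinger v (\<lambda>j. dz j v) (\<lambda>_ _. 0)"
    using u v hpoly_wirtinger by blast+
  have delta: "(\<Sum>i\<in>UNIV. (if j = i then f i else 0)) = f j" "(\<Sum>i\<in>UNIV. g i * (if j = i then 1 else 0)) = g j"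
    "(\<Sum>i\<in>UNIV. (if j = i then 1 else 0) * g i) = g j"
    for j :: 'n and f g :: "'n \<Rightarrow> complex"
    by (auto simp: if_distrib if_distribR cong: if_cong)
  have cdot1: "wirtinger (\<lambda>z. cdot z (vcnj w)) (\<lambda>j _. cnj (w $ j)) (\<lambda>_ _. 0)"
    unfolding cdot_def
    by (rule wirtinger_cong [OF wirtinger_sum [where I = UNIV, OF wirtinger_mult [OF wirtinger_coord wirtinger_const]]])
      (auto simp: vcnj_def delta)
  have cdot2: "wirtinger (\<lambda>w. cdot z (vcnj w)) (\<lambda>_ _. 0) (\<lambda>j _. z $ j)"
    unfolding cdot_def vcnj_def vec_lambda_beta
    by (rule wirtinger_cong [OF wirtinger_sum [where I = UNIV,
            OF wirtinger_mult [OF wirtinger_const wirtinger_cnj [OF wirtinger_coord]]]])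
      (auto simp: if_distrib if_distribR cong: if_cong)
  have ker1: "wirtinger (\<lambda>z. fock_ker a z w)
      (\<lambda>j z. of_real a * (cnj (w $ j) - cnj (z $ j) / 2) * fock_ker a z w)
      (\<lambda>j z. of_real a * (- z $ j / 2) * fock_ker a z w)"
    by (rule wirtinger_cong [OF wirtinger_exp [OF wirtinger_cmult [where c = "of_real a", OF wirtinger_add [OF cdot1
              wirtinger_add [OF wirtinger_cmult [where c = "- 1 / 2", OF wirtinger_norm_power2]
                wirtinger_const [of "- of_real ((norm w)\<^sup>2)"]]]]]])
      (auto simp: fock_ker_def algebra_simps)
  have ker2: "wirtinger (\<lambda>w. fock_ker a z w)
      (\<lambda>j w. of_real a * (- cnj (w $ j)) * fock_ker a z w)
      (\<lambda>j w. of_real a * (z $ j - w $ j) * fock_ker a z w)"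
    by (rule wirtinger_cong [OF wirtinger_exp [OF wirtinger_cmult [where c = "of_real a", OF wirtinger_add [OF cdot2
              wirtinger_add [OF wirtinger_cmult [where c = "- 1", OF wirtinger_norm_power2]
                wirtinger_const [of "- of_real ((norm z)\<^sup>2) / 2"]]]]]])
      (auto simp: fock_ker_def algebra_simps)
  show "wirtinger (\<lambda>z. fock_integrand a u v z w)
      (\<lambda>j z. of_real a * (fock_integrand a (\<lambda>w. w $ j * u w) v z w + cnj (z $ j) / 2 * fock_integrand a u v z w))
      (\<lambda>j z. - fock_integrand a (dz j u) v z w - of_real a * (z $ j / 2 * fock_integrand a u v z w))"
    unfolding fock_integrand_def
    by (rule wirtinger_cong [OF wirtinger_mult [OF wirtinger_mult [OF
              wirtinger_cnj [OF wirtinger_reflect [OF wu, of w]] wirtinger_const [of "v w"]] ker1]])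
      (auto simp: algebra_simps)
  have wu': "wirtinger (\<lambda>w. u (w - z)) (\<lambda>j w. dz j u (w - z)) (\<lambda>_ _. 0)"
    using wirtinger_translate [OF wu, of "- z"] by simp
  show "wirtinger (fock_integrand a u v z)
      (\<lambda>j w. fock_integrand a u (dz j v) z w -
        of_real a * (fock_integrand a (\<lambda>w. w $ j * u w) v z w + cnj (z $ j) * fock_integrand a u v z w))
      (\<lambda>j w. fock_integrand a (dz j u) v z w -
        of_real a * (fock_integrand a u (\<lambda>w. w $ j * v w) z w - z $ j * fock_integrand a u v z w))"
    unfolding fock_integrand_def
    by (rule wirtinger_cong [OF wirtinger_mult [OF wirtinger_mult [OF wirtinger_cnj [OF wu'] wv] ker2]])
      (auto simp: algebra_simps)
qed

text \<open>The integrals of the derivatives in \<open>w\<close> vanish. At z = 0 this is the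
  adjunction between d/dw_j and multiplication by a w_j; elsewhere the shift by \<open>z\<close>
  adds a multiple of z_j or of its conjugate.\<close>

lemma
  assumes u: "hpoly u" and v: "hpoly v" and a: "a > 0"
  shows fock_coeff_dz_right: "fock_coeff a u (dz j v) z =
      of_real a * (fock_coeff a (\<lambda>w. w $ j * u w) v z + cnj (z $ j) * fock_coeff a u v z)"
    and fock_coeff_dz_left: "fock_coeff a (dz j u) v z =
      of_real a * (fock_coeff a u (\<lambda>w. w $ j * v w) z - z $ j * fock_coeff a u v z)"
proof -
  have gd: "gauss_decay (fock_integrand a u v z)" "gauss_decay (fock_integrand a u (dz j v) z)"
    "gauss_decay (fock_integrand a (dz j u) v z)" "gauss_decay (fock_integrand a (\<lambda>w. w $ j * u w) v z)"
    "gauss_decay (fock_integrand a u (\<lambda>w. w $ j * v w) z)" for j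
    by (intro gauss_decay_fock_integrand hpoly_dz hpoly_coord u v a)+
  note int = gd [THEN gauss_decay_integrable]
  have 1: "gauss_decay (\<lambda>w. fock_integrand a u (dz j v) z w -
        of_real a * (fock_integrand a (\<lambda>w. w $ j * u w) v z w + cnj (z $ j) * fock_integrand a u v z w))" for j
    by (intro gauss_decay_diff gauss_decay_add gauss_decay_cmult gd)
  have 2: "gauss_decay (\<lambda>w. fock_integrand a (dz j u) v z w -
        of_real a * (fock_integrand a u (\<lambda>w. w $ j * v w) z w - z $ j * fock_integrand a u v z w))" for j
    by (intro gauss_decay_diff gauss_decay_cmult gd)
  note zero = wirtinger_integral_eq_0 [OF wirtinger_fock_integrand2 [OF u v, of a z] gd(1) 1 2, of j]
  have "(LINT w|lborel. fock_integrand a u (dz j v) z w) = of_real a *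
      ((LINT w|lborel. fock_integrand a (\<lambda>w. w $ j * u w) v z w) + cnj (z $ j) * (LINT w|lborel. fock_integrand a u v z w))"
    using zero(1) int by simp
  note eq = this
  show "fock_coeff a u (dz j v) z =
      of_real a * (fock_coeff a (\<lambda>w. w $ j * u w) v z + cnj (z $ j) * fock_coeff a u v z)"
    unfolding fock_coeff_def eq by (simp add: algebra_simps)
  have "(LINT w|lborel. fock_integrand a (dz j u) v z w) = of_real a *
      ((LINT w|lborel. fock_integrand a u (\<lambda>w. w $ j * v w) z w) - z $ j * (LINT w|lborel. fock_integrand a u v z w))"
    using zero(2) int by simp
  note eq = this
  show "fock_coeff a (dz j u) v z =
      of_real a * (fock_coeff a u (\<lambda>w. w $ j * v w) z - z $ j * fock_coeff a u v z)"
    unfolding fock_coeff_def eq by (simp add: algebra_simps)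
qed

text \<open>Differentiation under the integral leaves terms in which \<open>u\<close> has changed;
  the two preceding relations move the change to \<open>v\<close>. This form can be iterated:
  \<open>u\<close> stays fixed while operators accumulate on \<open>v\<close>.\<close>

lemma wirtinger_fock_coeff:
  fixes u :: "complex ^ 'n \<Rightarrow> complex"
  assumes u: "hpoly u" and v: "hpoly v" and a: "a > 0"
  shows "wirtinger (fock_coeff a u v)
    (\<lambda>j z. fock_coeff a u (dz j v) z - of_real a / 2 * cnj (z $ j) * fock_coeff a u v z)
    (\<lambda>j z. of_real a / 2 * z $ j * fock_coeff a u v z - of_real a * fock_coeff a u (\<lambda>w. w $ j * v w) z)"
proof -
  let ?p = "\<lambda>j z w. of_real a * (fock_integrand a (\<lambda>w. w $ j * u w) v z w + cnj (z $ j) / 2 * fock_integrand a u v z w)"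
  let ?q = "\<lambda>j z w. - fock_integrand a (dz j u) v z w - of_real a * (z $ j / 2 * fock_integrand a u v z w)"
  have int: "integrable lborel (fock_integrand a u v z)" "integrable lborel (fock_integrand a (dz j u) v z)"
    "integrable lborel (fock_integrand a (\<lambda>w. w $ j * u w) v z)" for j z
    by (intro integrable_fock_integrand hpoly_dz hpoly_coord u v a)+
  have "wirtinger (\<lambda>z. LINT w|lborel. fock_integrand a u v z w)
      (\<lambda>j z. LINT w|lborel. ?p j z w) (\<lambda>j z. LINT w|lborel. ?q j z w)"
  proof (rule wirtinger_integral)
    show "wirtinger (\<lambda>z. fock_integrand a u v z w) (\<lambda>j z. ?p j z w) (\<lambda>j z. ?q j z w)" for w
      by (rule wirtinger_fock_integrand1 [OF u v])
    fix z :: "complex ^ 'n" and r :: real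
    \<comment> \<open>Dropping the Gaussian in w - z makes the bound uniform in
      \<open>z\<close>.\<close>
    have bound: "\<exists>C. \<forall>z w. norm (fock_integrand a u' v z w) \<le> C * exp (- (a / 4) * (norm w)\<^sup>2)"
      if "hpoly u'" for u'
    proof -
      note u' = that
      obtain C where "C \<ge> 0" and C: "\<And>z w. norm (fock_integrand a u' v z w) \<le>
          C * (exp (- (a / 4) * (norm (w - z))\<^sup>2) * exp (- (a / 4) * (norm w)\<^sup>2))"
        using fock_integrand_bound [OF u' v a] by blast
      have "norm (fock_integrand a u' v z w) \<le> C * exp (- (a / 4) * (norm w)\<^sup>2)" for z w
      proof -
        have "exp (- (a / 4) * (norm (w - z))\<^sup>2) * exp (- (a / 4) * (norm w)\<^sup>2) \<le>
            1 * exp (- (a / 4) * (norm w)\<^sup>2)"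
          using a by (intro mult_right_mono) auto
        then show ?thesis
          using order_trans [OF C [of z w] mult_left_mono [OF _ \<open>C \<ge> 0\<close>]] by simp
      qed
      then show ?thesis by blast
    qed
    obtain C where C: "\<And>z w. norm (fock_integrand a u v z w) \<le> C * exp (- (a / 4) * (norm w)\<^sup>2)"
      using bound [OF u] by blast
    have "\<forall>j. \<exists>D. \<forall>z w. norm (fock_integrand a (dz j u) v z w) \<le> D * exp (- (a / 4) * (norm w)\<^sup>2)"
      using bound [OF hpoly_dz [OF u]] by blast
    then obtain D where D: "\<And>j z w. norm (fock_integrand a (dz j u) v z w) \<le> D j * exp (- (a / 4) * (norm w)\<^sup>2)"
      by metis
    have "\<forall>j. \<exists>E. \<forall>z w. norm (fock_integrand a (\<lambda>w. w $ j * u w) v z w) \<le> E * exp (- (a / 4) * (norm w)\<^sup>2)"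
      using bound [OF hpoly_coord [OF u]] by blast
    then obtain E where E: "\<And>j z w. norm (fock_integrand a (\<lambda>w. w $ j * u w) v z w) \<le> E j * exp (- (a / 4) * (norm w)\<^sup>2)"
      by metis
    define R where "R = norm z + r"
    \<comment> \<open>One constant for all \<open>j\<close> and for both derivatives on the ball,
      where |z'_j| / 2 is at most |R|.\<close>
    define H where "H = (\<Sum>j\<in>UNIV. \<bar>D j\<bar> + a * \<bar>E j\<bar>) + a * (\<bar>R\<bar> * \<bar>C\<bar>)"
    let ?e = "\<lambda>w :: complex ^ 'n. exp (- (a / 4) * (norm w)\<^sup>2)"
    have "norm (?p j z' w) \<le> H * ?e w \<and> norm (?q j z' w) \<le> H * ?e w" if z': "z' \<in> cball z r" for z' j w
    proof -
      have "norm z' \<le> R"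
        using z' norm_triangle_sub [of z' z] by (simp add: R_def dist_norm norm_minus_commute)
      then have zR: "norm (z' $ j) / 2 \<le> \<bar>R\<bar>"
        using Finite_Cartesian_Product.norm_nth_le [of z' j] norm_ge_zero [of "z' $ j"] by linarith
      have zI: "norm (z' $ j) / 2 * norm (fock_integrand a u v z' w) \<le> \<bar>R\<bar> * (\<bar>C\<bar> * ?e w)"
        using C [of z' w] by (intro mult_mono zR) (auto intro: order_trans mult_right_mono)
      have memb: "\<bar>D j\<bar> + a * \<bar>E j\<bar> \<le> (\<Sum>j\<in>UNIV. \<bar>D j\<bar> + a * \<bar>E j\<bar>)"
        using a by (intro member_le_sum) auto
      have "norm (?p j z' w) = a * norm (fock_integrand a (\<lambda>w. w $ j * u w) v z' w + cnj (z' $ j) / 2 * fock_integrand a u v z' w)"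
        using a by (simp add: norm_mult)
      also have "\<dots> \<le> a * (norm (fock_integrand a (\<lambda>w. w $ j * u w) v z' w) + norm (cnj (z' $ j) / 2 * fock_integrand a u v z' w))"
        using a by (intro mult_left_mono norm_triangle_ineq) auto
      also have "\<dots> \<le> a * (\<bar>E j\<bar> * ?e w + \<bar>R\<bar> * (\<bar>C\<bar> * ?e w))"
        using E [of j z' w] zI a
        by (intro mult_left_mono add_mono) (auto simp: norm_mult norm_divide intro: order_trans mult_right_mono)
      also have "\<dots> = (a * \<bar>E j\<bar> + a * (\<bar>R\<bar> * \<bar>C\<bar>)) * ?e w"
        by (simp add: algebra_simps)
      also have "\<dots> \<le> H * ?e w"
        using memb unfolding H_def by (intro mult_right_mono add_mono) auto
      finally have p: "norm (?p j z' w) \<le> H * ?e w" .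
      have "norm (?q j z' w) \<le> norm (fock_integrand a (dz j u) v z' w) + norm (of_real a * (z' $ j / 2 * fock_integrand a u v z' w))"
        using norm_triangle_ineq4 [of "- fock_integrand a (dz j u) v z' w" "of_real a * (z' $ j / 2 * fock_integrand a u v z' w)"]
        by (simp only: norm_minus_cancel)
      also have "\<dots> \<le> \<bar>D j\<bar> * ?e w + a * (\<bar>R\<bar> * (\<bar>C\<bar> * ?e w))"
        using D [of j z' w] zI a
        by (intro add_mono) (auto simp: norm_mult norm_divide intro: order_trans mult_right_mono)
      also have "\<dots> = (\<bar>D j\<bar> + a * (\<bar>R\<bar> * \<bar>C\<bar>)) * ?e w"
        by (simp add: algebra_simps)
      also have "\<dots> \<le> H * ?e w"
      proof -
        have "\<bar>D j\<bar> \<le> \<bar>D j\<bar> + a * \<bar>E j\<bar>" using a by simp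
        then show ?thesis
          using memb unfolding H_def by (intro mult_right_mono add_mono) auto
      qed
      finally show ?thesis using p by blast
    qed
    moreover have "integrable lborel (\<lambda>w. H * ?e w)"
      using a by (intro integrable_mult_right gaussian_integral) auto
    ultimately show "\<exists>g. integrable lborel g \<and> (\<forall>z'\<in>cball z r. \<forall>j. \<forall>w\<in>space lborel.
        norm (?p j z' w) \<le> g w \<and> norm (?q j z' w) \<le> g w)"
      by (intro exI [of _ "\<lambda>w. H * ?e w"]) blast
  qed (use int in auto)
  from wirtinger_cmult [OF this, of "of_real ((a / pi) ^ CARD('n))"]
  have "wirtinger (fock_coeff a u v)
      (\<lambda>j z. of_real a * (fock_coeff a (\<lambda>w. w $ j * u w) v z + cnj (z $ j) / 2 * fock_coeff a u v z))
      (\<lambda>j z. - fock_coeff a (dz j u) v z - of_real a * (z $ j / 2 * fock_coeff a u v z))"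
    by (rule wirtinger_cong) (use int in \<open>auto simp: fock_coeff_def algebra_simps simp del: of_real_power\<close>)
  then show ?thesis
    by (rule wirtinger_cong) (auto simp: fock_coeff_dz_right [OF u v a] fock_coeff_dz_left [OF u v a] algebra_simps)
qed

section \<open>Orthogonality relations for the matrix coefficients\<close>

lemma fock_coeff_add_left:
  assumes "hpoly u" "hpoly u'" "hpoly v" "a > 0"
  shows "fock_coeff a (\<lambda>w. u w + u' w) v z = fock_coeff a u v z + fock_coeff a u' v z"
  using assms by (simp add: fock_coeff_commute [of _ v] hpoly_add fock_coeff_add_right)

lemma fock_coeff_cmult_left:
  assumes "hpoly u" "hpoly v"
  shows "fock_coeff a (\<lambda>w. c * u w) v z = cnj c * fock_coeff a u v z"
  using assms by (simp add: fock_coeff_commute [of _ v] hpoly_cmult fock_coeff_cmult_right)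

lemma fock_coeff_sum_left:
  assumes "hpoly v" "a > 0" "\<And>i. i \<in> I \<Longrightarrow> hpoly (u i)"
  shows "fock_coeff a (\<lambda>w. \<Sum>i\<in>I. u i w) v z = (\<Sum>i\<in>I. fock_coeff a (u i) v z)"
  using assms by (simp add: fock_coeff_commute [of _ v] hpoly_sum fock_coeff_sum_right)

lemma fock_coeff_zero_left: "fock_coeff a (\<lambda>_. 0) v z = 0"
  by (simp add: fock_coeff_def fock_integrand_def)

lemma dz_const [simp]: "dz j (\<lambda>_. c) = (\<lambda>_. 0)"
  by (rule wirtinger_dz [OF wirtinger_const])

text \<open>\<open>dz j\<close> kills 1, so for u = 1 the left side of
  \<open>fock_coeff_dz_left\<close> is 0.\<close>

lemma fock_coeff_one_coord:
  assumes "hpoly v" "a > 0"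
  shows "fock_coeff a (\<lambda>_. 1) (\<lambda>w. w $ j * v w) z = z $ j * fock_coeff a (\<lambda>_. 1) v z"
  using fock_coeff_dz_left [OF hpoly_const [of 1] assms, of j z] assms(2)
  by (simp add: fock_coeff_zero_left)

lemma fock_coeff_one_0:
  assumes "a > 0"
  shows "fock_coeff a (\<lambda>_. 1) (\<lambda>_. 1) (0 :: complex ^ 'n) = 1"
proof -
  have "fock_integrand a (\<lambda>_. 1) (\<lambda>_. 1) (0 :: complex ^ 'n) = (\<lambda>w. of_real (exp (- a * (norm w)\<^sup>2)))"
    by (simp add: fock_integrand_def fock_ker_def cdot_def fun_eq_iff exp_of_real [symmetric])
  moreover have "(LINT w|lborel. exp (- a * (norm (w :: complex ^ 'n))\<^sup>2)) = (pi / a) ^ CARD('n)"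
    using assms gaussian_integral(2) [OF assms, where 'a = "complex ^ 'n"]
    by (simp add: power_mult mult.commute [of "CARD('n)"])
  moreover have "(a / pi) ^ CARD('n) * (pi / a) ^ CARD('n) = 1"
    using assms by (simp add: power_mult_distrib [symmetric])
  ultimately show ?thesis
    using assms by (simp add: fock_coeff_def flip: of_real_power of_real_mult of_real_divide)
qed

text \<open>The derivative formula closes up at (1, 1): both derivatives are multiples of the
  coefficient itself, with the factors that belong to the Gaussian. The quotient by the Gaussian is
  therefore constant on every line through 0, and \<open>fock_coeff_one_0\<close> gives its
  value.\<close>

lemma fock_coeff_one:
  fixes z :: "complex ^ 'n"
  assumes "a > 0"
  shows "fock_coeff a (\<lambda>_. 1) (\<lambda>_. 1) z = of_real (exp (- (a / 2) * (norm z)\<^sup>2))"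
proof -
  let ?F = "fock_coeff a (\<lambda>_. 1) (\<lambda>_. 1) :: complex ^ 'n \<Rightarrow> complex"
  have zero: "fock_coeff a (\<lambda>_. 1) (\<lambda>_. 0) z = 0" for z :: "complex ^ 'n"
    by (simp add: fock_coeff_def fock_integrand_def)
  have coord: "fock_coeff a (\<lambda>_. 1) (\<lambda>w. w $ j * 1) z = z $ j * ?F z" for j z
    by (rule fock_coeff_one_coord [OF hpoly_const assms])
  have half: "of_real a / 2 * x * y - of_real a * (x * y) = - (of_real a / 2) * x * y" for x y :: complex
    by (simp add: field_simps)
  have W1: "wirtinger ?F (\<lambda>j z. - (of_real a / 2) * cnj (z $ j) * ?F z) (\<lambda>j z. - (of_real a / 2) * z $ j * ?F z)"
    using wirtinger_fock_coeff [OF hpoly_const [of 1] hpoly_const [of 1] assms, where 'n = 'n]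
    unfolding dz_const zero coord half diff_0 mult_minus_left .
  have W2: "wirtinger (\<lambda>z :: complex ^ 'n. exp (of_real a / 2 * of_real ((norm z)\<^sup>2)))
      (\<lambda>j z. of_real a / 2 * cnj (z $ j) * exp (of_real a / 2 * of_real ((norm z)\<^sup>2)))
      (\<lambda>j z. of_real a / 2 * z $ j * exp (of_real a / 2 * of_real ((norm z)\<^sup>2)))"
    by (intro wirtinger_exp wirtinger_cmult wirtinger_norm_power2)
  have "wirtinger (\<lambda>z. ?F z * exp (of_real a / 2 * of_real ((norm z)\<^sup>2))) (\<lambda>_ _. 0) (\<lambda>_ _. 0)"
    by (rule wirtinger_cong [OF wirtinger_mult [OF W1 W2]]) (simp_all add: mult_ac)
  from wirtingerD [OF this, of 0 z]
  have "((\<lambda>t::real. ?F (t *\<^sub>R z) * exp (of_real a / 2 * of_real ((norm (t *\<^sub>R z))\<^sup>2))) has_vector_derivative 0) (at t)"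
    for t :: real
    by (simp del: of_real_power)
  then obtain c where "\<And>t::real. ?F (t *\<^sub>R z) * exp (of_real a / 2 * of_real ((norm (t *\<^sub>R z))\<^sup>2)) = c"
    using has_vector_derivative_zero_constant [of UNIV "\<lambda>t. ?F (t *\<^sub>R z) * exp (of_real a / 2 * of_real ((norm (t *\<^sub>R z))\<^sup>2))"]
    by auto
  from this [of 0] this [of 1] have "?F z * exp (of_real a / 2 * of_real ((norm z)\<^sup>2)) = 1"
    using fock_coeff_one_0 [OF assms, where 'n = 'n] by simp
  then have "?F z = exp (- (of_real a / 2 * of_real ((norm z)\<^sup>2)))"
    by (simp add: exp_minus field_simps)
  then show ?thesis
    by (simp add: exp_of_real [symmetric])
qed

text \<open>The adjunction between multiplication by a coordinate and differentiation lowers the degrees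
  until only the value at \<open>(1, 1)\<close> is left.\<close>

lemma fock_form_unique:
  fixes L :: "(complex ^ 'n \<Rightarrow> complex) \<Rightarrow> (complex ^ 'n \<Rightarrow> complex) \<Rightarrow> complex"
  assumes a: "a > 0"
    and add_left: "\<And>u u' v. hpoly u \<Longrightarrow> hpoly u' \<Longrightarrow> hpoly v \<Longrightarrow> L (\<lambda>w. u w + u' w) v = L u v + L u' v"
    and const_left: "\<And>c v. hpoly v \<Longrightarrow> L (\<lambda>_. c) v = cnj c * L (\<lambda>_. 1) v"
    and add_right: "\<And>u v v'. hpoly u \<Longrightarrow> hpoly v \<Longrightarrow> hpoly v' \<Longrightarrow> L u (\<lambda>w. v w + v' w) = L u v + L u v'"
    and const_right: "\<And>c u. hpoly u \<Longrightarrow> L u (\<lambda>_. c) = c * L u (\<lambda>_. 1)"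
    and dz_left: "\<And>u v j. hpoly u \<Longrightarrow> hpoly v \<Longrightarrow> L (dz j u) v = of_real a * L u (\<lambda>w. w $ j * v w)"
    and dz_right: "\<And>u v j. hpoly u \<Longrightarrow> hpoly v \<Longrightarrow> L u (dz j v) = of_real a * L (\<lambda>w. w $ j * u w) v"
  shows "hpoly u \<Longrightarrow> hpoly v \<Longrightarrow> L u v = fock_coeff a u v 0 * L (\<lambda>_. 1) (\<lambda>_. 1)"
proof (induction arbitrary: v rule: hpoly.induct)
  case (hpoly_const c)
  have "L (\<lambda>_. 1) v = fock_coeff a (\<lambda>_. 1) v 0 * L (\<lambda>_. 1) (\<lambda>_. 1)"
    using hpoly_const
  proof (induction rule: hpoly.induct)
    case (hpoly_const c)
    show ?case
      using const_right [OF hpoly.hpoly_const [of 1], of c] fock_coeff_one_0 [OF a, where 'n = 'n]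
        fock_coeff_cmult_right [of a "\<lambda>_ :: complex ^ 'n. 1" c "\<lambda>_. 1" 0] by simp
  next
    case (hpoly_add u v)
    then show ?case
      by (simp add: add_right fock_coeff_add_right a hpoly.hpoly_const distrib_right)
  next
    case (hpoly_coord u j)
    \<comment> \<open>Since \<open>dz j\<close> kills 1, the left side is \<open>L\<close> at the
      zero function, which vanishes by \<open>const_left\<close> with c = 0. So L(1, w_j u)
      vanishes, as the inner product does.\<close>
    have "L (dz j (\<lambda>_. 1)) u = of_real a * L (\<lambda>_. 1) (\<lambda>w. w $ j * u w)"
      by (intro dz_left hpoly.hpoly_const hpoly_coord)
    then show ?case
      using const_left [OF hpoly_coord(1), of 0] a hpoly_coord(1) by (simp add: fock_coeff_one_coord)
  qed
  then show ?case
    using const_left [OF hpoly_const, of c] fock_coeff_cmult_left [OF hpoly.hpoly_const [of 1] hpoly_const, of a c]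
    by simp
next
  case (hpoly_add u u')
  then show ?case
    by (simp add: add_left fock_coeff_add_left a distrib_right)
next
  case (hpoly_coord u j)
  \<comment> \<open>The coordinate leaves \<open>u\<close> and becomes a derivative of
    \<open>v\<close>; hence the induction hypothesis for arbitrary \<open>v\<close>.\<close>
  have "of_real a * L (\<lambda>w. w $ j * u w) v = L u (dz j v)"
    using dz_right [OF hpoly_coord(1,3)] by simp
  also have "\<dots> = fock_coeff a u (dz j v) 0 * L (\<lambda>_. 1) (\<lambda>_. 1)"
    by (intro hpoly_coord.IH hpoly_dz hpoly_coord.prems)
  also have "fock_coeff a u (dz j v) 0 = of_real a * fock_coeff a (\<lambda>w. w $ j * u w) v 0"
    by (simp add: fock_coeff_dz_right [OF hpoly_coord(1,3) a])
  finally show ?case using a by simp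
qed

lemma integrable_fock_coeff_mult:
  assumes "hpoly u" "hpoly v" "hpoly u'" "hpoly v'" "a > 0"
  shows "integrable lborel (\<lambda>z. fock_coeff a u v z * cnj (fock_coeff a u' v' z))"
  by (intro gauss_decay_integrable gauss_decay_mult gauss_decay_cnj gauss_decay_fock_coeff assms)

text \<open>In the derivatives of F(u, v) times the conjugate of F(u', v'), the terms with z_j and
  with its conjugate cancel. That the rest integrates to 0 is the adjunction for the pair (v',
  v).\<close>

lemma
  assumes h: "hpoly u" "hpoly v" "hpoly u'" "hpoly v'" and a: "a > 0"
  shows fock_coeff_orth_dz1: "(LINT z|lborel. fock_coeff a u (dz j v) z * cnj (fock_coeff a u' v' z)) =
      of_real a * (LINT z|lborel. fock_coeff a u v z * cnj (fock_coeff a u' (\<lambda>w. w $ j * v' w) z))"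
    and fock_coeff_orth_dz2: "(LINT z|lborel. fock_coeff a u v z * cnj (fock_coeff a u' (dz j v') z)) =
      of_real a * (LINT z|lborel. fock_coeff a u (\<lambda>w. w $ j * v w) z * cnj (fock_coeff a u' v' z))"
proof -
  let ?F = "fock_coeff a"
  let ?p = "\<lambda>j z. ?F u (dz j v) z * cnj (?F u' v' z) - of_real a * (?F u v z * cnj (?F u' (\<lambda>w. w $ j * v' w) z))"
  let ?q = "\<lambda>j z. ?F u v z * cnj (?F u' (dz j v') z) - of_real a * (?F u (\<lambda>w. w $ j * v w) z * cnj (?F u' v' z))"
  have W: "wirtinger (\<lambda>z. ?F u v z * cnj (?F u' v' z)) ?p ?q"
    by (rule wirtinger_cong [OF wirtinger_mult [OF wirtinger_fock_coeff [OF h(1,2) a]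
            wirtinger_cnj [OF wirtinger_fock_coeff [OF h(3,4) a]]]])
      (auto simp: algebra_simps)
  have gd: "gauss_decay (\<lambda>z. ?F u v z * cnj (?F u' v' z))" "gauss_decay (?p i)" "gauss_decay (?q i)" for i
    by (intro gauss_decay_diff gauss_decay_cmult gauss_decay_mult gauss_decay_cnj gauss_decay_fock_coeff
        hpoly_dz hpoly_coord h a)+
  note zero = wirtinger_integral_eq_0 [OF W gd, of j]
  have int: "integrable lborel (\<lambda>z. ?F u (dz j v) z * cnj (?F u' v' z))"
    "integrable lborel (\<lambda>z. ?F u v z * cnj (?F u' (\<lambda>w. w $ j * v' w) z))"
    "integrable lborel (\<lambda>z. ?F u v z * cnj (?F u' (dz j v') z))"
    "integrable lborel (\<lambda>z. ?F u (\<lambda>w. w $ j * v w) z * cnj (?F u' v' z))"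
    by (intro integrable_fock_coeff_mult hpoly_dz hpoly_coord h a)+
  show "(LINT z|lborel. ?F u (dz j v) z * cnj (?F u' v' z)) =
      of_real a * (LINT z|lborel. ?F u v z * cnj (?F u' (\<lambda>w. w $ j * v' w) z))"
    using zero(1) int by simp
  show "(LINT z|lborel. ?F u v z * cnj (?F u' (dz j v') z)) =
      of_real a * (LINT z|lborel. ?F u (\<lambda>w. w $ j * v w) z * cnj (?F u' v' z))"
    using zero(2) int by simp
qed

text \<open>Brings the first arguments into the second slots, where the adjunction acts; replacing
  \<open>z\<close> by \<open>- z\<close> undoes the reflection in
  \<open>fock_coeff_commute\<close>.\<close>

lemma fock_coeff_orth_swap:
  fixes u :: "complex ^ 'n \<Rightarrow> complex"
  assumes h: "hpoly u" "hpoly v" "hpoly u'" "hpoly v'" and a: "a > 0"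
  shows "(LINT z|lborel. fock_coeff a u v z * cnj (fock_coeff a u' v' z)) =
    (LINT z|lborel. fock_coeff a v' u' z * cnj (fock_coeff a v u z))"
proof -
  let ?h = "\<lambda>z. fock_coeff a v' u' z * cnj (fock_coeff a v u z)"
  have "fock_coeff a u v z * cnj (fock_coeff a u' v' z) = ?h (- z)" for z
    using h by (simp add: fock_coeff_commute [of u v] fock_coeff_commute [of u' v'])
  moreover have "(LINT z|lborel. ?h (- z)) = (LINT z|lborel. ?h z)"
    by (rule integral_lborel_orthogonal [where f = uminus])
      (auto simp: orthogonal_transformation_def linear_uminus
        intro!: gauss_decay_measurable gauss_decay_mult gauss_decay_cnj gauss_decay_fock_coeff h a)
  ultimately show ?thesis by simp
qed

text \<open>With \<open>u\<close> and \<open>u'\<close> fixed, the integral is a form in (v', v) to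
  which \<open>fock_form_unique\<close> applies, hence a multiple of the inner product. After a swap
  the same argument treats \<open>u\<close> and \<open>u'\<close>, and the integral of exp(- a
  |z|^2) remains.\<close>

lemma fock_coeff_orthogonality:
  fixes u :: "complex ^ 'n \<Rightarrow> complex"
  assumes h: "hpoly u" "hpoly v" "hpoly u'" "hpoly v'" and a: "a > 0"
  shows "(LINT z|lborel. fock_coeff a u v z * cnj (fock_coeff a u' v' z)) =
    of_real ((pi / a) ^ CARD('n)) * fock_coeff a u u' 0 * fock_coeff a v' v 0"
proof -
  let ?c = "\<lambda>(u :: complex ^ 'n \<Rightarrow> complex) v u' v'. LINT z|lborel. fock_coeff a u v z * cnj (fock_coeff a u' v' z)"
  note one = hpoly_const [of 1]
  have reduce: "?c u v u' v' = fock_coeff a v' v 0 * ?c u (\<lambda>_. 1) u' (\<lambda>_. 1)"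
    if h: "hpoly u" "hpoly v" "hpoly u'" "hpoly v'" for u v u' v' :: "complex ^ 'n \<Rightarrow> complex"
  \<comment> \<open>\<open>v'\<close> is the first argument of the form because the integral is
    conjugate linear in it.\<close>
  proof (rule fock_form_unique [where L = "\<lambda>v' v. ?c u v u' v'", OF a])
    note int = integrable_fock_coeff_mult [OF _ _ _ _ a]
    show "?c u v u' (\<lambda>w. x w + y w) = ?c u v u' x + ?c u v u' y" if "hpoly x" "hpoly y" "hpoly v" for x y v
      using that h a by (simp add: fock_coeff_add_right distrib_left int)
    show "?c u (\<lambda>w. x w + y w) u' v = ?c u x u' v + ?c u y u' v" if "hpoly v" "hpoly x" "hpoly y" for x y v
      using that h a by (simp add: fock_coeff_add_right distrib_right int)
    show "?c u v u' (\<lambda>_. c) = cnj c * ?c u v u' (\<lambda>_. 1)" for c v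
    proof -
      have "fock_coeff a u' (\<lambda>_. c) z = c * fock_coeff a u' (\<lambda>_. 1) z" for z
        using fock_coeff_cmult_right [of a u' c "\<lambda>_. 1" z] by simp
      then show ?thesis by (simp add: mult.left_commute)
    qed
    show "?c u (\<lambda>_. c) u' v = c * ?c u (\<lambda>_. 1) u' v" for c v
    proof -
      have "fock_coeff a u (\<lambda>_. c) z = c * fock_coeff a u (\<lambda>_. 1) z" for z
        using fock_coeff_cmult_right [of a u c "\<lambda>_. 1" z] by simp
      then show ?thesis by (simp add: mult.assoc)
    qed
  qed (use h a in \<open>auto intro: fock_coeff_orth_dz1 fock_coeff_orth_dz2\<close>)
  have "?c u v u' v' = fock_coeff a v' v 0 * ?c u (\<lambda>_. 1) u' (\<lambda>_. 1)"
    by (rule reduce [OF h])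
  also have "?c u (\<lambda>_. 1) u' (\<lambda>_. 1) = ?c (\<lambda>_. 1) u' (\<lambda>_. 1) u"
    by (rule fock_coeff_orth_swap [OF h(1) one h(3) one a])
  also have "\<dots> = fock_coeff a u u' 0 * ?c (\<lambda>_. 1) (\<lambda>_. 1) (\<lambda>_. 1) (\<lambda>_. 1)"
    by (rule reduce [OF one h(3) one h(1)])
  also have "?c (\<lambda>_. 1) (\<lambda>_. 1) (\<lambda>_. 1) (\<lambda>_. 1) = (LINT z|lborel. of_real (exp (- a * (norm (z :: complex ^ 'n))\<^sup>2)))"
  proof -
    have "exp (- (a / 2) * t) * exp (- (a / 2) * t) = exp (- a * t)" for t
      by (simp add: exp_add [symmetric])
    then show ?thesis
      unfolding fock_coeff_one [OF a] complex_cnj_complex_of_real of_real_mult [symmetric] by simp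
  qed
  also have "\<dots> = of_real ((pi / a) ^ CARD('n))"
    using a gaussian_integral(2) [OF a, where 'a = "complex ^ 'n"]
    by (simp add: power_mult mult.commute [of "CARD('n)"])
  finally show ?thesis by (simp only: mult_ac)
qed

section \<open>The Weyl correspondence\<close>

text \<open>\<open>fock_coeff\<close> translates \<open>u\<close> by minus its argument, whereas for
  positive \<open>lam\<close> the representation translates by plus the conjugate of
  \<open>z\<close>. This argument makes one coefficient serve both signs.\<close>

definition fock_arg :: "real \<Rightarrow> complex ^ 'n \<Rightarrow> complex ^ 'n" where
  "fock_arg lam z = (if lam > 0 then - vcnj z else z)"

lemma norm_vcnj [simp]: "norm (vcnj z) = norm z"
  by (simp add: vcnj_def norm_vec_def)

lemma vcnj_add: "vcnj (z + w) = vcnj z + vcnj w"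
  and vcnj_scaleR: "vcnj (r *\<^sub>R z) = r *\<^sub>R vcnj z"
  by (simp_all add: vcnj_def vec_eq_iff)

lemma cdot_minus_left: "cdot (- z) w = - cdot z w"
  by (simp add: cdot_def sum_negf)

lemma orthogonal_transformation_fock_arg: "orthogonal_transformation (fock_arg lam)"
  unfolding orthogonal_transformation
  by (auto simp: fock_arg_def vcnj_add vcnj_scaleR intro!: linearI)

lemma fock_inner_eq_fock_coeff: "fock_inner lam u v = fock_coeff (2 * \<bar>lam\<bar>) u v 0"
proof -
  have "cdot 0 w = 0" for w :: "complex ^ 'a"
    by (simp add: cdot_def)
  then show ?thesis
    by (simp add: fock_inner_def fock_coeff_def fock_integrand_def fock_ker_def exp_of_real [symmetric])
qed

lemma fock_inner_fock_rep:
  assumes "lam \<noteq> 0"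
  shows "fock_inner lam (fock_rep lam z u) v = fock_coeff (2 * \<bar>lam\<bar>) u v (fock_arg lam z)"
proof -
  have "cnj (fock_rep lam z u w) * v w * of_real (exp (- 2 * \<bar>lam\<bar> * (norm w)\<^sup>2)) =
      fock_integrand (2 * \<bar>lam\<bar>) u v (fock_arg lam z) w" for w
  proof (cases "lam > 0")
    case True
    have "cnj (exp (- 2 * of_real lam * (cdot w z + of_real ((norm z)\<^sup>2 / 2)))) * of_real (exp (- 2 * lam * (norm w)\<^sup>2)) =
        exp (of_real (2 * lam) * (cdot (- vcnj z) (vcnj w) - of_real ((norm z)\<^sup>2) / 2 - of_real ((norm w)\<^sup>2)))"
      by (simp add: exp_cnj exp_of_real [symmetric] exp_add [symmetric] cnj_cdot cdot_minus_left cdot_commute [of "vcnj w"]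
          algebra_simps)
    then show ?thesis
      using True by (simp add: fock_rep_def fock_integrand_def fock_ker_def fock_arg_def mult_ac)
  next
    case False
    have "cnj (exp (2 * of_real lam * (- cdot w (vcnj z) + of_real ((norm z)\<^sup>2 / 2)))) * of_real (exp (2 * lam * (norm w)\<^sup>2)) =
        exp (of_real (- 2 * lam) * (cdot z (vcnj w) - of_real ((norm z)\<^sup>2) / 2 - of_real ((norm w)\<^sup>2)))"
      by (simp add: exp_cnj exp_of_real [symmetric] exp_add [symmetric] cnj_cdot cdot_commute [of "vcnj w"]
          algebra_simps)
    then show ?thesis
      using False by (simp add: fock_rep_def fock_integrand_def fock_ker_def fock_arg_def mult_ac)
  qed
  then show ?thesis
    by (simp add: fock_inner_def fock_coeff_def)
qed

text \<open>The terms with \<open>lam\<close> cancel those in \<open>R_op\<close> and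
  \<open>Rbar_op\<close>, so - R_j and R_j-bar act on \<open>v\<close> as \<open>W_op\<close> and
  \<open>Wbar_op\<close>. For positive \<open>lam\<close> the exchange of the two derivatives under
  conjugation matches the interchange of multiplication and differentiation.\<close>

lemma wirtinger_fock_coeff_arg:
  assumes "hpoly u" "hpoly v" "lam \<noteq> 0"
  shows "wirtinger (\<lambda>z. fock_coeff (2 * \<bar>lam\<bar>) u v (fock_arg lam z))
    (\<lambda>j z. fock_coeff (2 * \<bar>lam\<bar>) u (Wbar_op lam j v) (fock_arg lam z) +
       of_real lam * cnj (z $ j) * fock_coeff (2 * \<bar>lam\<bar>) u v (fock_arg lam z))
    (\<lambda>j z. - fock_coeff (2 * \<bar>lam\<bar>) u (W_op lam j v) (fock_arg lam z) -
       of_real lam * z $ j * fock_coeff (2 * \<bar>lam\<bar>) u v (fock_arg lam z))"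
proof -
  let ?a = "2 * \<bar>lam\<bar>"
  have a: "?a > 0" using assms by simp
  note W = wirtinger_fock_coeff [OF assms(1,2) a]
  have mult: "fock_coeff ?a u (\<lambda>w. 2 * of_real \<bar>lam\<bar> * w $ j * v w) z = of_real ?a * fock_coeff ?a u (\<lambda>w. w $ j * v w) z" for j z
    using fock_coeff_cmult_right [of ?a u "of_real ?a" "\<lambda>w. w $ j * v w" z] by (simp add: mult.assoc)
  show ?thesis
  proof (cases "lam > 0")
    case True
    then show ?thesis
      using mult by (intro wirtinger_cong [OF wirtinger_conj_arg [OF W]])
        (auto simp: fock_arg_def W_op_def Wbar_op_def vcnj_def algebra_simps)
  next
    case False
    then have "\<bar>lam\<bar> = - lam" by simp
    with False show ?thesis
      using mult by (intro wirtinger_cong [OF W])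
        (auto simp: fock_arg_def W_op_def Wbar_op_def algebra_simps)
  qed
qed

text \<open>Both products run through the same \<open>index_list\<close>, so a relation preserved by
  each factor is preserved by the product. Choices of \<open>S\<close> give transfer between
  operators, evaluation at a point and closure under the operators.\<close>

lemma opow_rel:
  assumes step: "\<And>j f g. S f g \<Longrightarrow> S (A j f) (A' j g)" and "S f g"
  shows "S (opow A \<rho> f) (opow A' \<rho> g)"
proof -
  have "S f g \<Longrightarrow> S ((A j ^^ m) f) ((A' j ^^ m) g)" for j m f g
    by (induction m) (auto intro: step)
  then have "S (foldr (\<lambda>j g. (A j ^^ (\<rho> $ j)) \<circ> g) js id f) (foldr (\<lambda>j g. (A' j ^^ (\<rho> $ j)) \<circ> g) js id g)" for js
    using assms(2) by (induction js) auto
  then show ?thesis by (simp add: opow_def)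
qed

lemma opow_pointwise: "opow (\<lambda>j g b. A j (g b)) \<rho> g b = opow A \<rho> (g b)"
  by (rule opow_rel [where S = "\<lambda>f h. f b = h"]) auto

lemma hpoly_opow:
  assumes "\<And>j u. hpoly u \<Longrightarrow> hpoly (A j u)" "hpoly u"
  shows "hpoly (opow A \<rho> u)"
  using opow_rel [where S = "\<lambda>u _. hpoly u" and A = A and A' = A and f = u and g = u] assms by blast

lemma
  assumes "hpoly u"
  shows hpoly_W_op: "hpoly (W_op lam j u)" and hpoly_Wbar_op: "hpoly (Wbar_op lam j u)"
proof -
  have "hpoly (\<lambda>w. 2 * of_real \<bar>lam\<bar> * w $ j * u w)"
    using hpoly_cmult [OF hpoly_coord [OF assms], of "2 * of_real \<bar>lam\<bar>" j] by (simp add: mult.assoc)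
  then show "hpoly (W_op lam j u)" "hpoly (Wbar_op lam j u)"
    using hpoly_dz [OF assms] by (auto simp only: W_op_def Wbar_op_def split: if_split)
qed

lemma theta_fock_coeff_sum:
  fixes B :: "(complex ^ 'n \<Rightarrow> complex) set"
  assumes lam: "lam \<noteq> 0" and B: "\<And>b. b \<in> B \<Longrightarrow> hpoly b"
  shows "theta lam p (\<lambda>z. c * (\<Sum>b\<in>B. fock_coeff (2 * \<bar>lam\<bar>) b b (fock_arg lam z))) z =
    c * (\<Sum>b\<in>B. fock_coeff (2 * \<bar>lam\<bar>) b (weyl lam p b) (fock_arg lam z))"
proof -
  let ?F = "fock_coeff (2 * \<bar>lam\<bar>)"
  have a: "2 * \<bar>lam\<bar> > 0" using lam by simp
  \<comment> \<open>\<open>g b\<close> is the vector in the second slot, while the first slot stays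
    \<open>b\<close>. The operators turn \<open>G g\<close> into \<open>G\<close> of another family,
    which is what preservation of \<open>S\<close> expresses.\<close>
  define G where "G g = (\<lambda>z. c * (\<Sum>b\<in>B. ?F b (g b) (fock_arg lam z)))" for g
  define S where "S f g \<longleftrightarrow> (\<forall>b\<in>B. hpoly (g b)) \<and> f = G g" for f g
  have W: "wirtinger (G g)
      (\<lambda>j z. c * (\<Sum>b\<in>B. ?F b (Wbar_op lam j (g b)) (fock_arg lam z) + of_real lam * cnj (z $ j) * ?F b (g b) (fock_arg lam z)))
      (\<lambda>j z. c * (\<Sum>b\<in>B. - ?F b (W_op lam j (g b)) (fock_arg lam z) - of_real lam * z $ j * ?F b (g b) (fock_arg lam z)))"
    if "\<forall>b\<in>B. hpoly (g b)" for g
    unfolding G_def by (intro wirtinger_cmult wirtinger_sum wirtinger_fock_coeff_arg lam) (use that B in auto)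
  have R: "S (- R_op lam j f) (\<lambda>b. W_op lam j (g b))" if "S f g" for j f g
  proof -
    from that have g: "\<forall>b\<in>B. hpoly (g b)" and f: "f = G g" by (auto simp: S_def)
    have "- R_op lam j f = G (\<lambda>b. W_op lam j (g b))"
      unfolding R_op_def f wirtinger_dzb [OF W [OF g], of j]
      by (auto simp: G_def fun_eq_iff sum.distrib sum_subtractf sum_negf sum_distrib_left algebra_simps)
    with g show ?thesis by (simp add: S_def hpoly_W_op)
  qed
  have Rbar: "S (Rbar_op lam j f) (\<lambda>b. Wbar_op lam j (g b))" if "S f g" for j f g
  proof -
    from that have g: "\<forall>b\<in>B. hpoly (g b)" and f: "f = G g" by (auto simp: S_def)
    have "Rbar_op lam j f = G (\<lambda>b. Wbar_op lam j (g b))"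
      unfolding Rbar_op_def f wirtinger_dz [OF W [OF g], of j]
      by (auto simp: G_def fun_eq_iff sum.distrib sum_distrib_left algebra_simps)
    with g show ?thesis by (simp add: S_def hpoly_Wbar_op)
  qed
  \<comment> \<open>\<open>S\<close> relates a function to a whole family, so the operators act on
    \<open>g\<close> at each \<open>b\<close> separately; \<open>opow_pointwise\<close> turns this
    into the power applied to \<open>g b\<close>.\<close>
  have R': "S (opow (\<lambda>j g. - R_op lam j g) \<rho> f) (\<lambda>b. opow (W_op lam) \<rho> (g b))" if "S f g" for \<rho> f g
    using opow_rel [where S = S and A = "\<lambda>j g. - R_op lam j g" and A' = "\<lambda>j g b. W_op lam j (g b)", OF R that, of \<rho>]
    by (simp add: opow_pointwise [abs_def])
  have Rbar': "S (opow (Rbar_op lam) \<gamma> f) (\<lambda>b. opow (Wbar_op lam) \<gamma> (g b))" if "S f g" for \<gamma> f g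
    using opow_rel [where S = S and A = "Rbar_op lam" and A' = "\<lambda>j g b. Wbar_op lam j (g b)", OF Rbar that, of \<gamma>]
    by (simp add: opow_pointwise [abs_def])
  have S0: "S (G (\<lambda>b. b)) (\<lambda>b. b)"
    using B by (simp add: S_def)
  \<comment> \<open>\<open>X\<close> and \<open>Y\<close> are the two orderings that
    \<open>weyl\<close> averages.\<close>
  define X where "X \<rho> \<gamma> b = opow (Wbar_op lam) \<gamma> (opow (W_op lam) \<rho> b)"
    for \<rho> \<gamma> and b :: "complex ^ 'n \<Rightarrow> complex"
  define Y where "Y \<rho> \<gamma> b = opow (W_op lam) \<rho> (opow (Wbar_op lam) \<gamma> b)"
    for \<rho> \<gamma> and b :: "complex ^ 'n \<Rightarrow> complex"
  have XY: "hpoly (X \<rho> \<gamma> b)" "hpoly (Y \<rho> \<gamma> b)" if "b \<in> B" for \<rho> \<gamma> b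
    unfolding X_def Y_def using B [OF that] by (auto intro!: hpoly_opow hpoly_W_op hpoly_Wbar_op)
  have X: "opow (Rbar_op lam) \<gamma> (opow (\<lambda>j g. - R_op lam j g) \<rho> (G (\<lambda>b. b))) = G (X \<rho> \<gamma>)" for \<rho> \<gamma>
    using Rbar' [OF R' [OF S0]] by (simp add: S_def X_def [abs_def])
  have Y: "opow (\<lambda>j g. - R_op lam j g) \<rho> (opow (Rbar_op lam) \<gamma> (G (\<lambda>b. b))) = G (Y \<rho> \<gamma>)" for \<rho> \<gamma>
    using R' [OF Rbar' [OF S0]] by (simp add: S_def Y_def [abs_def])
  have weyl: "?F b (weyl lam p b) z = (\<Sum>(\<rho>, \<gamma>)\<in>Poly_Mapping.keys p. Poly_Mapping.lookup p (\<rho>, \<gamma>) * (1 / 2) *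
      (?F b (X \<rho> \<gamma> b) z + ?F b (Y \<rho> \<gamma> b) z))" if b: "b \<in> B" for b z
  proof -
    have "weyl lam p b = (\<lambda>w. \<Sum>k\<in>Poly_Mapping.keys p. Poly_Mapping.lookup p k * (1 / 2) *
        (X (fst k) (snd k) b w + Y (fst k) (snd k) b w))"
      by (auto simp: weyl_def X_def Y_def case_prod_beta' fun_eq_iff)
    moreover have "?F b (\<lambda>w. \<Sum>k\<in>Poly_Mapping.keys p. Poly_Mapping.lookup p k * (1 / 2) *
        (X (fst k) (snd k) b w + Y (fst k) (snd k) b w)) z = (\<Sum>k\<in>Poly_Mapping.keys p.
          ?F b (\<lambda>w. Poly_Mapping.lookup p k * (1 / 2) * (X (fst k) (snd k) b w + Y (fst k) (snd k) b w)) z)"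
      by (intro fock_coeff_sum_right hpoly_cmult hpoly_add XY [OF b] B [OF b] a)
    ultimately show ?thesis
      by (simp only: fock_coeff_cmult_right fock_coeff_add_right [OF B [OF b] XY [OF b] a] case_prod_beta' prod.collapse)
  qed
  have "theta lam p (G (\<lambda>b. b)) z = (\<Sum>(\<rho>, \<gamma>)\<in>Poly_Mapping.keys p. Poly_Mapping.lookup p (\<rho>, \<gamma>) * (1 / 2) *
      (G (X \<rho> \<gamma>) z + G (Y \<rho> \<gamma>) z))"
    by (simp only: theta_def X Y)
  also have "\<dots> = c * (\<Sum>(\<rho>, \<gamma>)\<in>Poly_Mapping.keys p. \<Sum>b\<in>B. Poly_Mapping.lookup p (\<rho>, \<gamma>) * (1 / 2) *
      (?F b (X \<rho> \<gamma> b) (fock_arg lam z) + ?F b (Y \<rho> \<gamma> b) (fock_arg lam z)))"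
    unfolding sum_distrib_left by (intro sum.cong refl)
      (auto simp: G_def sum_distrib_left distrib_left sum.distrib mult_ac)
  also have "(\<Sum>(\<rho>, \<gamma>)\<in>Poly_Mapping.keys p. \<Sum>b\<in>B. Poly_Mapping.lookup p (\<rho>, \<gamma>) * (1 / 2) *
      (?F b (X \<rho> \<gamma> b) (fock_arg lam z) + ?F b (Y \<rho> \<gamma> b) (fock_arg lam z))) =
      (\<Sum>b\<in>B. ?F b (weyl lam p b) (fock_arg lam z))"
    unfolding case_prod_beta' by (subst sum.swap, intro sum.cong refl) (simp add: weyl case_prod_beta')
  finally show ?thesis by (simp add: G_def)
qed

section \<open>Unitary matrices\<close>

lemma matrix_inv_unique:
  assumes "A ** B = mat 1" "B ** A = mat 1"
  shows "matrix_inv A = B"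
proof -
  have "A ** matrix_inv A = mat 1"
    unfolding matrix_inv_def by (rule someI2 [of _ B]) (use assms in auto)
  then have "B ** (A ** matrix_inv A) = B" by simp
  then show ?thesis using assms by (simp add: matrix_mul_assoc)
qed

lemma mcnj_mult: "mcnj (A ** B) = mcnj A ** mcnj B"
  by (simp add: mcnj_def matrix_matrix_mult_def vec_eq_iff)

lemma mcnj_mcnj [simp]: "mcnj (mcnj A) = A"
  by (simp add: mcnj_def vec_eq_iff)

lemma mcnj_transpose: "mcnj (transpose A) = transpose (mcnj A)"
  by (simp add: mcnj_def transpose_def vec_eq_iff)

lemma mcnj_one [simp]: "mcnj (mat 1) = mat 1"
  by (simp add: mcnj_def mat_def vec_eq_iff)

lemma unitary_inv:
  assumes "unitary A"
  shows "matrix_inv A = transpose (mcnj A)"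
  using assms by (intro matrix_inv_unique) (auto simp: unitary_def)

lemma unitary_mcnj:
  assumes "unitary A"
  shows "unitary (mcnj A)"
proof -
  have "mcnj (A ** transpose (mcnj A)) = mat 1" "mcnj (transpose (mcnj A) ** A) = mat 1"
    using assms by (simp_all add: unitary_def)
  then show ?thesis
    by (simp add: unitary_def mcnj_mult mcnj_transpose)
qed

lemma cdot_unitary:
  assumes "unitary A"
  shows "cdot (A *v z) (vcnj (A *v w)) = cdot z (vcnj w)"
proof -
  have "transpose (transpose (mcnj A) ** A) = mat 1"
    using assms by (simp add: unitary_def)
  then have A: "transpose A ** mcnj A = mat 1"
    by (simp add: matrix_transpose_mul)
  have "cdot (A *v z) y = cdot z (transpose A *v y)" for y
  proof -
    have "cdot (A *v z) y = (\<Sum>i\<in>UNIV. \<Sum>j\<in>UNIV. A $ i $ j * z $ j * y $ i)"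
      by (simp add: cdot_def matrix_vector_mult_def sum_distrib_right)
    also have "\<dots> = cdot z (transpose A *v y)"
      by (subst sum.swap) (simp add: cdot_def matrix_vector_mult_def transpose_def sum_distrib_left mult_ac)
    finally show ?thesis .
  qed
  moreover have "vcnj (A *v w) = mcnj A *v vcnj w"
    by (simp add: vcnj_def mcnj_def matrix_vector_mult_def vec_eq_iff)
  ultimately show ?thesis
    by (simp only: matrix_vector_mul_assoc A matrix_vector_mul_lid)
qed

lemma norm_unitary:
  assumes "unitary A"
  shows "norm (A *v z) = norm z"
proof -
  have "complex_of_real ((norm (A *v z))\<^sup>2) = of_real ((norm z)\<^sup>2)"
    by (simp only: cdot_self_vcnj [symmetric] cdot_unitary [OF assms])
  then have "(norm (A *v z))\<^sup>2 = (norm z)\<^sup>2"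
    by (simp only: of_real_eq_iff)
  then show ?thesis by simp
qed

lemma orthogonal_transformation_unitary:
  assumes "unitary A"
  shows "orthogonal_transformation (\<lambda>z. A *v z)"
  unfolding orthogonal_transformation
proof
  show "linear ((*v) A)"
    by (rule linearI) (simp_all add: matrix_vector_right_distrib,
        simp add: matrix_vector_mult_def vec_eq_iff scaleR_sum_right)
qed (simp add: norm_unitary assms)

text \<open>Substitute A w for \<open>w\<close>: the kernel depends on its arguments only through a
  Hermitian product and norms.\<close>

lemma fock_coeff_unitary:
  assumes "unitary A" "hpoly u" "hpoly v"
  shows "fock_coeff a u v (A *v z) = fock_coeff a (\<lambda>w. u (A *v w)) (\<lambda>w. v (A *v w)) z"
proof -
  have "(LINT w|lborel. fock_integrand a u v (A *v z) (A *v w)) = (LINT w|lborel. fock_integrand a u v (A *v z) w)"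
    by (intro integral_lborel_orthogonal orthogonal_transformation_unitary assms
        borel_measurable_continuous_onI fock_integrand_continuous2)
  moreover have "fock_integrand a u v (A *v z) (A *v w) =
      fock_integrand a (\<lambda>w. u (A *v w)) (\<lambda>w. v (A *v w)) z w" for w
    by (simp add: fock_integrand_def fock_ker_def cdot_unitary assms norm_unitary matrix_vector_mult_diff_distrib)
  ultimately show ?thesis by (simp add: fock_coeff_def)
qed

text \<open>Continuity in the matrix by induction on the polynomial, with no estimate of the integral:
  multiplication by a coordinate moves to the other argument as a derivative.\<close>

lemma continuous_on_fock_coeff_matrix:
  fixes u v :: "complex ^ 'n \<Rightarrow> complex"
  assumes a: "a > 0" and "hpoly v"
  shows "hpoly u \<Longrightarrow> continuous_on UNIV (\<lambda>A. fock_coeff a u (\<lambda>w. v (A *v w)) 0)"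
  using assms(2)
proof (induction arbitrary: u rule: hpoly.induct)
  case (hpoly_add v v')
  then show ?case
    by (auto simp: fock_coeff_add_right hpoly_matrix_vector a intro!: continuous_on_add)
next
  case (hpoly_coord v j)
  have "fock_coeff a u (\<lambda>w. (A *v w) $ j * v (A *v w)) 0 =
      (\<Sum>i\<in>UNIV. A $ j $ i * (fock_coeff a (dz i u) (\<lambda>w. v (A *v w)) 0 / of_real a))" for A :: "complex ^ 'n ^ 'n"
  proof -
    have h: "hpoly (\<lambda>w. v (A *v w))"
      by (rule hpoly_matrix_vector [OF hpoly_coord(1)])
    have "(\<lambda>w. (A *v w) $ j * v (A *v w)) = (\<lambda>w. \<Sum>i\<in>UNIV. A $ j $ i * (w $ i * v (A *v w)))"
      by (simp add: matrix_vector_mult_def sum_distrib_right mult.assoc)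
    moreover have "fock_coeff a u (\<lambda>w. \<Sum>i\<in>UNIV. A $ j $ i * (w $ i * v (A *v w))) 0 =
        (\<Sum>i\<in>UNIV. fock_coeff a u (\<lambda>w. A $ j $ i * (w $ i * v (A *v w))) 0)"
      by (intro fock_coeff_sum_right hpoly_coord.prems a hpoly_cmult hpoly.hpoly_coord h)
    ultimately show ?thesis
      using a by (simp add: fock_coeff_cmult_right fock_coeff_dz_left [OF hpoly_coord.prems h a])
  qed
  moreover have "continuous_on UNIV (\<lambda>A :: complex ^ 'n ^ 'n.
      \<Sum>i\<in>UNIV. A $ j $ i * (fock_coeff a (dz i u) (\<lambda>w. v (A *v w)) 0 / of_real a))"
    using a by (intro continuous_intros hpoly_coord.IH hpoly_dz hpoly_coord.prems) auto
  ultimately show ?case by simp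
qed simp

section \<open>Schur's lemma for the averages over \<open>K\<close>\<close>

lemma sum_fun_apply: "(\<Sum>i\<in>I. f i) x = (\<Sum>i\<in>I. f i x)"
  by (induction I rule: infinite_finite_induct) auto

lemma hpoly_cmonom: "hpoly (\<lambda>w. cmonom \<rho> w)"
proof -
  have pow: "hpoly u \<Longrightarrow> hpoly (\<lambda>w. w $ j ^ m * u w)" for j m and u :: "complex ^ 'a \<Rightarrow> complex"
  proof (induction m)
    case (Suc m)
    then show ?case using hpoly_coord [of "\<lambda>w. w $ j ^ m * u w" j] by (simp add: mult.assoc)
  qed simp
  have "hpoly (\<lambda>w. \<Prod>j\<in>J. w $ j ^ (\<rho> $ j))" for J
    by (induction J rule: infinite_finite_induct) (auto intro: hpoly_const pow)
  then show ?thesis by (simp add: cmonom_def)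
qed

lemma hol_polys_hpoly:
  assumes "u \<in> hol_polys"
  shows "hpoly u"
proof -
  obtain p :: "(nat ^ 'a) \<Rightarrow>\<^sub>0 complex" where
    p: "\<And>w. u w = (\<Sum>\<rho>\<in>Poly_Mapping.keys p. Poly_Mapping.lookup p \<rho> * cmonom \<rho> w)"
    using assms by (auto simp: hol_polys_def)
  have "hpoly (\<lambda>w. \<Sum>\<rho>\<in>Poly_Mapping.keys p. Poly_Mapping.lookup p \<rho> * cmonom \<rho> w)"
    by (intro hpoly_sum hpoly_cmult hpoly_cmonom)
  moreover have "u = (\<lambda>w. \<Sum>\<rho>\<in>Poly_Mapping.keys p. Poly_Mapping.lookup p \<rho> * cmonom \<rho> w)"
    using p by auto
  ultimately show ?thesis by simp
qed

text \<open>A polynomial \<open>p \<noteq> 0\<close> of least degree with \<open>p(A) x = 0\<close> has a root \<open>r\<close>; the cofactor of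
  \<open>X - r\<close> sends \<open>x\<close> to an eigenvector.\<close>

lemma eigenvector_exists:
  fixes A :: "('a \<Rightarrow> complex) \<Rightarrow> 'a \<Rightarrow> complex"
  assumes B: "finite B" and V: "V = cfun.span B" and x: "x \<in> V" "x \<noteq> 0"
    and AV: "\<And>y. y \<in> V \<Longrightarrow> A y \<in> V"
    and add: "\<And>y z. y \<in> V \<Longrightarrow> z \<in> V \<Longrightarrow> A (y + z) = A y + A z"
    and scale: "\<And>c y. y \<in> V \<Longrightarrow> A (fscale c y) = fscale c (A y)"
  shows "\<exists>c y. y \<in> V \<and> y \<noteq> 0 \<and> A y = fscale c y"
proof -
  define y where "y i = (A ^^ i) x" for i
  have sub: "cfun.subspace V" by (simp add: V)
  have y_Suc: "A (y i) = y (Suc i)" for i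
    by (simp add: y_def)
  have yV: "y i \<in> V" for i
    unfolding y_def by (induction i) (auto intro: x AV)
  \<comment> \<open>\<open>ev p\<close> is p(A) x.\<close>
  define ev where "ev p = (\<Sum>i\<le>degree p. fscale (coeff p i) (y i))" for p
  have ev: "ev p = (\<Sum>i\<le>N. fscale (coeff p i) (y i))" if "N \<ge> degree p" for p N
    unfolding ev_def using that
    by (intro sum.mono_neutral_left) (auto simp: coeff_eq_0)
  have evV: "ev p \<in> V" for p
    unfolding ev_def by (intro cfun.subspace_sum [OF sub] cfun.subspace_scale [OF sub] yV)
  have A0: "A 0 = 0"
    using scale [OF x(1), of 0] by simp
  have A_sum: "A (\<Sum>i\<in>I. fscale (c i) (y i)) = (\<Sum>i\<in>I. fscale (c i) (y (Suc i)))" for I and c :: "nat \<Rightarrow> complex"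
  proof (induction I rule: infinite_finite_induct)
    case (insert i I)
    have "A (fscale (c i) (y i) + (\<Sum>i\<in>I. fscale (c i) (y i))) = fscale (c i) (A (y i)) + A (\<Sum>i\<in>I. fscale (c i) (y i))"
      by (simp add: add scale yV cfun.subspace_sum [OF sub] cfun.subspace_scale [OF sub])
    then show ?case by (simp only: sum.insert [OF insert.hyps(1,2)] insert.IH y_Suc)
  next
    case (infinite I)
    then show ?case by (simp only: sum.infinite A0 not_False_eq_True)
  qed (simp only: sum.empty A0)
  have ev_mult: "ev ([:- r, 1:] * q) = A (ev q) - fscale r (ev q)" for r q
  proof -
    let ?N = "degree q"
    have "degree ([:- r, 1:] * q) \<le> Suc ?N"
      using degree_mult_le [of "[:- r, 1:]" q] by simp
    then have "ev ([:- r, 1:] * q) = (\<Sum>i\<le>Suc ?N. fscale (coeff ([:- r, 1:] * q) i) (y i))"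
      by (rule ev)
    also have "\<dots> = (\<Sum>i\<le>Suc ?N. fscale (coeff (pCons 0 q) i) (y i) - fscale r (fscale (coeff q i) (y i)))"
      by (intro sum.cong refl) (simp add: cfun.scale_left_diff_distrib [symmetric])
    also have "\<dots> = (\<Sum>i\<le>Suc ?N. fscale (coeff (pCons 0 q) i) (y i)) - fscale r (\<Sum>i\<le>Suc ?N. fscale (coeff q i) (y i))"
      by (simp only: sum_subtractf cfun.scale_sum_right)
    also have "(\<Sum>i\<le>Suc ?N. fscale (coeff q i) (y i)) = ev q"
      by (rule ev [symmetric]) simp
    also have "(\<Sum>i\<le>Suc ?N. fscale (coeff (pCons 0 q) i) (y i)) = (\<Sum>i\<le>?N. fscale (coeff q i) (y (Suc i)))"
      by (subst sum.atMost_Suc_shift) simp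
    also have "\<dots> = A (ev q)"
      by (simp add: A_sum ev_def)
    finally show ?thesis .
  qed
  have "\<exists>p. p \<noteq> 0 \<and> ev p = 0"
  proof -
    have witness: "\<exists>p. p \<noteq> 0 \<and> ev p = 0"
      if "j \<le> N" "c j \<noteq> 0" "(\<Sum>i\<le>N. fscale (c i) (y i)) = 0" for c :: "nat \<Rightarrow> complex" and j N
    proof -
      let ?p = "\<Sum>i\<le>N. monom (c i) i"
      have coeff: "coeff ?p i = (if i \<le> N then c i else 0)" for i
        by (simp add: coeff_sum)
      then have "degree ?p \<le> N"
        by (intro degree_le) auto
      then have "ev ?p = (\<Sum>i\<le>N. fscale (c i) (y i))"
        by (subst ev [of _ N]) (auto simp: coeff)
      moreover have "?p \<noteq> 0"
        using coeff [of j] that by auto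
      ultimately show ?thesis using that by auto
    qed
    \<comment> \<open>The powers from 0 to \<open>card B\<close> give one vector more than the
      spanning set has. Dependence is a notion for sets, so a repetition among these vectors is
      treated separately.\<close>
    let ?n = "card B"
    show ?thesis
    proof (cases "inj_on y {..?n}")
      case False
      then obtain i j where ij: "i \<le> ?n" "j \<le> ?n" "i \<noteq> j" "y i = y j"
        by (auto simp: inj_on_def)
      let ?c = "\<lambda>k. if k = i then 1 else if k = j then - 1 else 0 :: complex"
      have "(\<Sum>k\<le>?n. fscale (?c k) (y k)) = (\<Sum>k\<in>{i, j}. fscale (?c k) (y k))"
        using ij by (intro sum.mono_neutral_right) auto
      also have "\<dots> = 0"
        using ij by (simp add: cfun.scale_minus_left)
      finally show ?thesis
        using ij by (intro witness [of i ?n ?c]) auto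
    next
      case True
      then have card: "card (y ` {..?n}) = Suc ?n"
        by (simp add: card_image)
      have "cfun.dependent (y ` {..?n})"
      proof (rule ccontr)
        assume "cfun.independent (y ` {..?n})"
        moreover have "y ` {..?n} \<subseteq> cfun.span B"
          using yV by (auto simp: V)
        ultimately have "card (y ` {..?n}) \<le> card B"
          using cfun.independent_span_bound [OF B] by blast
        then show False using card by simp
      qed
      then obtain f where f: "\<exists>v\<in>y ` {..?n}. f v \<noteq> 0" "(\<Sum>v\<in>y ` {..?n}. fscale (f v) v) = 0"
        by (auto simp: cfun.dependent_finite)
      have "(\<Sum>i\<le>?n. fscale (f (y i)) (y i)) = 0"
        using f(2) by (simp add: sum.reindex [OF True])
      with f(1) show ?thesis
        using witness [of _ ?n "\<lambda>i. f (y i)"] by auto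
    qed
  qed
  then obtain p where p: "p \<noteq> 0" "ev p = 0"
    and least: "\<And>q. q \<noteq> 0 \<Longrightarrow> ev q = 0 \<Longrightarrow> degree p \<le> degree q"
    using exists_least_iff [of "\<lambda>n. \<exists>p. p \<noteq> 0 \<and> ev p = 0 \<and> degree p = n"]
    by (metis (mono_tags, lifting) linorder_not_le)
  \<comment> \<open>A constant annihilator c would give c x = 0 with both c and x nonzero.\<close>
  have "degree p \<noteq> 0"
  proof
    assume "degree p = 0"
    then obtain c where c: "p = [:c:]" by (auto elim: degree_eq_zeroE)
    with p x show False by (auto simp: ev_def y_def)
  qed
  then obtain r where "poly p r = 0"
    using fundamental_theorem_of_algebra [of p] by (auto simp: constant_degree)
  then obtain q where q: "p = [:- r, 1:] * q"
    by (auto simp: poly_eq_0_iff_dvd elim: dvdE)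
  with p have "q \<noteq> 0" by auto
  then have "degree p = Suc (degree q)"
    unfolding q by (subst degree_mult_eq) auto
  with least [OF \<open>q \<noteq> 0\<close>] have "ev q \<noteq> 0" by auto
  moreover have "A (ev q) = fscale r (ev q)"
    using p(2) ev_mult [of r q] by (simp add: q)
  ultimately show ?thesis using evV by blast
qed

text \<open>The matrix that \<open>k\<close> becomes after the substitution \<open>fock_arg\<close>;
  see \<open>fock_arg_matrix\<close>.\<close>

definition fock_mat :: "real \<Rightarrow> complex ^ 'n ^ 'n \<Rightarrow> complex ^ 'n ^ 'n" where
  "fock_mat lam k = (if lam > 0 then mcnj k else k)"

lemma fock_act_eq: "fock_act lam k u = (\<lambda>w. u (fock_mat lam (matrix_inv k) *v w))"
  by (simp add: fock_act_def fock_mat_def)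

lemma unitary_fock_mat: "unitary k \<Longrightarrow> unitary (fock_mat lam k)"
  by (simp add: fock_mat_def unitary_mcnj)

lemma fock_mat_mult: "fock_mat lam (k ** k') = fock_mat lam k ** fock_mat lam k'"
  by (simp add: fock_mat_def mcnj_mult)

lemma fock_arg_matrix: "fock_arg lam (k *v z) = fock_mat lam k *v fock_arg lam z"
proof -
  have "vcnj (k *v z) = mcnj k *v vcnj z"
    by (simp add: vcnj_def mcnj_def matrix_vector_mult_def vec_eq_iff)
  moreover have "mcnj k *v (- vcnj z) = - (mcnj k *v vcnj z)"
    by (simp add: matrix_vector_mult_def vec_eq_iff sum_negf)
  ultimately show ?thesis by (simp add: fock_arg_def fock_mat_def)
qed

section \<open>One irreducible summand with an orthonormal basis\<close>

locale fock_average =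
  fixes lam :: real and K :: "(complex ^ 'n ^ 'n) set" and \<mu> :: "(complex ^ 'n ^ 'n) measure"
    and V B :: "(complex ^ 'n \<Rightarrow> complex) set"
  assumes lam: "lam \<noteq> 0" and K: "unitary_subgroup K" and compact: "compact K"
    and haar: "normalized_haar K \<mu>"
    and irreducible: "fock_irreducible lam K V"
    and poly: "\<And>u. u \<in> V \<Longrightarrow> hpoly u"
    and onb: "fock_onb lam V B"
begin

abbreviation F where "F \<equiv> fock_coeff (2 * \<bar>lam\<bar>)"
abbreviation ip where "ip u v \<equiv> F u v 0"
abbreviation act where "act \<equiv> fock_act lam"

lemma a: "2 * \<bar>lam\<bar> > 0"
  using lam by simp

lemma K_unitary: "k \<in> K \<Longrightarrow> unitary k"
  and K_mult: "k \<in> K \<Longrightarrow> k' \<in> K \<Longrightarrow> k ** k' \<in> K"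
  and K_inv: "k \<in> K \<Longrightarrow> matrix_inv k \<in> K"
  using K by (auto simp: unitary_subgroup_def)

lemma K_inv_mult:
  assumes "k \<in> K"
  shows "matrix_inv k ** k = mat 1" "k ** matrix_inv k = mat 1"
  using K_unitary [OF assms] by (simp_all add: unitary_inv unitary_def)

lemma K_inv_inv: "k \<in> K \<Longrightarrow> matrix_inv (matrix_inv k) = k"
  by (intro matrix_inv_unique K_inv_mult)

lemma subspace: "cfun.subspace V" and act_closed: "k \<in> K \<Longrightarrow> u \<in> V \<Longrightarrow> act k u \<in> V"
  and V_nonzero: "V \<noteq> {0}"
  using irreducible by (auto simp: fock_irreducible_def fock_invariant_def)

lemma finite_B: "finite B" and span_B: "cfun.span B = V"
  and B_orth: "b \<in> B \<Longrightarrow> b' \<in> B \<Longrightarrow> ip b b' = (if b = b' then 1 else 0)"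
  using onb by (auto simp: fock_onb_def fock_inner_eq_fock_coeff)

lemma B_subset: "b \<in> B \<Longrightarrow> b \<in> V"
  using span_B cfun.span_base by blast

lemma act_mult:
  assumes "k \<in> K" "k' \<in> K"
  shows "act (k ** k') u = act k (act k' u)"
proof -
  have "matrix_inv (k ** k') = matrix_inv k' ** matrix_inv k"
  proof (rule matrix_inv_unique)
    have "k ** k' ** (matrix_inv k' ** matrix_inv k) = k ** (k' ** matrix_inv k') ** matrix_inv k"
      by (simp only: matrix_mul_assoc)
    then show "k ** k' ** (matrix_inv k' ** matrix_inv k) = mat 1"
      using assms by (simp add: K_inv_mult)
    have "matrix_inv k' ** matrix_inv k ** (k ** k') = matrix_inv k' ** (matrix_inv k ** k) ** k'"
      by (simp only: matrix_mul_assoc)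
    then show "matrix_inv k' ** matrix_inv k ** (k ** k') = mat 1"
      using assms by (simp add: K_inv_mult)
  qed
  then show ?thesis
    by (simp add: fock_act_eq fock_mat_mult matrix_vector_mul_assoc)
qed

lemma act_one:
  fixes u :: "complex ^ 'n \<Rightarrow> complex"
  shows "act (mat 1) u = u"
proof -
  have "matrix_inv (mat 1 :: complex ^ 'n ^ 'n) = mat 1"
    by (intro matrix_inv_unique) auto
  then show ?thesis by (simp add: fock_act_eq fock_mat_def)
qed

lemma act_inv:
  assumes "k \<in> K"
  shows "act (matrix_inv k) (act k u) = u" "act k (act (matrix_inv k) u) = u"
  using assms by (simp_all add: act_mult [symmetric] K_inv K_inv_mult act_one)

text \<open>Coefficient form of covariance: the operator at k z is the one at \<open>z\<close>
  conjugated by \<open>k\<close>.\<close>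

lemma F_act:
  assumes "k \<in> K" "u \<in> V" "v \<in> V"
  shows "F (act (matrix_inv k) u) (act (matrix_inv k) v) z = F u v (fock_mat lam k *v z)"
  using assms by (simp add: fock_act_eq K_inv_inv fock_coeff_unitary unitary_fock_mat K_unitary poly)

lemma ip_act_left:
  assumes "k \<in> K" "u \<in> V" "v \<in> V"
  shows "ip (act k u) v = ip u (act (matrix_inv k) v)"
  using F_act [OF assms(1) act_closed [OF assms(1,2)] assms(3), of 0] assms by (simp add: act_inv)

lemma ip_act_right:
  assumes "k \<in> K" "u \<in> V" "v \<in> V"
  shows "ip u (act k v) = ip (act (matrix_inv k) u) v"
  using ip_act_left [OF K_inv [OF assms(1)] assms(2,3)] assms by (simp add: K_inv_inv)

lemma ip_commute: "u \<in> V \<Longrightarrow> v \<in> V \<Longrightarrow> ip u v = cnj (ip v u)"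
  using fock_coeff_commute [OF poly poly, of u v "2 * \<bar>lam\<bar>" 0] by simp

lemma F_expand:
  assumes "\<And>b. b \<in> B \<Longrightarrow> hpoly (h b)" "hpoly u"
  shows "F u (\<lambda>w. \<Sum>b\<in>B. c b * h b w) z = (\<Sum>b\<in>B. c b * F u (h b) z)"
  using assms a by (subst fock_coeff_sum_right) (auto simp: fock_coeff_cmult_right intro: hpoly_cmult)

lemma F_expand_left:
  assumes "\<And>b. b \<in> B \<Longrightarrow> hpoly (h b)" "hpoly u"
  shows "F (\<lambda>w. \<Sum>b\<in>B. c b * h b w) u z = (\<Sum>b\<in>B. cnj (c b) * F (h b) u z)"
  using assms a by (subst fock_coeff_sum_left) (auto simp: fock_coeff_cmult_left intro: hpoly_cmult)

lemma expand:
  assumes "v \<in> V"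
  shows "v = (\<lambda>w. \<Sum>b\<in>B. ip b v * b w)"
proof -
  obtain c where c: "v = (\<Sum>b\<in>B. fscale (c b) b)"
    using assms unfolding span_B [symmetric] cfun.span_finite [OF finite_B] by auto
  then have v: "v = (\<lambda>w. \<Sum>b\<in>B. c b * b w)"
    by (auto simp: sum_fun_apply fscale_def)
  have "ip b v = c b" if "b \<in> B" for b
  proof -
    have "ip b v = (\<Sum>b'\<in>B. c b' * ip b b')"
      unfolding v by (rule F_expand) (use that B_subset poly in auto)
    also have "\<dots> = (\<Sum>b'\<in>B. if b' = b then c b else 0)"
      using that by (intro sum.cong) (auto simp: B_orth)
    finally show ?thesis using that finite_B by simp
  qed
  then show ?thesis using v by (simp cong: sum.cong)
qed

lemma combination_in_V: "(\<lambda>w. \<Sum>b\<in>B. c b * b w) \<in> V"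
proof -
  have "(\<Sum>b\<in>B. fscale (c b) b) \<in> V"
    by (intro cfun.subspace_sum [OF subspace] cfun.subspace_scale [OF subspace] B_subset)
  moreover have "(\<Sum>b\<in>B. fscale (c b) b) = (\<lambda>w. \<Sum>b\<in>B. c b * b w)"
    by (auto simp: sum_fun_apply fscale_def)
  ultimately show ?thesis by simp
qed

lemma ip_parseval:
  assumes "u \<in> V" "v \<in> V"
  shows "ip u v = (\<Sum>b\<in>B. ip u b * ip b v)"
proof -
  have "ip u v = ip u (\<lambda>w. \<Sum>b\<in>B. ip b v * b w)"
    using expand [OF assms(2)] by simp
  also have "\<dots> = (\<Sum>b\<in>B. ip b v * ip u b)"
    by (rule F_expand) (use assms B_subset poly in auto)
  finally show ?thesis by (simp add: mult.commute)
qed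

lemma eqI:
  assumes "u \<in> V" "v \<in> V" "\<And>b. b \<in> B \<Longrightarrow> ip b u = ip b v"
  shows "u = v"
proof -
  have "u = (\<lambda>w. \<Sum>b\<in>B. ip b u * b w)" by (rule expand [OF assms(1)])
  also have "\<dots> = (\<lambda>w. \<Sum>b\<in>B. ip b v * b w)"
    using assms(3) by (simp cong: sum.cong)
  also have "\<dots> = v" by (rule expand [OF assms(2), symmetric])
  finally show ?thesis .
qed

lemma card_B: "card B > 0"
proof (rule ccontr)
  assume "\<not> card B > 0"
  then have "B = {}" using finite_B by auto
  then show False using span_B V_nonzero by (simp add: cfun.span_empty)
qed

section \<open>Integration over \<open>K\<close>\<close>

lemma sets_haar: "sets \<mu> = sets (restrict_space borel K)"
  and emeasure_haar: "emeasure \<mu> K = 1"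
  and distr_haar: "k \<in> K \<Longrightarrow> distr \<mu> \<mu> (\<lambda>k'. k ** k') = \<mu>"
  using haar by (auto simp: normalized_haar_def)

lemma space_haar: "space \<mu> = K"
  using sets_eq_imp_space_eq [OF sets_haar] by (simp add: space_restrict_space)

lemma measurable_haar: "continuous_on K (f :: _ \<Rightarrow> complex) \<Longrightarrow> f \<in> borel_measurable \<mu>"
  using borel_measurable_continuous_on_restrict [of K f] measurable_cong_sets [OF sets_haar refl] by auto

lemma integrable_haar:
  fixes f :: "complex ^ 'n ^ 'n \<Rightarrow> complex"
  assumes "continuous_on K f"
  shows "integrable \<mu> f"
proof -
  interpret finite_measure \<mu>
    by (rule finite_measureI) (simp add: space_haar emeasure_haar)
  have "bounded (f ` K)"
    by (intro compact_imp_bounded compact_continuous_image assms compact)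
  then obtain C where "\<forall>k\<in>K. norm (f k) \<le> C"
    by (auto simp: bounded_iff)
  then show ?thesis
    by (intro integrable_const_bound [of _ C] measurable_haar assms) (auto simp: space_haar)
qed

lemma integral_haar_const: "(LINT k|\<mu>. c) = (c :: complex)"
  by (simp add: measure_def space_haar emeasure_haar)

lemma integral_haar_translate:
  fixes f :: "complex ^ 'n ^ 'n \<Rightarrow> complex"
  assumes "k \<in> K" "continuous_on K f"
  shows "(LINT k'|\<mu>. f (k ** k')) = (LINT k'|\<mu>. f k')"
proof -
  have "continuous_on K (\<lambda>k'. k ** k')"
    unfolding matrix_matrix_mult_def by (intro continuous_intros)
  then have "(\<lambda>k'. k ** k') \<in> restrict_space borel K \<rightarrow>\<^sub>M restrict_space borel K"
    using assms by (intro measurable_restrict_space2 borel_measurable_continuous_on_restrict)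
      (auto simp: space_restrict_space K_mult)
  then have "(\<lambda>k'. k ** k') \<in> \<mu> \<rightarrow>\<^sub>M \<mu>"
    using measurable_cong_sets [OF sets_haar sets_haar] by simp
  then have "(LINT k'|distr \<mu> \<mu> (\<lambda>k'. k ** k'). f k') = (LINT k'|\<mu>. f (k ** k'))"
    by (intro integral_distr measurable_haar assms)
  then show ?thesis using distr_haar [OF assms(1)] by simp
qed

lemma continuous_ip_act:
  assumes "u \<in> V" "v \<in> V"
  shows "continuous_on K (\<lambda>k. ip u (act k v))" "continuous_on K (\<lambda>k. ip (act k v) u)"
proof -
  have "continuous_on UNIV (\<lambda>A. ip u (\<lambda>w. v (A *v w)))"
    by (intro continuous_on_fock_coeff_matrix a poly assms)
  \<comment> \<open>\<open>matrix_inv\<close> is defined by choice; on \<open>K\<close> it is the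
    conjugate transpose, whose entries are visibly continuous.\<close>
  moreover have "continuous_on K (\<lambda>k. fock_mat lam (transpose (mcnj k)))"
    unfolding fock_mat_def transpose_def mcnj_def
    by (cases "lam > 0") (auto intro!: continuous_intros)
  ultimately have "continuous_on K (\<lambda>k. ip u (\<lambda>w. v (fock_mat lam (transpose (mcnj k)) *v w)))"
    by (rule continuous_on_compose2) auto
  then show c: "continuous_on K (\<lambda>k. ip u (act k v))"
    by (rule continuous_on_eq) (simp add: fock_act_eq unitary_inv K_unitary)
  have "continuous_on K (\<lambda>k. cnj (ip u (act k v)))"
    by (intro continuous_intros c)
  then show "continuous_on K (\<lambda>k. ip (act k v) u)"
    by (rule continuous_on_eq) (metis act_closed assms ip_commute)
qed

text \<open>As a form in \<open>y\<close> and \<open>x\<close>, the integral is given by an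
  operator: the average, over conjugation by \<open>K\<close>, of the rank one operator that sends x
  to <q, x> p. It commutes with \<open>K\<close>, so irreducibility makes it a scalar, and its trace
  determines the scalar.\<close>

lemma schur_average:
  assumes p: "p \<in> V" and q: "q \<in> V" and y: "y \<in> V" and x: "x \<in> V"
  shows "(LINT k|\<mu>. ip y (act k p) * ip (act k q) x) = ip q p * ip y x / of_nat (card B)"
proof -
  define J where "J y x = (LINT k|\<mu>. ip y (act k p) * ip (act k q) x)" for y x
  have cont: "continuous_on K (\<lambda>k. ip y (act k p) * ip (act k q) x)" if "y \<in> V" "x \<in> V" for x y
    by (intro continuous_on_mult continuous_ip_act p q that)
  note int = integrable_haar [OF cont]
  \<comment> \<open>The averaged operator, built from its coordinates in \<open>B\<close>, so that
    only scalar functions are integrated.\<close>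
  define A where "A x = (\<lambda>w. \<Sum>b\<in>B. J b x * b w)" for x
  have AV: "A x \<in> V" for x
    unfolding A_def by (rule combination_in_V)
  have J: "ip y (A x) = J y x" if y: "y \<in> V" and x: "x \<in> V" for y x
  proof -
    have "ip y (A x) = (\<Sum>b\<in>B. J b x * ip y b)"
      unfolding A_def by (rule F_expand) (use y B_subset poly in auto)
    also have "\<dots> = (\<Sum>b\<in>B. LINT k|\<mu>. ip y b * (ip b (act k p) * ip (act k q) x))"
      by (simp add: J_def mult.commute)
    also have "\<dots> = (LINT k|\<mu>. (\<Sum>b\<in>B. ip y b * (ip b (act k p) * ip (act k q) x)))"
      by (intro Bochner_Integration.integral_sum [symmetric] integrable_mult_right int B_subset x)
    also have "\<dots> = J y x"
      unfolding J_def
    proof (intro Bochner_Integration.integral_cong refl)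
      fix k assume "k \<in> space \<mu>"
      then have "ip y (act k p) = (\<Sum>b\<in>B. ip y b * ip b (act k p))"
        by (intro ip_parseval y act_closed p) (simp add: space_haar)
      then show "(\<Sum>b\<in>B. ip y b * (ip b (act k p) * ip (act k q) x)) = ip y (act k p) * ip (act k q) x"
        by (simp add: sum_distrib_right mult.assoc)
    qed
    finally show ?thesis .
  qed
  have Jact: "J (act (matrix_inv k0) y) x = J y (act k0 x)" if k0: "k0 \<in> K" and y: "y \<in> V" and x: "x \<in> V" for k0 y x
  proof -
    \<comment> \<open>Left invariance replaces \<open>k\<close> by k0 k; unitarity then removes
      \<open>k0\<close> from the second factor and moves it to \<open>y\<close> in the
      first.\<close>
    have "J y (act k0 x) = (LINT k|\<mu>. ip y (act (k0 ** k) p) * ip (act (k0 ** k) q) (act k0 x))"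
      unfolding J_def by (intro integral_haar_translate [symmetric] k0 cont y act_closed x)
    also have "\<dots> = J (act (matrix_inv k0) y) x"
      unfolding J_def
    proof (intro Bochner_Integration.integral_cong refl)
      fix k assume "k \<in> space \<mu>"
      then have k: "k \<in> K" by (simp add: space_haar)
      have "ip y (act (k0 ** k) p) = ip (act (matrix_inv k0) y) (act k p)"
        using k k0 y p by (simp add: act_mult ip_act_right act_closed)
      moreover have "ip (act (k0 ** k) q) (act k0 x) = ip (act k q) x"
        using k k0 x q by (simp add: act_mult ip_act_left act_closed act_inv)
      ultimately show "ip y (act (k0 ** k) p) * ip (act (k0 ** k) q) (act k0 x) =
          ip (act (matrix_inv k0) y) (act k p) * ip (act k q) x" by simp
    qed
    finally show ?thesis ..
  qed
  have Aact: "A (act k0 x) = act k0 (A x)" if k0: "k0 \<in> K" and x: "x \<in> V" for k0 x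
  proof (rule eqI)
    fix b assume "b \<in> B"
    then have b: "b \<in> V" by (rule B_subset)
    have "ip b (A (act k0 x)) = J b (act k0 x)"
      by (intro J b act_closed k0 x)
    also have "\<dots> = ip (act (matrix_inv k0) b) (A x)"
      using b k0 x by (simp add: J Jact act_closed K_inv)
    also have "\<dots> = ip b (act k0 (A x))"
      using b k0 AV by (simp add: ip_act_right)
    finally show "ip b (A (act k0 x)) = ip b (act k0 (A x))" .
  qed (use AV act_closed k0 in auto)
  have add: "A (y + z) = A y + A z" if "y \<in> V" "z \<in> V" for y z
  proof (rule eqI)
    have yz: "y + z = (\<lambda>w. y w + z w)" "A y + A z = (\<lambda>w. A y w + A z w)" by auto
    fix b assume "b \<in> B"
    then have b: "b \<in> V" by (rule B_subset)
    have "J b (y + z) = (LINT k|\<mu>. ip b (act k p) * ip (act k q) y + ip b (act k p) * ip (act k q) z)"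
      unfolding J_def yz
      by (intro Bochner_Integration.integral_cong refl)
        (simp add: fock_coeff_add_right a poly that act_closed q space_haar distrib_left)
    also have "\<dots> = J b y + J b z"
      unfolding J_def by (intro Bochner_Integration.integral_add int b that)
    finally show "ip b (A (y + z)) = ip b (A y + A z)"
      using b that by (simp add: J cfun.subspace_add [OF subspace])
        (simp add: yz(2) fock_coeff_add_right a poly AV J)
  qed (use AV cfun.subspace_add [OF subspace] in auto)
  have scale: "A (fscale c y) = fscale c (A y)" if "y \<in> V" for c y
  proof (rule eqI)
    fix b assume "b \<in> B"
    then have b: "b \<in> V" by (rule B_subset)
    have "J b (fscale c y) = c * J b y"
      unfolding J_def fscale_def by (simp add: fock_coeff_cmult_right mult.left_commute)
    then show "ip b (A (fscale c y)) = ip b (fscale c (A y))"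
      using b that by (simp add: J cfun.subspace_scale [OF subspace])
        (simp add: fscale_def fock_coeff_cmult_right J)
  qed (use AV cfun.subspace_scale [OF subspace] in auto)
  obtain x0 where "x0 \<in> V" "x0 \<noteq> 0"
    using V_nonzero cfun.subspace_0 [OF subspace] by blast
  then obtain c x1 where x1: "x1 \<in> V" "x1 \<noteq> 0" "A x1 = fscale c x1"
    using eigenvector_exists [OF finite_B span_B [symmetric], of x0 A] AV add scale by blast
  \<comment> \<open>An eigenspace of an operator that commutes with \<open>K\<close> is invariant,
    hence all of \<open>V\<close>.\<close>
  define E where "E = {x \<in> V. A x = fscale c x}"
  have "fock_invariant lam K E"
    unfolding fock_invariant_def
  proof (intro conjI ballI)
    have "A 0 = 0"
      using scale [OF x1(1), of 0] by simp
    then show "cfun.subspace E"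
      unfolding cfun.subspace_def E_def
      using add scale cfun.subspace_add [OF subspace] cfun.subspace_scale [OF subspace] cfun.subspace_0 [OF subspace]
      by (auto simp: cfun.scale_right_distrib cfun.scale_left_commute)
    fix k x assume k: "k \<in> K" and x: "x \<in> E"
    have "act k (fscale c x) = fscale c (act k x)"
      by (simp add: fock_act_def fscale_def)
    then show "act k x \<in> E"
      using k x by (auto simp: E_def Aact act_closed)
  qed
  moreover have "E \<subseteq> V" "E \<noteq> {0}"
    using x1 by (auto simp: E_def)
  ultimately have "E = V"
    using irreducible by (auto simp: fock_irreducible_def)
  have Jc: "J y x = c * ip y x" if "y \<in> V" "x \<in> V" for y x
  proof -
    have "A x = fscale c x"
      using that \<open>E = V\<close> by (auto simp: E_def)
    then show ?thesis
      using J [OF that] by (simp add: fscale_def fock_coeff_cmult_right)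
  qed
  \<comment> \<open>The trace in two ways: c times the dimension, and the integral of <k q, k p>,
    which is constantly <q, p>.\<close>
  have "c * of_nat (card B) = (\<Sum>b\<in>B. J b b)"
    using Jc B_orth B_subset by (simp add: mult.commute)
  also have "\<dots> = (LINT k|\<mu>. (\<Sum>b\<in>B. ip b (act k p) * ip (act k q) b))"
    unfolding J_def by (intro Bochner_Integration.integral_sum [symmetric] int B_subset)
  also have "\<dots> = (LINT k|\<mu>. ip q p)"
  proof (intro Bochner_Integration.integral_cong refl)
    fix k assume "k \<in> space \<mu>"
    then have k: "k \<in> K" by (simp add: space_haar)
    have "ip (act k q) (act k p) = ip q p"
      using k p q by (simp add: ip_act_left act_closed act_inv)
    then show "(\<Sum>b\<in>B. ip b (act k p) * ip (act k q) b) = ip q p"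
      using ip_parseval [of "act k q" "act k p"] k p q by (simp add: act_closed mult.commute)
  qed
  also have "\<dots> = ip q p"
    by (rule integral_haar_const)
  finally have "c = ip q p / of_nat (card B)"
    using card_B by (simp add: field_simps)
  then show ?thesis
    using Jc [OF y x] by (simp add: J_def)
qed

text \<open>Covariance moves \<open>k\<close> from \<open>z\<close> to the vector. Expanding the
  translated unit vector in \<open>B\<close> leaves products of two matrix entries, whose averages
  are 1 / card B on the diagonal and 0 off it.\<close>

lemma averaged_coeff_eq:
  assumes u: "u \<in> V" and unit: "fock_inner lam u u = 1"
  shows "averaged_coeff lam \<mu> u z = (\<Sum>b\<in>B. F b b (fock_arg lam z)) / of_nat (card B)"
proof -
  let ?z = "fock_arg lam z"
  have cont: "continuous_on K (\<lambda>k. ip u (act k b) * ip (act k b') u)" if "b \<in> B" "b' \<in> B" for b b'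
    by (intro continuous_on_mult continuous_ip_act u B_subset that)
  have int: "integrable \<mu> (\<lambda>k. ip u (act k b) * ip (act k b') u * F b b' ?z)" if "b \<in> B" "b' \<in> B" for b b'
    by (intro integrable_mult_left integrable_haar cont that)
  have "averaged_coeff lam \<mu> u z = (LINT k|\<mu>. (\<Sum>b\<in>B. \<Sum>b'\<in>B. ip u (act k b) * ip (act k b') u * F b b' ?z))"
    unfolding averaged_coeff_def
  proof (intro Bochner_Integration.integral_cong refl)
    fix k assume "k \<in> space \<mu>"
    then have k: "k \<in> K" by (simp add: space_haar)
    define x where "x = act (matrix_inv k) u"
    have xV: "x \<in> V" unfolding x_def by (intro act_closed K_inv k u)
    have c: "ip b x = ip (act k b) u" "cnj (ip (act k b) u) = ip u (act k b)" if "b \<in> B" for b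
    proof -
      show "ip b x = ip (act k b) u"
        unfolding x_def by (intro ip_act_left [symmetric] k u B_subset that)
      show "cnj (ip (act k b) u) = ip u (act k b)"
        using ip_commute [OF u act_closed [OF k B_subset [OF that]]] by simp
    qed
    have "fock_inner lam (fock_rep lam (k *v z) u) u = F x x ?z"
      using k u by (simp add: fock_inner_fock_rep lam fock_arg_matrix F_act x_def)
    also have "\<dots> = F (\<lambda>w. \<Sum>b\<in>B. ip b x * b w) (\<lambda>w. \<Sum>b\<in>B. ip b x * b w) ?z"
      using expand [OF xV] by simp
    also have "\<dots> = (\<Sum>b\<in>B. cnj (ip b x) * F b (\<lambda>w. \<Sum>b\<in>B. ip b x * b w) ?z)"
      by (intro F_expand_left poly B_subset combination_in_V)
    also have "\<dots> = (\<Sum>b\<in>B. cnj (ip b x) * (\<Sum>b'\<in>B. ip b' x * F b b' ?z))"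
      by (intro sum.cong refl arg_cong2 [where f = "(*)"] F_expand poly B_subset)
    also have "\<dots> = (\<Sum>b\<in>B. \<Sum>b'\<in>B. ip u (act k b) * ip (act k b') u * F b b' ?z)"
      by (simp add: c sum_distrib_left mult.assoc)
    finally show "fock_inner lam (fock_rep lam (k *v z) u) u =
        (\<Sum>b\<in>B. \<Sum>b'\<in>B. ip u (act k b) * ip (act k b') u * F b b' ?z)" .
  qed
  also have "\<dots> = (\<Sum>b\<in>B. \<Sum>b'\<in>B. LINT k|\<mu>. ip u (act k b) * ip (act k b') u * F b b' ?z)"
    using int by (simp add: Bochner_Integration.integral_sum)
  also have "\<dots> = (\<Sum>b\<in>B. \<Sum>b'\<in>B. if b' = b then F b b ?z / of_nat (card B) else 0)"
  proof (intro sum.cong refl)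
    fix b b' assume b: "b \<in> B" "b' \<in> B"
    have "ip u u = 1" using unit by (simp add: fock_inner_eq_fock_coeff)
    then have "(LINT k|\<mu>. ip u (act k b) * ip (act k b') u) = (if b' = b then 1 else 0) / of_nat (card B)"
      using b by (subst schur_average) (auto simp: u B_subset B_orth)
    then show "(LINT k|\<mu>. ip u (act k b) * ip (act k b') u * F b b' ?z) =
        (if b' = b then F b b ?z / of_nat (card B) else 0)"
      by simp
  qed
  also have "\<dots> = (\<Sum>b\<in>B. F b b ?z) / of_nat (card B)"
    using finite_B by (simp add: sum_divide_distrib)
  finally show ?thesis .
qed

text \<open>In the squared norm of the trace only the pairs with b = b' survive, and there are
  \<open>card B\<close> of them. The square of \<open>card B\<close> from the averaged coefficient
  thus loses one factor.\<close>

lemma kappa_eq: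
  assumes u: "u \<in> V" and unit: "fock_inner lam u u = 1"
  shows "of_real (kappa lam \<mu> u) = (of_real ((pi / (2 * \<bar>lam\<bar>)) ^ CARD('n)) / of_nat (card B) :: complex)"
proof -
  let ?d = "of_nat (card B) :: complex"
  define f where "f z = (\<Sum>b\<in>B. \<Sum>b'\<in>B. F b b z * cnj (F b' b' z))" for z
  have hB: "hpoly b" if "b \<in> B" for b
    using that B_subset poly by blast
  have gd: "gauss_decay (\<lambda>z. F b b z * cnj (F b' b' z))" if "b \<in> B" "b' \<in> B" for b b'
    by (intro gauss_decay_mult gauss_decay_cnj gauss_decay_fock_coeff a hB [OF that(1)] hB [OF that(2)])
  have "(\<lambda>z. of_real ((norm (averaged_coeff lam \<mu> u z))\<^sup>2)) = (\<lambda>z. f (fock_arg lam z) / (?d * ?d))"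
    by (simp only: complex_norm_square averaged_coeff_eq [OF u unit])
      (simp add: f_def cnj_sum sum_product)
  then have "complex_of_real (kappa lam \<mu> u) = (LINT z|lborel. f (fock_arg lam z) / (?d * ?d))"
    unfolding kappa_def integral_complex_of_real [symmetric] by (simp only:)
  also have "\<dots> = (LINT z|lborel. f (fock_arg lam z)) / (?d * ?d)"
    by simp
  also have "(LINT z|lborel. f (fock_arg lam z)) = (LINT z|lborel. f z)"
    unfolding f_def
    by (intro integral_lborel_orthogonal orthogonal_transformation_fock_arg gauss_decay_measurable
        gauss_decay_sum gd)
  also have "\<dots> = (\<Sum>b\<in>B. \<Sum>b'\<in>B. LINT z|lborel. F b b z * cnj (F b' b' z))"
    using gd [THEN gauss_decay_integrable] unfolding f_def by (simp add: Bochner_Integration.integral_sum)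
  also have "\<dots> = (\<Sum>b\<in>B. \<Sum>b'\<in>B. if b' = b then of_real ((pi / (2 * \<bar>lam\<bar>)) ^ CARD('n)) else 0)"
    by (intro sum.cong refl) (auto simp: fock_coeff_orthogonality a hB B_orth)
  also have "\<dots> = ?d * of_real ((pi / (2 * \<bar>lam\<bar>)) ^ CARD('n))"
    using finite_B by simp
  finally show ?thesis
    using card_B by (simp add: field_simps)
qed

text \<open>The dimension divides the averaged coefficient and \<open>kappa\<close> alike and
  cancels, which leaves a constant independent of \<open>V\<close>.\<close>

lemma psi_eq:
  assumes "u \<in> V" "fock_inner lam u u = 1"
  shows "psi lam \<mu> u = (\<lambda>z. of_real (pi powi (- int CARD('n)) * (2 * \<bar>lam\<bar>) ^ CARD('n)) *
    (\<Sum>b\<in>B. F b b (fock_arg lam z)))"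
proof
  fix z
  define N where "N = (pi / (2 * \<bar>lam\<bar>)) ^ CARD('n)"
  have N: "pi powi (- int CARD('n)) * (2 * \<bar>lam\<bar>) ^ CARD('n) = 1 / N"
    by (simp add: N_def power_int_minus power_divide inverse_eq_divide)
  have cancel: "s / d / (c / d) = 1 / c * s" if "d \<noteq> 0" for s d c :: complex
    using that by simp
  have "psi lam \<mu> u z = of_real (1 / N) * (\<Sum>b\<in>B. F b b (fock_arg lam z))"
    unfolding psi_def averaged_coeff_eq [OF assms] kappa_eq [OF assms] N_def [symmetric] of_real_divide of_real_1
    using card_B by (intro cancel) simp
  then show "psi lam \<mu> u z = of_real (pi powi (- int CARD('n)) * (2 * \<bar>lam\<bar>) ^ CARD('n)) *
      (\<Sum>b\<in>B. F b b (fock_arg lam z))"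
    unfolding N .
qed

text \<open>Both halves of the theorem are instances of this identity, the first with an entry of
  \<open>P\<close> for \<open>p\<close>.\<close>

lemma theta_psi:
  assumes "u \<in> V" "fock_inner lam u u = 1"
  shows "theta lam p (psi lam \<mu> u) z = of_real (pi powi (- int CARD('n)) * (2 * \<bar>lam\<bar>) ^ CARD('n)) *
    op_pairing lam B (fock_rep lam z) (weyl lam p)"
proof -
  have "\<And>b. b \<in> B \<Longrightarrow> hpoly b"
    using B_subset poly by blast
  then show ?thesis
    unfolding psi_eq [OF assms] op_pairing_def fock_inner_fock_rep [OF lam]
    by (rule theta_fock_coeff_sum [OF lam])
qed

end

theorem proposition7p15:
  fixes K :: "(complex ^ 'n ^ 'n) set"
    and \<mu> :: "(complex ^ 'n ^ 'n) measure"
    and M :: "(complex ^ 'n ^ 'n) set"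
    and l :: nat
    and P :: "nat \<Rightarrow> nat \<Rightarrow> 'n cpoly"
    and T :: "(complex ^ 'n) set"
    and lam :: real
    and \<Lambda> :: "'a set"
    and V :: "'a \<Rightarrow> (complex ^ 'n \<Rightarrow> complex) set"
    and \<alpha> :: 'a
    and u :: "complex ^ 'n \<Rightarrow> complex"
    and B :: "(complex ^ 'n \<Rightarrow> complex) set"
    and \<delta> :: "complex ^ 'n ^ 'n \<Rightarrow> complex ^ 'd ^ 'd"
    and v :: "nat \<Rightarrow> complex ^ 'd"
    and v' :: "nat \<Rightarrow> complex ^ 'd \<Rightarrow> complex"
    and \<eta> :: "nat \<Rightarrow> (complex ^ 'd \<Rightarrow> complex) \<Rightarrow> 'n cpoly"
  assumes "unitary_subgroup K" and "compact K" and "connected K"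
    and "gelfand_pair K"
    and "polar_section K T" and "M = fixer K T"
    and "normalized_haar K \<mu>"
    and "lam \<noteq> 0"
    and "polys_decomposition lam K \<Lambda> V" and "\<alpha> \<in> \<Lambda>"
    and "u \<in> V \<alpha>" and "fock_inner lam u u = 1"
    and "fock_onb lam (V \<alpha>) B"
    and "\<delta> \<in> khat K M"
    and "l = vec.dim (fixed_space M \<delta>)"
    and "adapted_onb M \<delta> v" and "is_dual_basis v v'"
    and "Hom_basis K \<delta> l \<eta>" and "P = Pmat \<eta> v'"
  shows "(\<forall>i<CARD('d). \<forall>j<l. \<forall>z. Psi lam \<mu> u P i j z =
            of_real (pi powi (- int CARD('n)) * (2 * \<bar>lam\<bar>) ^ CARD('n)) * Phi lam B P i j z)
       \<and> (\<forall>p\<in>H_check K \<delta>. \<forall>z. theta lam p (psi lam \<mu> u) z =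
            of_real (pi powi (- int CARD('n)) * (2 * \<bar>lam\<bar>) ^ CARD('n)) *
              op_pairing lam B (fock_rep lam z) (weyl lam p))"
proof -
  \<comment> \<open>A summand lies in the span of all summands, which is \<open>hol_polys\<close>;
    this supplies the \<open>hpoly\<close> assumption of the locale.\<close>
  have dec: "fock_irreducible lam K (V \<alpha>)" "V \<alpha> \<subseteq> hol_polys"
    using assms(9,10) cfun.span_superset [of "\<Union>\<alpha>\<in>\<Lambda>. V \<alpha>"]
    by (auto simp: polys_decomposition_def)
  interpret fock_average lam K \<mu> "V \<alpha>" B
    by unfold_locales (use assms dec hol_polys_hpoly in auto)
  show ?thesis
    using theta_psi [OF assms(11,12)] by (simp add: Psi_def Phi_def)
qed

end
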